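(* Let $d \ge 1$ and let $M \in \mathcal G$. Then the following statements are equivalent. 1. $\rho_{\mathrm{HS}}(M) < 1$. 2. The system $\Sigma_M$ is strongly stable with uniform rate. 3. The system $\Sigma_M$ is locally strongly stable with uniform rate.
   Context: Fix an integer $d\ge 1$ and a norm $|\cdot|$ on $\mathbb R^d$; $\|\cdot\|$ is the induced matrix norm on the space $\mathcal M_d(\mathbb R)$ of real $d\times d$ matrices, $\mathrm{Id}$ is the identity matrix, $\mathrm{id}$ the identity map, $\rho(\cdot)$ the spectral radius, $\|\cdot\|_\infty$ the supremum norm. $\mathrm{NBV}([-1,0],\mathcal M_d(\mathbb R))$ is the set of functions $M:[-1,0]\to\mathcal M_d(\mathbb R)$ of bounded variation with $M(-1)=0$ and $M$ right-continuous on $(-1,0)$. Such $M$ correspond one-to-one to matrix-valued Borel measures $\mu_M$ on $[-1,0]$ (each entry a finite signed measure) via $M(t)=\mu_M([-1,t])$ for $t\in(-1,0]$. Integrals $\int_{-1}^0\cdots dM(\theta)$ are integrals over $[-1,0]$ with respect to $\mu_M$. Any notion defined for $M$ is also used for $\mu_M$ through this correspondence. System $\Sigma_M$: $x(t)=\int_{-1}^0 dM(\theta)\,x(t+\theta)$, $t\ge 0$. Solutions are continuous functions $x:[-1,+\infty)\to\mathbb R^d$ satisfying this for all $t\ge0$; write $x_t(\theta)=x(t+\theta)$, $\theta\in[-1,0]$; $x_0$ is the initial condition. Let $\mathcal C_0=\{\eta\in \mathcal C([-1,0],\mathbb R^d):\eta(0)=\int_{-1}^0 dM(\theta)\eta(\theta)\}$.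 Let $\mathcal W$ be the set of $M\in \mathrm{NBV}([-1,0],\mathcal M_d(\mathbb R))$ with $\det(\mathrm{Id}-(M(0)-M(0^-)))\ne0$; for $M\in\mathcal W$, every $\phi\in\mathcal C_0$ is the initial condition of a unique solution on $[-1,+\infty)$. Exponential rate, for $M\in\mathcal W$: $\omega_M$ is the infimum (in $[-\infty,+\infty)$) of the $\alpha\in\mathbb R$ for which there is $K>0$ such that for all $\phi\in\mathcal C_0$ the solution $x$ with $x_0=\phi$ satisfies $\|x_t\|_\infty\le Ke^{\alpha t}\|\phi\|_\infty$ for all $t\ge0$. Characteristic function: $\Delta_M(s)=\det\left(\mathrm{Id}-\int_{-1}^0 e^{s\theta}dM(\theta)\right)$, $s\in\mathbb C$. Spectral abscissa: $S_M=\sup\{\operatorname{Re}s:\Delta_M(s)=0\}$ ($=-\infty$ if there are no zeros). Set $\mathcal G=\{M\in\mathcal W: S_M=\omega_M\}$. $\rho_{\mathrm{HS}}(M)=\sup_{\xi}\rho\left(\int_{-1}^0 e^{i\xi(\theta)}dM(\theta)\right)$, the supremum being over all Borel-measurable $\xi:[-1,0]\to\mathbb R$. Let $\mathbf B$ be the set of Borel-measurable $\varphi:[-1,0]\to[-1,0]$, and let $\varphi_*\mu$ denote the pushforward, $\varphi_*\mu(A)=\mu(\varphi^{-1}(A))$. For $M\in\mathcal G$ with associated measure $\mu=\mu_M$: - $\Sigma_M$ is locally strongly stable with uniform rate if there exist $\alpha>0$ and $\epsilon>0$ such that $\omega_{\varphi_*\mu}\le-\alpha$ for all $\varphi\in\mathbf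 B$ with $\|\varphi-\mathrm{id}\|_\infty<\epsilon$ and $\varphi_*\mu\in\mathcal G$. - $\Sigma_M$ is strongly stable with uniform rate if there exists $\alpha>0$ such that $\omega_{\varphi_*\mu}\le-\alpha$ for all $\varphi\in\mathbf B$ with $\varphi_*\mu\in\mathcal G$. *)

theory Defs
  imports "HOL-Analysis.Analysis"
begin

text \<open>The dimension \<open>d\<close> is the cardinality of the index type \<open>'n\<close>. Functions on \<open>[-1,0]\<close> are
  represented by total functions on the reals, of which only the values on \<open>[-1,0]\<close> are used.\<close>

definition is_norm :: "('a::real_vector \<Rightarrow> real) \<Rightarrow> bool" where
  "is_norm N \<longleftrightarrow> (\<forall>x. N x = 0 \<longleftrightarrow> x = 0) \<and> (\<forall>c x. N (c *\<^sub>R x) = \<bar>c\<bar> * N x)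
     \<and> (\<forall>x y. N (x + y) \<le> N x + N y)"

text \<open>As in the library's \<^const>\<open>onorm\<close>, the quotient \<open>0 / 0 = 0\<close> makes \<open>x = 0\<close> harmless.\<close>

definition induced_norm :: "(real^'n \<Rightarrow> real) \<Rightarrow> real^'n^'n \<Rightarrow> real" where
  "induced_norm N A = (SUP x. N (A *v x) / N x)"

definition sup_norm :: "('a \<Rightarrow> real) \<Rightarrow> (real \<Rightarrow> 'a) \<Rightarrow> real" where
  "sup_norm N f = (SUP \<theta>\<in>{-1..0}. N (f \<theta>))"

definition spectral_radius_cmat :: "complex^'n^'n \<Rightarrow> real" where
  "spectral_radius_cmat A = Max (cmod ` {z. \<exists>v. v \<noteq> 0 \<and> A *v v = z *s v})"


subsection \<open>Signed and matrix-valued measures on the delay interval\<close>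

abbreviation delay_borel :: "real measure" where
  "delay_borel \<equiv> restrict_space borel {-1..0}"

text \<open>Finite signed measures are real-valued, countably additive set functions on the Borel
  subsets of \<open>[-1,0]\<close>. The value 0 prescribed on all other sets makes equality of measures
  the equality of set functions. Taking all \<open>A n = {}\<close> shows \<open>\<nu> {} = 0\<close>.\<close>

definition signed_measure :: "(real set \<Rightarrow> real) \<Rightarrow> bool" where
  "signed_measure \<nu> \<longleftrightarrow>
     (\<forall>A :: nat \<Rightarrow> real set. range A \<subseteq> sets delay_borel \<longrightarrow> disjoint_family A \<longrightarrow>
        (\<lambda>n. \<nu> (A n)) sums \<nu> (\<Union>n. A n)) \<and>
     (\<forall>A. A \<notin> sets delay_borel \<longrightarrow> \<nu> A = 0)"

definition matrix_measure :: "(real set \<Rightarrow> real^'n^'n) \<Rightarrow> bool" where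
  "matrix_measure \<mu> \<longleftrightarrow> (\<forall>i j. signed_measure (\<lambda>A. \<mu> A $ i $ j))"

text \<open>The positive part \<open>\<nu>\<^sup>+(A) = sup {\<nu>(B) | B \<subseteq> A}\<close> of the Jordan decomposition; the negative part
  is the positive part of \<open>-\<nu>\<close>. \<^const>\<open>ennreal\<close> sends negative numbers to 0, which does not
  change the supremum since \<open>B = {}\<close> is admissible.\<close>

definition positive_part :: "(real set \<Rightarrow> real) \<Rightarrow> real measure" where
  "positive_part \<nu> = measure_of {-1..0} (sets delay_borel)
     (\<lambda>A. SUP B\<in>{B \<in> sets delay_borel. B \<subseteq> A}. ennreal (\<nu> B))"

definition signed_integral ::
    "(real set \<Rightarrow> real) \<Rightarrow> (real \<Rightarrow> 'b::{banach, second_countable_topology}) \<Rightarrow> 'b" where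
  "signed_integral \<nu> f =
     integral\<^sup>L (positive_part \<nu>) f - integral\<^sup>L (positive_part (\<lambda>A. - \<nu> A)) f"

definition pushforward ::
    "(real \<Rightarrow> real) \<Rightarrow> (real set \<Rightarrow> 'a::zero) \<Rightarrow> real set \<Rightarrow> 'a" where
  "pushforward \<phi> \<mu> A = (if A \<in> sets delay_borel then \<mu> (\<phi> -` A \<inter> {-1..0}) else 0)"


subsection \<open>Normalized functions of bounded variation\<close>

definition bounded_variation :: "(real^'n \<Rightarrow> real) \<Rightarrow> (real \<Rightarrow> real^'n^'n) \<Rightarrow> bool" where
  "bounded_variation N M \<longleftrightarrow>
     (\<exists>C. \<forall>(n::nat) t. mono_on {..n} t \<longrightarrow> t ` {..n} \<subseteq> {-1..0} \<longrightarrow>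
        (\<Sum>k<n. induced_norm N (M (t (Suc k)) - M (t k))) \<le> C)"

definition NBV :: "(real^'n \<Rightarrow> real) \<Rightarrow> (real \<Rightarrow> real^'n^'n) set" where
  "NBV N = {M. bounded_variation N M \<and> M (-1) = 0 \<and>
     (\<forall>t\<in>{-1<..<0}. continuous (at_right t) M)}"

definition measure_of_nbv :: "(real \<Rightarrow> real^'n^'n) \<Rightarrow> real set \<Rightarrow> real^'n^'n" where
  "measure_of_nbv M = (THE \<mu>. matrix_measure \<mu> \<and> (\<forall>t\<in>{-1<..0}. M t = \<mu> {-1..t}))"

definition nbv_of_measure :: "(real set \<Rightarrow> real^'n^'n) \<Rightarrow> real \<Rightarrow> real^'n^'n" where
  "nbv_of_measure \<mu> t = (if t \<in> {-1<..0} then \<mu> {-1..t} else 0)"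

definition vector_integral :: "(real \<Rightarrow> real^'n^'n) \<Rightarrow> (real \<Rightarrow> real^'n) \<Rightarrow> real^'n" where
  "vector_integral M f =
     (\<chi> i. \<Sum>j\<in>UNIV. signed_integral (\<lambda>A. measure_of_nbv M A $ i $ j) (\<lambda>\<theta>. f \<theta> $ j))"

definition matrix_integral :: "(real \<Rightarrow> real^'n^'n) \<Rightarrow> (real \<Rightarrow> complex) \<Rightarrow> complex^'n^'n" where
  "matrix_integral M g = (\<chi> i j. signed_integral (\<lambda>A. measure_of_nbv M A $ i $ j) g)"


subsection \<open>The delay system\<close>

definition is_solution :: "(real \<Rightarrow> real^'n^'n) \<Rightarrow> (real \<Rightarrow> real^'n) \<Rightarrow> bool" where
  "is_solution M x \<longleftrightarrow> continuous_on {-1..} x \<and>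
     (\<forall>t\<ge>0. x t = vector_integral M (\<lambda>\<theta>. x (t + \<theta>)))"

definition initial_space :: "(real \<Rightarrow> real^'n^'n) \<Rightarrow> (real \<Rightarrow> real^'n) set" where
  "initial_space M = {\<eta>. continuous_on {-1..0} \<eta> \<and> \<eta> 0 = vector_integral M \<eta>}"

definition well_posed :: "(real^'n \<Rightarrow> real) \<Rightarrow> (real \<Rightarrow> real^'n^'n) set" where
  "well_posed N = {M \<in> NBV N. det (mat 1 - (M 0 - Lim (at_left 0) M)) \<noteq> 0}"

text \<open>For well-posed \<open>M\<close> the solution with a given initial condition exists and is unique, so
  quantifying over all solutions with that initial condition refers to the solution.\<close>

definition exp_rate :: "(real^'n \<Rightarrow> real) \<Rightarrow> (real \<Rightarrow> real^'n^'n) \<Rightarrow> ereal" where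
  "exp_rate N M = Inf (ereal ` {\<alpha>. \<exists>K>0. \<forall>\<phi>\<in>initial_space M. \<forall>x.
     is_solution M x \<longrightarrow> (\<forall>\<theta>\<in>{-1..0}. x \<theta> = \<phi> \<theta>) \<longrightarrow>
     (\<forall>t\<ge>0. sup_norm N (\<lambda>\<theta>. x (t + \<theta>)) \<le> K * exp (\<alpha> * t) * sup_norm N \<phi>)})"

definition char_fun :: "(real \<Rightarrow> real^'n^'n) \<Rightarrow> complex \<Rightarrow> complex" where
  "char_fun M s = det (mat 1 - matrix_integral M (\<lambda>\<theta>. exp (s * of_real \<theta>)))"

text \<open>In \<^typ>\<open>ereal\<close>, the supremum of the empty set is \<open>-\<infinity>\<close>.\<close>

definition spectral_abscissa :: "(real \<Rightarrow> real^'n^'n) \<Rightarrow> ereal" where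
  "spectral_abscissa M = Sup ((\<lambda>s. ereal (Re s)) ` {s. char_fun M s = 0})"

definition spectral_growth :: "(real^'n \<Rightarrow> real) \<Rightarrow> (real \<Rightarrow> real^'n^'n) set" where
  "spectral_growth N = {M \<in> well_posed N. spectral_abscissa M = exp_rate N M}"

text \<open>The supremum is over a bounded set: each spectral radius is at most a constant times the
  total variation of the measure.\<close>

definition rho_HS :: "(real \<Rightarrow> real^'n^'n) \<Rightarrow> real" where
  "rho_HS M = (SUP \<xi>\<in>borel_measurable delay_borel.
     spectral_radius_cmat (matrix_integral M (\<lambda>\<theta>. exp (\<i> * of_real (\<xi> \<theta>)))))"


subsection \<open>Strong stability\<close>

definition delay_maps :: "(real \<Rightarrow> real) set" where
  "delay_maps = measurable delay_borel delay_borel"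

definition perturbed :: "(real \<Rightarrow> real) \<Rightarrow> (real \<Rightarrow> real^'n^'n) \<Rightarrow> real \<Rightarrow> real^'n^'n" where
  "perturbed \<phi> M = nbv_of_measure (pushforward \<phi> (measure_of_nbv M))"

definition locally_strongly_stable_uniform ::
    "(real^'n \<Rightarrow> real) \<Rightarrow> (real \<Rightarrow> real^'n^'n) \<Rightarrow> bool" where
  "locally_strongly_stable_uniform N M \<longleftrightarrow>
     (\<exists>\<alpha>>0. \<exists>\<epsilon>>0. \<forall>\<phi>\<in>delay_maps. sup_norm abs (\<lambda>\<theta>. \<phi> \<theta> - \<theta>) < \<epsilon> \<longrightarrow>
        perturbed \<phi> M \<in> spectral_growth N \<longrightarrow> exp_rate N (perturbed \<phi> M) \<le> ereal (- \<alpha>))"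

definition strongly_stable_uniform ::
    "(real^'n \<Rightarrow> real) \<Rightarrow> (real \<Rightarrow> real^'n^'n) \<Rightarrow> bool" where
  "strongly_stable_uniform N M \<longleftrightarrow>
     (\<exists>\<alpha>>0. \<forall>\<phi>\<in>delay_maps.
        perturbed \<phi> M \<in> spectral_growth N \<longrightarrow> exp_rate N (perturbed \<phi> M) \<le> ereal (- \<alpha>))"

end

theory Submission
  imports Defs "HOL-Complex_Analysis.Complex_Analysis"
    "HOL-Computational_Algebra.Fundamental_Theorem_Algebra" "HOL-Computational_Algebra.Polynomial_FPS"
begin

text \<open>
  The zeros of the characteristic function of a perturbed system are governed by the determinants
  of \<open>Id - \<integral> e\<^sup>s\<^sup>\<phi> dM\<close>. If \<open>\<rho>\<^sub>H\<^sub>S(M) < 1\<close>, the maximum principle on polydiscs bounds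
  the eigenvalues of \<open>\<integral> g dM\<close> by \<open>\<rho>\<^sub>H\<^sub>S(M)\<close> for every measurable \<open>g\<close> with \<open>\<bar>g\<bar> \<le> 1\<close>,
  not only for unimodular ones. Since \<open>\<bar>e\<^sup>s\<^sup>\<phi>\<bar>\<close> barely exceeds 1 as long as \<open>Re s\<close> exceeds
  a small negative number, no zero lies there.

  Conversely, let the system be locally strongly stable and fix a simple \<open>g\<close>. Rounding the delays
  onto a fine grid and shifting \<open>s\<close> by a large imaginary number realises, in the limit, every
  choice of phases on the finitely many level sets \<open>B\<^sub>i\<close> of \<open>g\<close>. Commensurable systems reduce to
  linear recurrences, so their exponential rate is their spectral abscissa and the stability
  hypothesis applies to them. A Hurwitz argument then shows that the determinant of
  \<open>Id - \<Sum>\<^sub>i z\<^sub>i \<mu>(B\<^sub>i)\<close> has no zero on the tori \<open>\<bar>z\<^sub>i\<bar> = exp (-\<sigma> \<tau>\<^sub>i)\<close> with \<open>\<sigma> > -\<alpha>\<close>.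
  As \<open>\<sigma> \<rightarrow> \<infinity>\<close> these tori shrink to the origin, so the determinant has no zero in the polydiscs
  they bound either. For \<open>\<sigma> < 0\<close> all radii exceed 1, which bounds \<open>\<rho>\<^sub>H\<^sub>S(M)\<close> away from 1.
\<close>

section \<open>Eigenvalues\<close>

text \<open>Three obstacles shape the details. A stability hypothesis speaks about a perturbed
  system only if that system lies in the class where rate and abscissa agree, and an arbitrary delay
  map may even destroy well-posedness by moving mass to delay 0. The converse direction therefore
  tests stability only on maps onto a finite grid that omits 0, for which membership can be proved.

  Eigenvalues are awkward to follow through limits. A bound on all of them is therefore turned into
  an explicit lower bound for \<open>det (Id - c A)\<close>, depending only on the bound, on
  \<open>c\<close> and on the dimension; such an inequality survives entrywise limits.

  Finally, the radii \<open>exp (-\<sigma> \<tau>_i)\<close> are not proportional to each other,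
  because the delays differ. Hence the polydisc argument works with an arbitrary continuous family
  of radii that starts at 0, not only with multiples of one fixed polydisc.\<close>

definition pencil :: "complex^'n^'n \<Rightarrow> complex poly" where
  "pencil A = det (mat 1 - (\<chi> i j. [:0, A $ i $ j:]))"

lemma poly_det: "poly (det A) x = det (\<chi> i j. poly (A $ i $ j) x)"
  by (simp add: det_def poly_sum poly_prod)

lemma poly_pencil: "poly (pencil A) c = det (mat 1 - (\<chi> i j. c * A $ i $ j))"
  unfolding pencil_def poly_det
  by (rule arg_cong[where f = det]) (simp add: vec_eq_iff mat_def)

lemma degree_det_le:
  fixes A :: "'a::idom poly^'n^'n"
  assumes "\<And>i j. degree (A $ i $ j) \<le> m"
  shows "degree (det A) \<le> m * CARD('n)"
proof -
  have "degree (of_int (sign p) * (\<Prod>i\<in>UNIV. A $ i $ p i)) \<le> m * CARD('n)" for p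
  proof -
    have "degree (of_int (sign p) * (\<Prod>i\<in>UNIV. A $ i $ p i)) \<le> degree (\<Prod>i\<in>UNIV. A $ i $ p i)"
      by (cases "sign p = 1") (auto simp: sign_def split: if_splits)
    also have "\<dots> \<le> (\<Sum>i\<in>UNIV. degree (A $ i $ p i))"
      using degree_prod_sum_le[of UNIV "\<lambda>i. A $ i $ p i"] by (simp add: o_def)
    also have "\<dots> \<le> (\<Sum>i\<in>(UNIV::'n set). m)" by (intro sum_mono assms)
    finally show ?thesis by (simp add: mult.commute)
  qed
  then show ?thesis unfolding det_def by (intro degree_sum_le) (auto simp: finite_permutations)
qed

lemma degree_pencil_le: "degree (pencil (A::complex^'n^'n)) \<le> CARD('n)"
proof -
  have "degree ((mat 1 - (\<chi> i j. [:0, A $ i $ j:])) $ i $ j) \<le> 1" for i j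
    by (auto simp: mat_def intro!: degree_diff_le)
  then show ?thesis using degree_det_le[of _ 1] unfolding pencil_def by fastforce
qed

text \<open>Writing the linear factors as \<open>1 - x/z\<close> keeps the constant term equal to 1
  throughout the induction on the degree; the list records roots with multiplicity.\<close>

lemma poly_factor_nonzero_root:
  fixes p :: "complex poly"
  assumes "poly p 0 = 1"
  shows "\<exists>zs. p = (\<Prod>z\<leftarrow>zs. [:1, - (1/z):]) \<and> length zs = degree p \<and> (\<forall>z\<in>set zs. z \<noteq> 0 \<and> poly p z = 0)"
  using assms
proof (induction "degree p" arbitrary: p)
  case 0
  then obtain c where "p = [:c:]" by (metis degree_eq_zeroE)
  with 0 show ?case by (intro exI[of _ "[]"]) auto
next
  case (Suc n)
  then have "\<not> constant (poly p)" by (simp add: constant_degree)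
  then obtain z where z: "poly p z = 0" using fundamental_theorem_of_algebra by blast
  have z0: "z \<noteq> 0" using z Suc.prems by auto
  have "[:-z, 1:] dvd p" using z by (simp add: poly_eq_0_iff_dvd)
  then obtain q where q: "p = [:-z, 1:] * q" by (elim dvdE)
  define r where "r = smult (-z) q"
  have r: "p = [:1, - (1/z):] * r"
  proof -
    have "[:1, - (1/z):] * r = smult (-z) [:1, - (1/z):] * q" unfolding r_def
        by (simp only: mult_smult_left mult_smult_right)
    also have "smult (-z) [:1, - (1/z):] = [:-z, 1:]" using z0 by simp
    finally show ?thesis by (simp only: q)
  qed
  have p0: "p \<noteq> 0" using Suc.prems by auto
  then have "r \<noteq> 0" using r by auto
  then have "degree p = Suc (degree r)" unfolding r using z0 by (subst degree_mult_eq) auto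
  then have dr: "n = degree r" using Suc.hyps by simp
  have "poly r 0 = 1" using Suc.prems unfolding r by simp
  from Suc.hyps(1)[OF dr this] obtain zs where
    zs: "r = (\<Prod>z\<leftarrow>zs. [:1, - (1/z):])" "length zs = degree r" "\<forall>z\<in>set zs. z \<noteq> 0 \<and> poly r z = 0" by auto
  show ?case
  proof (intro exI[of _ "z # zs"] conjI)
    show "p = (\<Prod>z\<leftarrow>z # zs. [:1, - (1 / z):])"
      unfolding list.map prod_list.Cons zs(1)[symmetric] by (rule r)
    show "length (z # zs) = degree p" using zs(2) dr Suc.hyps(2) by simp
    show "\<forall>z'\<in>set (z # zs). z' \<noteq> 0 \<and> poly p z' = 0"
      using zs(3) z0 z unfolding r poly_mult by auto
  qed
qed

text \<open>Each factor \<open>1 - 1/z\<close> has modulus at least \<open>1 - r\<close>, and there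
  are at most \<open>n\<close> of them. The bound sees \<open>p\<close> only through
  \<open>r\<close> and the degree.\<close>

lemma poly_one_lower_bound:
  fixes p :: "complex poly"
  assumes "poly p 0 = 1" and "\<And>z. poly p z = 0 \<Longrightarrow> 1 \<le> r * cmod z" and "0 \<le> r" "r \<le> 1" "degree p \<le> n"
  shows "(1 - r) ^ n \<le> cmod (poly p 1)"
proof -
  obtain zs where zs: "p = (\<Prod>z\<leftarrow>zs. [:1, - (1/z):])" "length zs = degree p"
     "\<forall>z\<in>set zs. z \<noteq> 0 \<and> poly p z = 0"
    using poly_factor_nonzero_root[OF assms(1)] by auto
  have 1: "1 - r \<le> cmod (1 - 1/z)" if "z \<in> set zs" for z
  proof -
    have "z \<noteq> 0" "1 \<le> r * cmod z" using zs that assms(2) by auto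
    then have "cmod (1/z) \<le> r" by (simp add: norm_divide divide_simps)
    then show ?thesis using norm_triangle_ineq2[of 1 "1/z"] by simp
  qed
  have "(1-r)^length zs \<le> cmod (\<Prod>z\<leftarrow>zs. poly [:1, - (1/z):] 1)"
    using 1
  proof (induction zs)
    case (Cons a zs)
    have "(1 - r) * (1-r)^length zs \<le> cmod (1 - 1/a) * cmod (\<Prod>z\<leftarrow>zs. poly [:1, - (1/z):] 1)"
      by (intro mult_mono Cons.IH Cons.prems) (use assms in auto)
    then show ?case by (simp add: norm_mult)
  qed auto
  also have "(\<Prod>z\<leftarrow>zs. poly [:1, - (1/z):] 1) = poly p 1"
    unfolding zs(1) by (induction zs) (simp_all add: algebra_simps)
  finally have "(1-r)^degree p \<le> cmod (poly p 1)" using zs by simp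
  moreover have "(1-r)^n \<le> (1-r)^degree p" using assms by (intro power_decreasing) auto
  ultimately show ?thesis by simp
qed

definition eigenvalues :: "complex^'n^'n \<Rightarrow> complex set" where
  "eigenvalues A = {z. \<exists>v. v \<noteq> 0 \<and> A *v v = z *s v}"

lemma det_eq_0_iff_kernel:
  fixes A :: "'a::field^'n^'n"
  shows "det A = 0 \<longleftrightarrow> (\<exists>v. v \<noteq> 0 \<and> A *v v = 0)"
  using invertible_det_nz[of A] invertible_left_inverse[of A] matrix_left_invertible_ker[of A] by blast

text \<open>The pencil is the reversed characteristic polynomial: it forgets the eigenvalue 0 but
  has constant term 1 for every \<open>A\<close>.\<close>

lemma eigenvalue_iff_pencil:
  assumes "z \<noteq> 0"
  shows "z \<in> eigenvalues A \<longleftrightarrow> poly (pencil A) (1/z) = 0"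
proof -
  have *: "(mat 1 - (\<chi> i j. 1/z * A $ i $ j)) *v v = v - (1/z) *s (A *v v)" for v
  proof -
    have "(\<chi> i j. 1/z * A $ i $ j) *v v = (1/z) *s (A *v v)"
      by (simp add: vec_eq_iff matrix_vector_mult_def sum_distrib_left mult.assoc)
    then show ?thesis by (simp only: matrix_vector_mult_diff_rdistrib matrix_vector_mul_lid)
  qed
  have "v - (1/z) *s (A *v v) = 0 \<longleftrightarrow> A *v v = z *s v" for v
    using assms by (auto simp: vec_eq_iff field_simps)
  then show ?thesis unfolding poly_pencil det_eq_0_iff_kernel eigenvalues_def * by auto
qed

lemma poly_pencil_0 [simp]: "poly (pencil A) 0 = 1"
proof -
  have "mat 1 - (\<chi> i j. 0 * A $ i $ j) = mat 1" by (simp add: vec_eq_iff)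
  then show ?thesis by (simp add: poly_pencil)
qed

lemma finite_eigenvalues: "finite (eigenvalues A)"
proof -
  have "pencil A \<noteq> 0" using poly_pencil_0[of A] by (metis poly_0 zero_neq_one)
  then have "finite {c. poly (pencil A) c = 0}" by (rule poly_roots_finite)
  then have "finite (insert 0 ((\<lambda>c. 1/c) ` {c. poly (pencil A) c = 0}))" by simp
  moreover have "eigenvalues A \<subseteq> insert 0 ((\<lambda>c. 1/c) ` {c. poly (pencil A) c = 0})"
  proof
    fix z assume "z \<in> eigenvalues A"
    then show "z \<in> insert 0 ((\<lambda>c. 1/c) ` {c. poly (pencil A) c = 0})"
      using eigenvalue_iff_pencil[of z A] by (cases "z = 0") (auto intro!: image_eqI[of _ _ "1/z"])
  qed
  ultimately show ?thesis by (rule finite_subset[rotated])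
qed

lemma det_scale: "det (\<chi> i j. c * (A::'a::comm_ring_1^'n^'n) $ i $ j) = c ^ CARD('n) * det A"
  by (simp add: det_def sum_distrib_left prod.distrib mult.left_commute)

text \<open>Makes the \<open>Max\<close> in \<open>spectral_radius_cmat\<close> meaningful. Without
  eigenvalues the pencil has no root and is constantly 1, so \<open>det (t Id - A) = t^d\<close> for
  \<open>t > 0\<close>; letting \<open>t\<close> tend to 0 gives \<open>det A = 0\<close>, and 0 is
  an eigenvalue after all.\<close>

lemma eigenvalues_nonempty: "eigenvalues (A::complex^'n^'n) \<noteq> {}"
proof
  assume e: "eigenvalues A = {}"
  then have "0 \<notin> eigenvalues A" by auto
  then have d: "det A \<noteq> 0" unfolding det_eq_0_iff_kernel eigenvalues_def by simp
  have nz: "poly (pencil A) c \<noteq> 0" for c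
    using e eigenvalue_iff_pencil[of "1/c" A] by (cases "c = 0") simp_all
  then have "constant (poly (pencil A))" using fundamental_theorem_of_algebra by blast
  then have one: "poly (pencil A) c = 1" for c by (metis constant_def poly_pencil_0)
  have det_eq: "det ((\<chi> i j. complex_of_real t * (if i = j then 1 else 0)) - A)
      = complex_of_real t ^ CARD('n)" if "t > 0" for t
  proof -
    have "(\<chi> i j. complex_of_real t * (mat 1 - (\<chi> i j. (1/complex_of_real t) * A $ i $ j)) $ i $ j)
       = (\<chi> i j. complex_of_real t * (if i = j then 1 else 0)) - A"
      using that by (simp add: vec_eq_iff mat_def field_simps)
    moreover have "det (\<chi> i j. complex_of_real t * (mat 1 - (\<chi> i j. (1/complex_of_real t) * A $ i $
        j)) $ i $ j) = complex_of_real t ^ CARD('n)"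
      using one[of "1/complex_of_real t"] unfolding det_scale poly_pencil by simp
    ultimately show ?thesis by simp
  qed
  have "((\<lambda>t. det ((\<chi> i j. complex_of_real t * (if i = j then 1 else 0)) - A)) \<longlongrightarrow> det
      ((\<chi> i j. complex_of_real 0 * (if i = j then 1 else 0)) - A)) (at_right 0)"
    unfolding det_def by (simp only: vec_lambda_beta vector_minus_component, intro tendsto_intros)
  moreover have "eventually (\<lambda>t. det ((\<chi> i j. complex_of_real t * (if i = j then 1 else 0)) - A)
      = complex_of_real t ^ CARD('n)) (at_right 0)"
    using eventually_at_right_less[of "0::real"] by eventually_elim (rule det_eq)
  ultimately have "((\<lambda>t. complex_of_real t ^ CARD('n)) \<longlongrightarrow> det ((\<chi> i j. complex_of_real 0 * (if i
      = j then 1 else 0)) - A)) (at_right 0)"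
    by (rule Lim_transform_eventually)
  moreover have "((\<lambda>t. complex_of_real t ^ CARD('n)) \<longlongrightarrow> complex_of_real 0 ^ CARD('n)) (at_right 0)"
    by (intro tendsto_intros)
  ultimately have "det ((\<chi> i j. complex_of_real 0 * (if i = j then 1 else 0)) - A)
      = complex_of_real 0 ^ CARD('n)"
    by (rule tendsto_unique[OF trivial_limit_at_right_real])
  moreover have "(\<chi> i j. complex_of_real 0 * (if i = j then 1 else 0)) - A = (\<chi> i j. (-1) * A $ i $ j)"
    by (simp add: vec_eq_iff)
  ultimately have "det (\<chi> i j. (-1) * A $ i $ j) = 0" by (simp add: zero_power)
  then have "(-1) ^ CARD('n) * det A = 0" by (simp only: det_scale)
  then show False using d by simp
qed

text \<open>Apply \<open>poly_one_lower_bound\<close> to the pencil with \<open>c x\<close>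
  substituted for \<open>x\<close>. This is the form in which eigenvalue bounds pass to limits of
  matrices.\<close>

lemma det_lower_bound:
  fixes A :: "complex^'n^'n"
  assumes "\<And>z. z \<in> eigenvalues A \<Longrightarrow> cmod z \<le> r" and "0 \<le> r" and "cmod c * r \<le> 1"
  shows "(1 - cmod c * r) ^ CARD('n) \<le> cmod (det (mat 1 - (\<chi> i j. c * A $ i $ j)))"
proof -
  define p where "p = pcompose (pencil A) [:0, c:]"
  have p: "poly p z = poly (pencil A) (c * z)" for z by (simp add: p_def poly_pcompose mult.commute)
  have "(1 - cmod c * r) ^ CARD('n) \<le> cmod (poly p 1)"
  proof (rule poly_one_lower_bound)
    show "degree p \<le> CARD('n)"
    proof -
      have "degree p \<le> degree (pencil A) * 1"
        unfolding p_def degree_pcompose by (intro mult_le_mono2) simp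
      then show ?thesis using degree_pencil_le[of A] by linarith
    qed
    fix z assume z: "poly p z = 0"
    then have nz: "c * z \<noteq> 0" using p by auto
    then have "1/(c*z) \<in> eigenvalues A" using z p eigenvalue_iff_pencil[of "1/(c*z)" A] by simp
    then have "cmod (1/(c*z)) \<le> r" using assms by auto
    then show "1 \<le> cmod c * r * cmod z" using nz
        by (simp add: norm_divide norm_mult divide_simps mult_ac split: if_splits)
  qed (use assms p in auto)
  then show ?thesis by (simp add: p poly_pencil)
qed

lemma norm_matrix_vector_mult_le:
  fixes A :: "'a::{real_normed_field}^'n^'m"
  shows "norm (A *v v) \<le> (\<Sum>i\<in>UNIV. \<Sum>j\<in>UNIV. norm (A $ i $ j)) * norm v"
proof -
  have "norm (A *v v) \<le> (\<Sum>i\<in>UNIV. norm ((A *v v) $ i))" unfolding norm_vec_def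
      by (intro L2_set_le_sum) auto
  also have "\<dots> \<le> (\<Sum>i\<in>UNIV. \<Sum>j\<in>UNIV. norm (A $ i $ j) * norm v)"
    unfolding matrix_vector_mult_def
    by (intro sum_mono, simp, intro sum_norm_le) (auto simp: norm_mult intro!: mult_left_mono
        Finite_Cartesian_Product.norm_nth_le)
  also have "\<dots> = (\<Sum>i\<in>UNIV. \<Sum>j\<in>UNIV. norm (A $ i $ j)) * norm v" by (simp add: sum_distrib_right)
  finally show ?thesis .
qed

lemma eigenvalue_norm_le:
  fixes A :: "complex^'n^'n"
  assumes "z \<in> eigenvalues A"
  shows "cmod z \<le> (\<Sum>i\<in>UNIV. \<Sum>j\<in>UNIV. cmod (A $ i $ j))"
proof -
  obtain v where v: "v \<noteq> 0" "A *v v = z *s v" using assms by (auto simp: eigenvalues_def)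
  have "cmod z * norm v = norm (z *s v)"
    by (simp add: norm_vec_def norm_mult L2_set_right_distrib)
  also have "\<dots> \<le> (\<Sum>i\<in>UNIV. \<Sum>j\<in>UNIV. cmod (A $ i $ j)) * norm v"
    unfolding v(2)[symmetric] by (rule norm_matrix_vector_mult_le)
  finally show ?thesis using v(1) by simp
qed

section \<open>Zeros of families of holomorphic functions\<close>

text \<open>The maximum principle for \<open>1/f\<close>; the point of the circle is a minimiser of
  the modulus there.\<close>

lemma boundary_min_modulus:
  assumes hol: "f holomorphic_on ball z0 r" and cont: "continuous_on (cball z0 r) f" and r: "0 < r"
    and nz: "\<And>z. z \<in> cball z0 r \<Longrightarrow> f z \<noteq> 0" and w: "w \<in> cball z0 r"
  shows "\<exists>z\<in>sphere z0 r. cmod (f z) \<le> cmod (f w)"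
proof -
  have "sphere z0 r \<noteq> {}" using r by simp
  moreover have "continuous_on (sphere z0 r) (\<lambda>z. cmod (f z))"
    by (intro continuous_on_norm continuous_on_subset[OF cont]) auto
  ultimately obtain b where b: "b \<in> sphere z0 r" "\<And>z. z \<in> sphere z0 r \<Longrightarrow> cmod (f b) \<le> cmod (f z)"
    using continuous_attains_inf[of "sphere z0 r" "\<lambda>z. cmod (f z)"] by auto
  have "cmod (inverse (f w)) \<le> inverse (cmod (f b))"
  proof (rule maximum_modulus_frontier[of "\<lambda>z. inverse (f z)" "cball z0 r"])
    show "(\<lambda>z. inverse (f z)) holomorphic_on interior (cball z0 r)"
      using hol nz by (auto intro!: holomorphic_intros simp: interior_cball)
    show "continuous_on (closure (cball z0 r)) (\<lambda>z. inverse (f z))"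
      using cont nz by (auto intro!: continuous_intros)
    fix z assume "z \<in> frontier (cball z0 r)"
    then have "z \<in> sphere z0 r" using r by (simp add: frontier_cball)
    then have "cmod (f b) \<le> cmod (f z)" "f b \<noteq> 0" using b nz[of b] by auto
    then show "cmod (inverse (f z)) \<le> inverse (cmod (f b))"
      by (simp add: norm_inverse le_imp_inverse_le)
  qed (use w in auto)
  moreover have "f w \<noteq> 0" "f b \<noteq> 0" using nz w b by auto
  ultimately have "cmod (f b) \<le> cmod (f w)" by (simp add: norm_inverse)
  then show ?thesis using b by auto
qed

text \<open>A zero with minimal parameter would be a zero of the limit of functions without zeros in the
  disc, whose modulus is therefore bounded below by its minimum on the circle.\<close>

lemma no_zeros_homotopy:
  fixes h :: "real \<Rightarrow> complex \<Rightarrow> complex"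
  assumes cont: "continuous_on ({0..1} \<times> cball 0 1) (\<lambda>(t, w). h t w)"
    and hol: "\<And>t. t \<in> {0..1} \<Longrightarrow> h t holomorphic_on ball 0 1"
    and start: "\<And>w. w \<in> cball 0 1 \<Longrightarrow> h 0 w \<noteq> 0"
    and bdry: "\<And>t w. t \<in> {0..1} \<Longrightarrow> cmod w = 1 \<Longrightarrow> h t w \<noteq> 0"
    and tw: "t \<in> {0..1}" "w \<in> cball 0 1"
  shows "h t w \<noteq> 0"
proof
  assume h0: "h t w = 0"
  define Z where "Z = {x \<in> {0..1} \<times> cball 0 1. (\<lambda>(t, w). h t w) x = 0}"
  have "compact Z"
  proof -
    have "closed Z" unfolding Z_def
      by (intro continuous_closed_preimage_constant cont closed_Times) auto
    moreover have "compact ({0..1::real} \<times> cball (0::complex) 1)" by (intro compact_Times) auto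
    ultimately have "compact (({0..1::real} \<times> cball (0::complex) 1) \<inter> Z)" by (intro compact_Int_closed)
    moreover have "({0..1::real} \<times> cball (0::complex) 1) \<inter> Z = Z" by (auto simp: Z_def)
    ultimately show ?thesis by simp
  qed
  moreover have "(t, w) \<in> Z" using tw h0 by (simp add: Z_def)
  moreover have "continuous_on Z fst" by (intro continuous_intros)
  ultimately obtain x where x: "x \<in> Z" "\<And>y. y \<in> Z \<Longrightarrow> fst x \<le> fst y"
    using continuous_attains_inf[of Z fst] by (metis empty_iff)
  obtain t0 w0 where x0: "x = (t0, w0)" by (cases x)
  have t0: "t0 \<in> {0..1}" "w0 \<in> cball 0 1" "h t0 w0 = 0" using x(1) by (auto simp: Z_def x0)
  have min: "h s v \<noteq> 0" if "s \<in> {0..<t0}" "v \<in> cball 0 1" for s v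
    using x(2)[of "(s, v)"] that t0 by (auto simp: Z_def x0)
  have "t0 \<noteq> 0" using start t0 by auto
  \<comment> \<open>One positive bound for all boundary circles at once: it must not degenerate as
    the parameter approaches \<open>t0\<close>.\<close>
  have "compact ({0..1::real} \<times> sphere (0::complex) 1)" by (intro compact_Times) auto
  moreover have "continuous_on ({0..1} \<times> sphere 0 1) (\<lambda>x. cmod ((\<lambda>(t, w). h t w) x))"
    by (intro continuous_on_norm continuous_on_subset[OF cont]) auto
  moreover have "{0..1::real} \<times> sphere (0::complex) 1 \<noteq> {}" by auto
  ultimately obtain y where y: "y \<in> {0..1} \<times> sphere 0 1"
     "\<And>x. x \<in> {0..1} \<times> sphere 0 1 \<Longrightarrow> cmod ((\<lambda>(t, w). h t w) y) \<le> cmod ((\<lambda>(t, w). h t w) x)"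
    using continuous_attains_inf by meson
  define \<delta> where "\<delta> = cmod ((\<lambda>(t, w). h t w) y)"
  have \<delta>: "\<delta> > 0" using y(1) bdry by (auto simp: \<delta>_def)
  have hcont: "continuous_on (cball 0 1) (h s)" if "s \<in> {0..1}" for s
  proof -
    have "continuous_on (cball 0 1) ((\<lambda>(t, w). h t w) \<circ> (\<lambda>w. (s, w)))"
      by (intro continuous_on_compose continuous_intros continuous_on_subset[OF cont])
          (use that in auto)
    then show ?thesis by (simp add: o_def)
  qed
  have low: "\<delta> \<le> cmod (h s w0)" if "s \<in> {0..<t0}" for s
  proof -
    have s: "s \<in> {0..1}" using that t0 by auto
    have "\<exists>z\<in>sphere 0 1. cmod (h s z) \<le> cmod (h s w0)"
      by (rule boundary_min_modulus[OF hol[OF s] hcont[OF s]]) (use min that t0 in auto)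
    then obtain z where z: "z \<in> sphere 0 1" "cmod (h s z) \<le> cmod (h s w0)" by blast
    then show ?thesis using y(2)[of "(s, z)"] s by (auto simp: \<delta>_def)
  qed
  have "continuous_on {0..1} ((\<lambda>(t, w). h t w) \<circ> (\<lambda>s. (s, w0)))"
    by (intro continuous_on_compose continuous_intros continuous_on_subset[OF cont]) (use t0 in auto)
  then have "continuous_on {0..t0} (\<lambda>s. cmod (h s w0))"
    by (intro continuous_on_norm) (use t0 in \<open>auto simp: o_def elim!: continuous_on_subset\<close>)
  then have "((\<lambda>s. cmod (h s w0)) \<longlongrightarrow> cmod (h t0 w0)) (at t0 within {0..t0})"
    using t0(1) unfolding continuous_on_def by (metis atLeastAtMost_iff order_refl)
  then have lim: "((\<lambda>s. cmod (h s w0)) \<longlongrightarrow> cmod (h t0 w0)) (at_left t0)"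
    using t0 \<open>t0 \<noteq> 0\<close> by (simp add: at_within_Icc_at_left)
  have "\<delta> \<le> cmod (h t0 w0)"
  proof (rule tendsto_lowerbound[OF lim])
    have "eventually (\<lambda>s. s \<in> {0<..<t0}) (at_left t0)"
      using t0 \<open>t0 \<noteq> 0\<close> by (intro eventually_at_left_real) auto
    then show "eventually (\<lambda>s. \<delta> \<le> cmod (h s w0)) (at_left t0)"
      by eventually_elim (use low in auto)
  qed simp
  then show False using \<delta> t0 by simp
qed

text \<open>A variant of Hurwitz's theorem that asks for continuous convergence only.\<close>

lemma no_zeros_limit:
  fixes F :: "nat \<Rightarrow> complex \<Rightarrow> complex"
  assumes S: "open S" "connected S" and hol: "\<And>n. F n holomorphic_on S" and Hol: "H holomorphic_on S"
    and nz: "\<And>n z. n \<ge> n0 \<Longrightarrow> z \<in> S \<Longrightarrow> F n z \<noteq> 0"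
    and lim: "\<And>s z r. strict_mono r \<Longrightarrow> s \<longlonglongrightarrow> z \<Longrightarrow> z \<in> S \<Longrightarrow> (\<lambda>n. F (r n) (s n)) \<longlonglongrightarrow> H z"
    and b: "b \<in> S" "H b \<noteq> 0" and z0: "z0 \<in> S"
  shows "H z0 \<noteq> 0"
proof
  assume "H z0 = 0"
  from isolated_zeros[OF Hol S z0 this b] obtain r where
    r: "0 < r" "ball z0 r \<subseteq> S" "\<And>z. z \<in> ball z0 r - {z0} \<Longrightarrow> H z \<noteq> 0" by metis
  define e where "e = r / 2"
  have e: "e > 0" "cball z0 e \<subseteq> ball z0 r" using r by (auto simp: e_def)
  have eS: "cball z0 e \<subseteq> S" "ball z0 e \<subseteq> S" using e r(2)
      by (auto intro: ball_subset_cball[THEN subsetD])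
  have "\<exists>z\<in>sphere z0 e. cmod (F n z) \<le> cmod (F n z0)" if "n \<ge> n0" for n
  proof (rule boundary_min_modulus)
    show "F n holomorphic_on ball z0 e" by (rule holomorphic_on_subset[OF hol eS(2)])
    show "continuous_on (cball z0 e) (F n)"
      by (rule holomorphic_on_imp_continuous_on, rule holomorphic_on_subset[OF hol eS(1)])
  qed (use e eS nz that in auto)
  then obtain s where s: "\<And>n. n \<ge> n0 \<Longrightarrow> s n \<in> sphere z0 e \<and> cmod (F n (s n)) \<le> cmod (F n z0)" by metis
  \<comment> \<open>The minimisers on the circle move with \<open>n\<close>. A subsequence of them
    converges, and continuous convergence evaluates the limit along the moving points; the shift by
    \<open>n0\<close> keeps to indices for which \<open>F\<close> has no zeros.\<close>
  have "compact (sphere z0 e)" by simp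
  then obtain l q where lq: "l \<in> sphere z0 e" "strict_mono q" "((\<lambda>n. s (n + n0)) \<circ> q) \<longlonglongrightarrow> l"
    using s unfolding compact_def by (metis le_add2)
  define q' where "q' = (\<lambda>n. q n + n0)"
  have q': "strict_mono q'" using lq(2) by (auto simp: q'_def strict_mono_def)
  have lS: "l \<in> S" using lq(1) e r by auto
  have "(\<lambda>n. F (q' n) (s (q' n))) \<longlonglongrightarrow> H l"
    using lq(3) by (intro lim q' lS) (simp add: q'_def o_def)
  moreover have "(\<lambda>n. F (q' n) z0) \<longlonglongrightarrow> H z0" by (intro lim q' z0) auto
  ultimately have "cmod (H l) \<le> cmod (H z0)"
    by (intro LIMSEQ_le[OF tendsto_norm tendsto_norm]) (use s in \<open>auto simp: q'_def intro!:
        exI[of _ 0]\<close>)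
  then have "H l = 0" using \<open>H z0 = 0\<close> by simp
  moreover have "l \<in> ball z0 r - {z0}" using lq(1) e by auto
  ultimately show False using r(3) by auto
qed

section \<open>Finite signed measures and integration\<close>

lemma space_delay_borel [simp]: "space delay_borel = {-1..0}"
  by (simp add: space_restrict_space)

definition signed_difference :: "real measure \<Rightarrow> real measure \<Rightarrow> real set \<Rightarrow> real" where
  "signed_difference P Q A = (if A \<in> sets delay_borel then measure P A - measure Q A else 0)"

text \<open>Having two finite positive measures at hand makes the Hahn decomposition available.
  Functions of bounded variation supply such a pair, and delay maps preserve the property.\<close>

definition difference_measure :: "(real set \<Rightarrow> real) \<Rightarrow> bool" where
  "difference_measure \<nu> \<longleftrightarrow> (\<exists>P Q. finite_measure P \<and> finite_measure Q \<and>
     sets P = sets delay_borel \<and> sets Q = sets delay_borel \<and> \<nu> = signed_difference P Q)"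

lemma difference_measureE:
  assumes "difference_measure \<nu>"
  obtains P Q where "finite_measure P" "finite_measure Q" "sets P = sets delay_borel"
    "sets Q = sets delay_borel" "\<nu> = signed_difference P Q"
  using assms unfolding difference_measure_def by blast

lemma signed_measure_difference:
  assumes "difference_measure \<nu>"
  shows "signed_measure \<nu>"
proof -
  from assms obtain P Q where PQ: "finite_measure P" "finite_measure Q" "sets P = sets delay_borel"
    "sets Q = sets delay_borel" "\<nu> = signed_difference P Q" by (rule difference_measureE)
  show ?thesis unfolding signed_measure_def
  proof (intro conjI allI impI)
    fix A :: "nat \<Rightarrow> real set" assume A: "range A \<subseteq> sets delay_borel" "disjoint_family A"
    have "(\<lambda>n. measure P (A n) - measure Q (A n)) sums (measure P (\<Union>n. A n) - measure Q (\<Union>n. A n))"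
      using A PQ by (intro sums_diff finite_measure.finite_measure_UNION) auto
    moreover have "A n \<in> sets delay_borel" for n using A by auto
    moreover have "(\<Union>n. A n) \<in> sets delay_borel" using A by blast
    ultimately show "(\<lambda>n. \<nu> (A n)) sums \<nu> (\<Union>n. A n)"
      unfolding PQ(5) signed_difference_def by simp
  qed (simp add: PQ signed_difference_def)
qed

lemma signed_measure_empty:
  assumes "signed_measure \<nu>"
  shows "\<nu> {} = 0"
proof -
  have "(\<lambda>n::nat. \<nu> {}) sums \<nu> (\<Union>n::nat. {})"
    using assms unfolding signed_measure_def
    by (elim conjE allE[of _ "\<lambda>_. {}"]) (auto simp: disjoint_family_on_def)
  then have "(\<lambda>n::nat. \<nu> {}) \<longlonglongrightarrow> 0" by (intro summable_LIMSEQ_zero) (rule sums_summable)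
  then show ?thesis by (simp add: LIMSEQ_const_iff)
qed

lemma signed_measure_Un:
  assumes "signed_measure \<nu>" "A \<in> sets delay_borel" "B \<in> sets delay_borel" "A \<inter> B = {}"
  shows "\<nu> (A \<union> B) = \<nu> A + \<nu> B"
proof -
  define E where "E = (\<lambda>n::nat. if n = 0 then A else if n = 1 then B else {})"
  have "(\<lambda>n. \<nu> (E n)) sums \<nu> (\<Union>n. E n)"
    using assms unfolding signed_measure_def
    by (elim conjE allE[of _ E]) (auto simp: disjoint_family_on_def E_def split: if_splits)
  moreover have "(\<Union>n. E n) = A \<union> B" by (auto simp: E_def split: if_splits)
  moreover have "(\<lambda>n. \<nu> (E n)) sums (\<Sum>n\<in>{0,1}. \<nu> (E n))"
    by (intro sums_finite) (auto simp: E_def signed_measure_empty[OF assms(1)])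
  ultimately show ?thesis by (auto simp: E_def dest: sums_unique2)
qed

text \<open>\<open>M\<close> prescribes its measure only on the intervals \<open>{-1..t}\<close>
  with \<open>t > -1\<close>, so these must generate all Borel sets; \<open>{-1}\<close> is
  recovered as a countable intersection of them.\<close>

lemma sets_delay_borel: "sets delay_borel = sigma_sets {-1..0} {{-1..t} |t. t \<in> {-1<..0::real}}"
  (is "_ = sigma_sets ?\<Omega> ?G")
proof (rule antisym)
  interpret G: sigma_algebra ?\<Omega> "sigma_sets ?\<Omega> ?G" by (rule sigma_algebra_sigma_sets) auto
  have G: "{-1..t} \<in> sigma_sets ?\<Omega> ?G" if "t \<in> {-1<..0}" for t using that
      by (intro sigma_sets.Basic) auto
  have "?\<Omega> \<inter> {..t} \<in> sigma_sets ?\<Omega> ?G" for t :: real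
  proof -
    consider "t < -1" | "t = -1" | "t \<in> {-1<..0}" | "t > 0" by fastforce
    then show ?thesis
    proof cases
      case 2
      have "(\<Inter>n::nat. {-1..-1 + 1 / Suc n}) \<in> sigma_sets ?\<Omega> ?G"
      proof (rule G.countable_INT)
        show "(UNIV :: nat set) \<noteq> {}" by simp
        have "{-1..-1 + 1 / real (Suc n)} \<in> sigma_sets ?\<Omega> ?G" for n
          by (rule G) (simp add: field_simps)
        then show "range (\<lambda>n. {-1..-1 + 1 / real (Suc n)}) \<subseteq> sigma_sets ?\<Omega> ?G" by blast
      qed
      moreover have "(\<Inter>n::nat. {-1..-1 + 1 / Suc n}) = ?\<Omega> \<inter> {..t}"
      proof
        show "(\<Inter>n::nat. {-1..-1 + 1 / Suc n}) \<subseteq> ?\<Omega> \<inter> {..t}"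
        proof
          fix x assume x: "x \<in> (\<Inter>n::nat. {-1..-1 + 1 / Suc n})"
          have "(\<lambda>n. -1 + 1 / real (Suc n)) \<longlonglongrightarrow> -1 + 0"
            by (intro tendsto_intros LIMSEQ_Suc lim_1_over_n)
          then have "x \<le> -1 + 0" by (rule LIMSEQ_le_const) (use x in auto)
          then show "x \<in> ?\<Omega> \<inter> {..t}" using 2 x by auto
        qed
      qed (auto simp: 2)
      ultimately show ?thesis by simp
    next
      case 3
      then have "?\<Omega> \<inter> {..t} = {-1..t}" by auto
      with G 3 show ?thesis by simp
    next
      case 4
      then have "?\<Omega> \<inter> {..t} = {-1..0}" by auto
      with G show ?thesis by simp
    next
      case 1
      then have "?\<Omega> \<inter> {..t} = {}" by auto
      then show ?thesis by (simp only: sigma_sets.Empty)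
    qed
  qed
  then have "(\<inter>) ?\<Omega> ` range atMost \<subseteq> sigma_sets ?\<Omega> ?G" by auto
  moreover have "sets delay_borel = sigma_sets ?\<Omega> ((\<inter>) ?\<Omega> ` range atMost)"
  proof -
    have b: "sets (borel :: real measure) = sigma_sets UNIV (range atMost)"
      by (subst borel_eq_atMost) simp
    have "?\<Omega> \<in> sigma_sets UNIV (range atMost)" unfolding b[symmetric] by simp
    then show ?thesis unfolding sets_restrict_space b by (rule sigma_sets_Int) simp
  qed
  ultimately show "sets delay_borel \<subseteq> sigma_sets ?\<Omega> ?G" by (simp add: sigma_sets_mono)
  show "sigma_sets ?\<Omega> ?G \<subseteq> sets delay_borel"
  proof -
    have "?G \<subseteq> sets delay_borel" by (auto simp: sets_restrict_space_iff)
    then show ?thesis using sets.sigma_sets_subset[of ?G delay_borel] by simp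
  qed
qed

text \<open>The uniqueness half of the correspondence behind \<open>measure_of_nbv\<close>, by the
  pi-lambda theorem: the generating intervals are stable under intersection. Outside the Borel sets
  both sides are 0 by convention.\<close>

lemma signed_measure_eqI:
  assumes "signed_measure \<nu>" "signed_measure \<nu>'" "\<And>t. t \<in> {-1<..0} \<Longrightarrow> \<nu> {-1..t} = \<nu>' {-1..t}"
  shows "\<nu> = \<nu>'"
proof
  fix A
  show "\<nu> A = \<nu>' A"
  proof (cases "A \<in> sets delay_borel")
    case False
    then show ?thesis using assms by (simp add: signed_measure_def)
  next
    case True
    let ?G = "{{-1..t} |t. t \<in> {-1<..0::real}}"
    have Om: "\<nu> {-1..0} = \<nu>' {-1..0}" using assms(3)[of 0] by simp
    have "Int_stable ?G"
    proof (rule Int_stableI)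
      fix a b assume "a \<in> ?G" "b \<in> ?G"
      then obtain s t where "a = {-1..s}" "b = {-1..t}" "s \<in> {-1<..0}" "t \<in> {-1<..0}" by auto
      then show "a \<inter> b \<in> ?G" by (intro CollectI exI[of _ "min s t"]) auto
    qed
    moreover have "?G \<subseteq> Pow {-1..0}" by auto
    moreover have "A \<in> sigma_sets {-1..0} ?G" using True sets_delay_borel by simp
    ultimately show ?thesis
    proof (induction rule: sigma_sets_induct_disjoint)
      case empty
      show ?case using assms signed_measure_empty by metis
    next
      case (compl A)
      have A: "A \<in> sets delay_borel" "{-1..0} - A \<in> sets delay_borel"
        using compl sets.compl_sets[of A delay_borel] by (auto simp: sets_delay_borel)
      then have "A \<union> ({-1..0} - A) = {-1..0}" using sets.sets_into_space[of A delay_borel] by auto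
      then show ?case
        using signed_measure_Un[OF assms(1) A] signed_measure_Un[OF assms(2) A] Om compl.IH by simp
    next
      case (union A)
      have "range A \<subseteq> sets delay_borel" using union by (auto simp: sets_delay_borel)
      then have "(\<lambda>n. \<nu> (A n)) sums \<nu> (\<Union>n. A n)" "(\<lambda>n. \<nu>' (A n)) sums \<nu>' (\<Union>n. A n)"
        using assms union(1) unfolding signed_measure_def by auto
      then show ?case using union by (auto intro: sums_unique2)
    qed (use assms(3) in auto)
  qed
qed

lemma measure_of_nbv_eqI:
  assumes "matrix_measure \<mu>" "\<And>t. t \<in> {-1<..0} \<Longrightarrow> M t = \<mu> {-1..t}"
  shows "measure_of_nbv M = \<mu>"
  unfolding measure_of_nbv_def
proof (rule the_equality)
  fix \<mu>' assume \<mu>': "matrix_measure \<mu>' \<and> (\<forall>t\<in>{-1<..0}. M t = \<mu>' {-1..t})"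
  have "(\<lambda>A. \<mu>' A $ i $ j) = (\<lambda>A. \<mu> A $ i $ j)" for i j
    using assms \<mu>' by (intro signed_measure_eqI) (auto simp: matrix_measure_def)
  then show "\<mu>' = \<mu>" by (auto simp: fun_eq_iff vec_eq_iff)
qed (use assms in auto)

section \<open>The Jordan decomposition of a signed measure\<close>

lemma sets_positive_part [simp]: "sets (positive_part \<nu>) = sets delay_borel"
  unfolding positive_part_def
  using sets.sigma_sets_eq[of delay_borel] sets.space_closed[of delay_borel]
  by (subst sets_measure_of) auto

lemma space_positive_part [simp]: "space (positive_part \<nu>) = {-1..0}"
  using sets_eq_imp_space_eq[OF sets_positive_part] by simp

lemma measurable_positive_part [simp]:
  "borel_measurable (positive_part \<nu>) = borel_measurable delay_borel"
  by (rule measurable_cong_sets) simp_all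

text \<open>For a Hahn set \<open>Y\<close> the supremum is attained at \<open>A \<inter> Y\<close>:
  dropping the part of \<open>B\<close> outside \<open>Y\<close> and adding the rest of
  \<open>A \<inter> Y\<close> can only increase \<open>\<nu>\<close>. Countable additivity has to be
  shown on the way, because \<open>measure_of\<close> yields the zero measure for a set function
  that is not a measure.\<close>

lemma emeasure_positive_part:
  assumes \<nu>: "signed_measure \<nu>" and Y: "Y \<in> sets delay_borel"
    and pos: "\<And>X. X \<in> sets delay_borel \<Longrightarrow> X \<subseteq> Y \<Longrightarrow> 0 \<le> \<nu> X"
    and neg: "\<And>X. X \<in> sets delay_borel \<Longrightarrow> X \<inter> Y = {} \<Longrightarrow> \<nu> X \<le> 0"
    and A: "A \<in> sets delay_borel"
  shows "emeasure (positive_part \<nu>) A = ennreal (\<nu> (A \<inter> Y))"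
proof -
  have sup: "(SUP B\<in>{B \<in> sets delay_borel. B \<subseteq> A}. ennreal (\<nu> B)) = ennreal (\<nu> (A \<inter> Y))"
    if A: "A \<in> sets delay_borel" for A
  proof (rule antisym)
    show "(SUP B\<in>{B \<in> sets delay_borel. B \<subseteq> A}. ennreal (\<nu> B)) \<le> ennreal (\<nu> (A \<inter> Y))"
    proof (rule SUP_least)
      fix B assume "B \<in> {B \<in> sets delay_borel. B \<subseteq> A}"
      then have B: "B \<in> sets delay_borel" "B \<subseteq> A" by auto
      have "\<nu> ((B \<inter> Y) \<union> (B - Y)) = \<nu> (B \<inter> Y) + \<nu> (B - Y)"
        using B Y by (intro signed_measure_Un \<nu>) auto
      moreover have "(B \<inter> Y) \<union> (B - Y) = B" by auto
      moreover have "\<nu> (B - Y) \<le> 0" using B Y by (intro neg) auto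
      moreover have "\<nu> ((B \<inter> Y) \<union> ((A - B) \<inter> Y)) = \<nu> (B \<inter> Y) + \<nu> ((A - B) \<inter> Y)"
        using B Y A by (intro signed_measure_Un \<nu>) auto
      moreover have "(B \<inter> Y) \<union> ((A - B) \<inter> Y) = A \<inter> Y" using B by auto
      moreover have "0 \<le> \<nu> ((A - B) \<inter> Y)" using B Y A by (intro pos) auto
      ultimately have "\<nu> B \<le> \<nu> (A \<inter> Y)" by simp
      then show "ennreal (\<nu> B) \<le> ennreal (\<nu> (A \<inter> Y))" by (rule ennreal_leI)
    qed
    show "ennreal (\<nu> (A \<inter> Y)) \<le> (SUP B\<in>{B \<in> sets delay_borel. B \<subseteq> A}. ennreal (\<nu> B))"
      by (rule SUP_upper) (use A Y in auto)
  qed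
  have "emeasure (positive_part \<nu>) A = (SUP B\<in>{B \<in> sets delay_borel. B \<subseteq> A}. ennreal (\<nu> B))"
  proof (rule emeasure_measure_of[OF positive_part_def])
    show "sets delay_borel \<subseteq> Pow {-1..0}" using sets.space_closed[of delay_borel] by simp
    show "positive (sets (positive_part \<nu>)) (\<lambda>A. SUP B\<in>{B \<in> sets delay_borel. B \<subseteq> A}. ennreal (\<nu> B))"
      by (simp add: positive_def sup signed_measure_empty[OF \<nu>])
    show "countably_additive (sets (positive_part \<nu>)) (\<lambda>A. SUP B\<in>{B
        \<in> sets delay_borel. B \<subseteq> A}. ennreal (\<nu> B))"
    proof (rule countably_additiveI)
      fix A :: "nat \<Rightarrow> real set"
      assume A: "range A \<subseteq> sets (positive_part \<nu>)" "disjoint_family A"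
          "\<Union>(range A) \<in> sets (positive_part \<nu>)"
      have "range (\<lambda>n. A n \<inter> Y) \<subseteq> sets delay_borel" using A Y by auto
      moreover have "disjoint_family (\<lambda>n. A n \<inter> Y)" using A by (auto simp: disjoint_family_on_def)
      ultimately have "(\<lambda>n. \<nu> (A n \<inter> Y)) sums \<nu> (\<Union>n. A n \<inter> Y)"
        using \<nu> unfolding signed_measure_def by blast
      moreover have "0 \<le> \<nu> (A n \<inter> Y)" for n using A Y by (intro pos) auto
      ultimately have "(\<Sum>n. ennreal (\<nu> (A n \<inter> Y))) = ennreal (\<nu> (\<Union>n. A n \<inter> Y))"
        by (intro suminf_ennreal_eq) auto
      moreover have "(\<Union>n. A n \<inter> Y) = \<Union>(range A) \<inter> Y" by auto
      moreover have "A n \<in> sets delay_borel" for n using A by auto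
      ultimately show "(\<Sum>n. SUP B\<in>{B \<in> sets delay_borel. B \<subseteq> A n}. ennreal (\<nu> B)) =
          (SUP B\<in>{B \<in> sets delay_borel. B \<subseteq> \<Union>(range A)}. ennreal (\<nu> B))"
        using A by (simp add: sup)
    qed
  qed (use A in simp)
  then show ?thesis by (simp add: sup A)
qed

lemma signed_measure_uminus: "signed_measure \<nu> \<Longrightarrow> signed_measure (\<lambda>A. - \<nu> A)"
  unfolding signed_measure_def by (auto intro: sums_minus)

lemma jordan_decomposition:
  assumes "difference_measure \<nu>"
  shows "finite_measure (positive_part \<nu>)" "finite_measure (positive_part (\<lambda>A. - \<nu> A))"
    "\<And>A. A \<in> sets delay_borel \<Longrightarrow>
       \<nu> A = measure (positive_part \<nu>) A - measure (positive_part (\<lambda>A. - \<nu> A)) A"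
proof -
  from assms obtain P Q where PQ: "finite_measure P" "finite_measure Q" "sets P = sets delay_borel"
    "sets Q = sets delay_borel" "\<nu> = signed_difference P Q" by (rule difference_measureE)
  interpret P: finite_measure P by fact
  interpret Q: finite_measure Q by fact
  have \<nu>: "signed_measure \<nu>" by (rule signed_measure_difference[OF assms])
  obtain Y where Y: "Y \<in> sets P" "\<forall>X\<in>sets P. X \<subseteq> Y \<longrightarrow> Q X \<le> P X" "\<forall>X\<in>sets P. X \<inter> Y = {} \<longrightarrow> P X \<le> Q X"
    using finite_unsigned_Hahn_decomposition[of P Q] PQ by auto
  have pos: "0 \<le> \<nu> X" if "X \<in> sets delay_borel" "X \<subseteq> Y" for X
    using Y(2) that by (simp add: PQ signed_difference_def P.emeasure_eq_measure Q.emeasure_eq_measure)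
  have neg: "\<nu> X \<le> 0" if "X \<in> sets delay_borel" "X \<inter> Y = {}" for X
    using Y(3) that by (simp add: PQ signed_difference_def P.emeasure_eq_measure Q.emeasure_eq_measure)
  have Ys: "Y \<in> sets delay_borel" "{-1..0} - Y \<in> sets delay_borel"
    using Y(1) sets.compl_sets[of Y delay_borel] by (auto simp: PQ)
  have 1: "emeasure (positive_part \<nu>) A = ennreal (\<nu> (A \<inter> Y))" if "A \<in> sets delay_borel" for A
    using emeasure_positive_part[OF \<nu> Ys(1) pos neg that] .
  \<comment> \<open>The complement of a Hahn set for \<open>\<nu>\<close> is a Hahn set for
    \<open>-\<nu>\<close>.\<close>
  have 2: "emeasure (positive_part (\<lambda>A. - \<nu> A)) A = ennreal (- \<nu> (A \<inter> ({-1..0} - Y)))"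
    if "A \<in> sets delay_borel" for A
  proof (rule emeasure_positive_part[OF signed_measure_uminus[OF \<nu>] Ys(2) _ _ that])
    fix X assume X: "X \<in> sets delay_borel"
    then have "X \<subseteq> {-1..0}" using sets.sets_into_space[OF X] by simp
    then show "X \<subseteq> {-1..0} - Y \<Longrightarrow> 0 \<le> - \<nu> X" "X \<inter> ({-1..0} - Y) = {} \<Longrightarrow> - \<nu> X \<le> 0"
      using pos[OF X] neg[OF X] by auto
  qed
  show "finite_measure (positive_part \<nu>)" using 1[of "{-1..0}"]
    by (intro finite_measureI) (simp add: sets_restrict_space_iff)
  show "finite_measure (positive_part (\<lambda>A. - \<nu> A))" using 2[of "{-1..0}"]
    by (intro finite_measureI) (simp add: sets_restrict_space_iff)
  fix A assume A: "A \<in> sets delay_borel"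
  have "\<nu> ((A \<inter> Y) \<union> (A \<inter> ({-1..0} - Y))) = \<nu> (A \<inter> Y) + \<nu> (A \<inter> ({-1..0} - Y))"
    using A Ys by (intro signed_measure_Un \<nu>) auto
  moreover have "(A \<inter> Y) \<union> (A \<inter> ({-1..0} - Y)) = A" using sets.sets_into_space[OF A] by auto
  moreover have "0 \<le> \<nu> (A \<inter> Y)" using A Ys by (intro pos) auto
  moreover have "\<nu> (A \<inter> ({-1..0} - Y)) \<le> 0" using A Ys by (intro neg) auto
  ultimately show "\<nu> A = measure (positive_part \<nu>) A - measure (positive_part (\<lambda>A. - \<nu> A)) A"
    using 1[OF A] 2[OF A] by (simp add: measure_def)
qed

section \<open>Integrals of simple functions, limits and changes of variable\<close>

lemma simple_function_vimage_sets:
  assumes "simple_function delay_borel u"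
  shows "u -` {i} \<inter> {-1..0} \<in> sets delay_borel"
  using simple_functionD(2)[OF assms, of "{i}"] by simp

lemma integral_simple_compose:
  fixes f :: "'i \<Rightarrow> 'b::{banach, second_countable_topology}"
  assumes P: "finite_measure P" "sets P = sets delay_borel" and u: "simple_function delay_borel u"
    and I: "finite I" "u ` {-1..0} \<subseteq> I"
  shows "integral\<^sup>L P (\<lambda>\<theta>. f (u \<theta>)) = (\<Sum>i\<in>I. measure P (u -` {i} \<inter> {-1..0}) *\<^sub>R f i)"
proof -
  interpret finite_measure P by fact
  have sp: "space P = {-1..0}" using sets_eq_imp_space_eq[OF P(2)] by simp
  have m: "u -` {i} \<inter> {-1..0} \<in> sets P" for i using simple_function_vimage_sets[OF u] P(2) by simp
  have "integral\<^sup>L P (\<lambda>\<theta>. f (u \<theta>)) = integral\<^sup>L P (\<lambda>\<theta>. \<Sum>i\<in>I. indicator (u -` {i} \<inter> {-1..0}) \<theta> *\<^sub>R f i)"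
  proof (rule Bochner_Integration.integral_cong)
    fix \<theta> assume "\<theta> \<in> space P"
    then have "(\<Sum>i\<in>I. indicator (u -` {i} \<inter> {-1..0}) \<theta> *\<^sub>R f i) = (\<Sum>i\<in>I. if i = u \<theta> then f i else 0)"
      by (intro sum.cong) (auto simp: sp indicator_def)
    also have "\<dots> = f (u \<theta>)"
    proof -
      have "u \<theta> \<in> I" using I \<open>\<theta> \<in> space P\<close> by (auto simp: sp)
      then show ?thesis using I by simp
    qed
    finally show "f (u \<theta>) = (\<Sum>i\<in>I. indicator (u -` {i} \<inter> {-1..0}) \<theta> *\<^sub>R f i)" by simp
  qed simp
  also have "\<dots> = (\<Sum>i\<in>I. integral\<^sup>L P (\<lambda>\<theta>. indicator (u -` {i} \<inter> {-1..0}) \<theta> *\<^sub>R f i))"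
    using m by (intro Bochner_Integration.integral_sum integrable_scaleR_left)
        (auto simp: less_top[symmetric])
  also have "\<dots> = (\<Sum>i\<in>I. measure P (u -` {i} \<inter> {-1..0}) *\<^sub>R f i)"
  proof (intro sum.cong refl)
    fix i
    have "integrable P (indicator (u -` {i} \<inter> {-1..0}) :: real \<Rightarrow> real)"
      using m[of i] by (auto simp: less_top[symmetric])
    then show "integral\<^sup>L P (\<lambda>\<theta>. indicator (u -` {i} \<inter> {-1..0}) \<theta> *\<^sub>R f i)
        = measure P (u -` {i} \<inter> {-1..0}) *\<^sub>R f i"
      by (simp add: sp Int_assoc)
  qed
  finally show ?thesis .
qed

text \<open>\<open>u\<close> only labels the pieces of a finite partition, and labels may have any
  type: later they are complex values, grid indices, and pairs of a value and an index.\<close>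

lemma signed_integral_simple:
  fixes f :: "'i \<Rightarrow> 'b::{banach, second_countable_topology}"
  assumes \<nu>: "difference_measure \<nu>" and u: "simple_function delay_borel u"
    and I: "finite I" "u ` {-1..0} \<subseteq> I"
  shows "signed_integral \<nu> (\<lambda>\<theta>. f (u \<theta>)) = (\<Sum>i\<in>I. \<nu> (u -` {i} \<inter> {-1..0}) *\<^sub>R f i)"
  unfolding signed_integral_def
  using simple_function_vimage_sets[OF u]
  by (subst (1 2) integral_simple_compose[OF _ _ u I])
    (simp_all add: jordan_decomposition[OF \<nu>] sum_subtractf scaleR_left_diff_distrib)

lemma signed_integral_dominated_convergence:
  fixes f :: "real \<Rightarrow> 'b::{banach, second_countable_topology}"
  assumes \<nu>: "difference_measure \<nu>" and f: "f \<in> borel_measurable delay_borel"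
    and s: "\<And>n. s n \<in> borel_measurable delay_borel"
    and lim: "\<And>\<theta>. \<theta> \<in> {-1..0} \<Longrightarrow> (\<lambda>n. s n \<theta>) \<longlonglongrightarrow> f \<theta>"
    and bound: "\<And>n \<theta>. \<theta> \<in> {-1..0} \<Longrightarrow> norm (s n \<theta>) \<le> c"
  shows "(\<lambda>n. signed_integral \<nu> (s n)) \<longlonglongrightarrow> signed_integral \<nu> f"
  unfolding signed_integral_def
proof (intro tendsto_diff)
  interpret P: finite_measure "positive_part \<nu>" by (rule jordan_decomposition[OF \<nu>])
  interpret Q: finite_measure "positive_part (\<lambda>A. - \<nu> A)" by (rule jordan_decomposition[OF \<nu>])
  show "(\<lambda>n. integral\<^sup>L (positive_part \<nu>) (s n)) \<longlonglongrightarrow> integral\<^sup>L (positive_part \<nu>) f"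
    by (rule integral_dominated_convergence[where w = "\<lambda>_. c"]) (use f s lim bound in auto)
  show "(\<lambda>n. integral\<^sup>L (positive_part (\<lambda>A. - \<nu> A)) (s n)) \<longlonglongrightarrow> integral\<^sup>L (positive_part (\<lambda>A. - \<nu> A)) f"
    by (rule integral_dominated_convergence[where w = "\<lambda>_. c"]) (use f s lim bound in auto)
qed

lemma difference_measure_pushforward:
  assumes "difference_measure \<nu>" and \<phi>: "\<phi> \<in> delay_maps"
  shows "difference_measure (pushforward \<phi> \<nu>)"
proof -
  from assms obtain P Q where PQ: "finite_measure P" "finite_measure Q" "sets P = sets delay_borel"
    "sets Q = sets delay_borel" "\<nu> = signed_difference P Q" by (elim difference_measureE)
  have sp: "space P = {-1..0}" "space Q = {-1..0}"
    using sets_eq_imp_space_eq[OF PQ(3)] sets_eq_imp_space_eq[OF PQ(4)] by simp_all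
  have mP: "\<phi> \<in> measurable P delay_borel" "\<phi> \<in> measurable Q delay_borel"
    using \<phi> PQ measurable_cong_sets[of P delay_borel delay_borel delay_borel]
      measurable_cong_sets[of Q delay_borel delay_borel delay_borel] by (auto simp: delay_maps_def)
  have "pushforward \<phi> \<nu> = signed_difference (distr P delay_borel \<phi>) (distr Q delay_borel \<phi>)"
  proof
    fix A
    have "\<phi> -` A \<inter> {-1..0} \<in> sets delay_borel" if "A \<in> sets delay_borel"
      using measurable_sets[of \<phi> delay_borel delay_borel A] that \<phi> by (simp add: delay_maps_def)
    then show "pushforward \<phi> \<nu> A = signed_difference (distr P delay_borel \<phi>) (distr Q delay_borel \<phi>) A"
      using mP by (simp add: pushforward_def signed_difference_def PQ measure_distr sp)
  qed
  then show ?thesis unfolding difference_measure_def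
    using PQ mP by (intro exI[of _ "distr P delay_borel \<phi>"] exI[of _ "distr Q delay_borel \<phi>"])
      (auto intro: finite_measure.finite_measure_distr)
qed

lemma simple_function_compose_delay_map:
  assumes "simple_function delay_borel u" "\<phi> \<in> delay_maps"
  shows "simple_function delay_borel (\<lambda>\<theta>. u (\<phi> \<theta>))"
  using simple_function_comp[of \<phi> delay_borel delay_borel u] assms by (simp add: delay_maps_def o_def)

lemma delay_mapsD: "\<phi> \<in> delay_maps \<Longrightarrow> \<theta> \<in> {-1..0} \<Longrightarrow> \<phi> \<theta> \<in> {-1..0}"
  using measurable_space[of \<phi> delay_borel delay_borel \<theta>] by (simp add: delay_maps_def)

text \<open>Masses of opposite sign can cancel under \<open>\<phi>\<close>, so the positive part of
  the image may be smaller than the image of the positive part, and the two parts cannot be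
  transported separately. On simple functions only values of \<open>\<nu>\<close> enter; dominated
  convergence does the rest.\<close>

lemma signed_integral_pushforward:
  fixes f :: "real \<Rightarrow> 'b::{banach, second_countable_topology}"
  assumes \<nu>: "difference_measure \<nu>" and \<phi>: "\<phi> \<in> delay_maps" and f: "f \<in> borel_measurable delay_borel"
    and bound: "\<And>\<theta>. \<theta> \<in> {-1..0} \<Longrightarrow> norm (f \<theta>) \<le> c"
  shows "signed_integral (pushforward \<phi> \<nu>) f = signed_integral \<nu> (\<lambda>\<theta>. f (\<phi> \<theta>))"
proof -
  obtain s where s: "\<And>n. simple_function delay_borel (s n)"
    "\<And>\<theta>. \<theta> \<in> {-1..0} \<Longrightarrow> (\<lambda>n. s n \<theta>) \<longlonglongrightarrow> f \<theta>"
    "\<And>n \<theta>. \<theta> \<in> {-1..0} \<Longrightarrow> norm (s n \<theta>) \<le> 2 * norm (f \<theta>)"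
    using borel_measurable_implies_sequence_metric[OF f, of 0]
        unfolding space_delay_borel dist_0_norm dist_norm diff_zero by metis
  have sb: "norm (s n \<theta>) \<le> 2 * c" if "\<theta> \<in> {-1..0}" for n \<theta>
    using s(3)[OF that, of n] bound[OF that] by simp
  have \<phi>m: "\<phi> \<in> measurable delay_borel delay_borel" using \<phi> by (simp add: delay_maps_def)
  have eq: "signed_integral (pushforward \<phi> \<nu>) (s n) = signed_integral \<nu> (\<lambda>\<theta>. s n (\<phi> \<theta>))" for n
  proof -
    have fin: "finite (s n ` {-1..0})" using simple_functionD(1)[OF s(1)[of n]] by simp
    have "signed_integral (pushforward \<phi> \<nu>) (\<lambda>\<theta>. id (s n \<theta>)) =
        (\<Sum>i\<in>s n ` {-1..0}. pushforward \<phi> \<nu> (s n -` {i} \<inter> {-1..0}) *\<^sub>R id i)"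
      by (rule signed_integral_simple[OF difference_measure_pushforward[OF \<nu> \<phi>] s(1) fin order_refl])
    also have "\<dots> = (\<Sum>i\<in>s n ` {-1..0}. \<nu> ((\<lambda>\<theta>. s n (\<phi> \<theta>)) -` {i} \<inter> {-1..0}) *\<^sub>R id i)"
    proof (rule sum.cong[OF refl])
      fix i
      have "\<phi> -` (s n -` {i} \<inter> {-1..0}) \<inter> {-1..0} = (\<lambda>\<theta>. s n (\<phi> \<theta>)) -` {i} \<inter> {-1..0}"
        using delay_mapsD[OF \<phi>] by auto
      then show "pushforward \<phi> \<nu> (s n -` {i} \<inter> {-1..0}) *\<^sub>R id i
          = \<nu> ((\<lambda>\<theta>. s n (\<phi> \<theta>)) -` {i} \<inter> {-1..0}) *\<^sub>R id i"
        using simple_function_vimage_sets[OF s(1)] by (simp add: pushforward_def)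
    qed
    also have "\<dots> = signed_integral \<nu> (\<lambda>\<theta>. id (s n (\<phi> \<theta>)))"
      by (rule signed_integral_simple[symmetric, OF \<nu> simple_function_compose_delay_map[OF s(1) \<phi>] fin])
        (use delay_mapsD[OF \<phi>] in auto)
    finally show ?thesis by simp
  qed
  have "(\<lambda>n. signed_integral (pushforward \<phi> \<nu>) (s n)) \<longlonglongrightarrow> signed_integral (pushforward \<phi> \<nu>) f"
    by (rule signed_integral_dominated_convergence[OF difference_measure_pushforward[OF \<nu> \<phi>] f,
        where c = "2 * c"])
      (use s sb in \<open>auto intro: borel_measurable_simple_function\<close>)
  moreover have "(\<lambda>n. signed_integral \<nu> (\<lambda>\<theta>. s n (\<phi> \<theta>))) \<longlonglongrightarrow> signed_integral \<nu> (\<lambda>\<theta>. f (\<phi> \<theta>))"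
  proof (rule signed_integral_dominated_convergence[OF \<nu>])
    show "(\<lambda>\<theta>. f (\<phi> \<theta>)) \<in> borel_measurable delay_borel" by (rule measurable_compose[OF \<phi>m f])
    show "(\<lambda>\<theta>. s n (\<phi> \<theta>)) \<in> borel_measurable delay_borel" for n
      by (rule measurable_compose[OF \<phi>m borel_measurable_simple_function[OF s(1)]])
    show "(\<lambda>n. s n (\<phi> \<theta>)) \<longlonglongrightarrow> f (\<phi> \<theta>)" if "\<theta> \<in> {-1..0}" for \<theta>
      by (rule s(2)[OF delay_mapsD[OF \<phi> that]])
    show "norm (s n (\<phi> \<theta>)) \<le> 2 * c" if "\<theta> \<in> {-1..0}" for n \<theta>
      by (rule sb[OF delay_mapsD[OF \<phi> that]])
  qed
  ultimately show ?thesis unfolding eq by (rule LIMSEQ_unique)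
qed

section \<open>Measures of functions of bounded variation\<close>

lemma is_norm_nonneg:
  assumes "is_norm N"
  shows "0 \<le> N x"
proof -
  have "N (x + (-1) *\<^sub>R x) \<le> N x + N ((-1) *\<^sub>R x)" "N ((-1) *\<^sub>R x) = \<bar>-1\<bar> * N x"
    using assms unfolding is_norm_def by blast+
  moreover have "N (x + (-1) *\<^sub>R x) = 0" using assms unfolding is_norm_def by simp
  ultimately show ?thesis by simp
qed

lemma is_norm_sum_le:
  assumes "is_norm N" "finite I"
  shows "N (\<Sum>i\<in>I. f i) \<le> (\<Sum>i\<in>I. N (f i))"
  using assms(2)
proof induction
  case empty
  have "N 0 = 0" using assms(1) unfolding is_norm_def by blast
  then show ?case by simp
next
  case (insert i I)
  have "N (f i + (\<Sum>i\<in>I. f i)) \<le> N (f i) + N (\<Sum>i\<in>I. f i)"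
    using assms(1) by (auto simp: is_norm_def)
  then show ?case using insert by simp
qed

lemma is_norm_upper_bound:
  fixes N :: "real^'n \<Rightarrow> real"
  assumes N: "is_norm N"
  shows "\<exists>C>0. \<forall>x. N x \<le> C * norm x"
proof -
  define C where "C = (\<Sum>i\<in>UNIV. N (axis i 1)) + 1"
  have "C > 0" unfolding C_def by (intro add_nonneg_pos sum_nonneg is_norm_nonneg[OF N]) auto
  moreover have "N x \<le> C * norm x" for x
  proof -
    have "N x = N (\<Sum>i\<in>UNIV. x $ i *\<^sub>R axis i 1)"
      using basis_expansion[of x] by (simp add: scalar_mult_eq_scaleR)
    also have "\<dots> \<le> (\<Sum>i\<in>UNIV. N (x $ i *\<^sub>R axis i 1))" by (rule is_norm_sum_le[OF N]) simp
    also have "\<dots> = (\<Sum>i\<in>UNIV. \<bar>x $ i\<bar> * N (axis i 1))" using N by (simp add: is_norm_def)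
    also have "\<dots> \<le> (\<Sum>i\<in>UNIV. norm x * N (axis i 1))"
      by (intro sum_mono mult_right_mono component_le_norm_cart is_norm_nonneg[OF N])
    also have "\<dots> \<le> C * norm x" by (simp add: C_def algebra_simps sum_distrib_left)
    finally show ?thesis .
  qed
  ultimately show ?thesis by blast
qed

lemma is_norm_continuous:
  fixes N :: "real^'n \<Rightarrow> real"
  assumes N: "is_norm N"
  shows "continuous_on S N"
proof -
  obtain C where C: "C > 0" "\<And>x. N x \<le> C * norm x" using is_norm_upper_bound[OF N] by blast
  have le: "N x - N y \<le> C * dist x y" for x y
  proof -
    have "N ((x - y) + y) \<le> N (x - y) + N y" using N unfolding is_norm_def by blast
    then show ?thesis using C(2)[of "x - y"] by (simp add: dist_norm)
  qed
  have "dist (N x) (N y) \<le> C * dist x y" for x y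
    using le[of x y] le[of y x] unfolding dist_real_def dist_commute[of y x] by linarith
  then have "C-lipschitz_on S N" using C by (intro lipschitz_onI) auto
  then show ?thesis by (rule lipschitz_on_continuous_on)
qed

lemma is_norm_lower_bound:
  fixes N :: "real^'n \<Rightarrow> real"
  assumes N: "is_norm N"
  shows "\<exists>c>0. \<forall>x. c * norm x \<le> N x"
proof -
  have "sphere (0::real^'n) 1 \<noteq> {}" by simp
  then obtain b where b: "b \<in> sphere 0 1" "\<And>x. x \<in> sphere 0 1 \<Longrightarrow> N b \<le> N x"
    using continuous_attains_inf[of "sphere (0::real^'n) 1" N] is_norm_continuous[OF N] by auto
  have "b \<noteq> 0" using b(1) by auto
  then have "N b > 0" using N is_norm_nonneg[OF N, of b] by (auto simp: is_norm_def less_le)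
  moreover have "N b * norm x \<le> N x" for x
  proof (cases "x = 0")
    case True
    then show ?thesis using is_norm_nonneg[OF N] by simp
  next
    case False
    have "N b \<le> N ((1 / norm x) *\<^sub>R x)" using False by (intro b) simp
    also have "\<dots> = N x / norm x" using N by (simp add: is_norm_def)
    finally show ?thesis using False by (simp add: field_simps)
  qed
  ultimately show ?thesis by blast
qed

text \<open>Bounds every quotient and not just the supremum: a real-valued \<open>SUP\<close>
  dominates its members only once they are known to be bounded.\<close>

lemma induced_norm_quotient_bound:
  fixes N :: "real^'n \<Rightarrow> real"
  assumes N: "is_norm N"
  shows "\<exists>K>0. \<forall>A x. N (A *v x) / N x \<le> K * (\<Sum>i\<in>UNIV. \<Sum>j\<in>UNIV. \<bar>A $ i $ j\<bar>)"
proof -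
  obtain C where C: "C > 0" "\<And>x. N x \<le> C * norm x" using is_norm_upper_bound[OF N] by blast
  obtain c where c: "c > 0" "\<And>x. c * norm x \<le> N x" using is_norm_lower_bound[OF N] by blast
  have "N (A *v x) / N x \<le> C / c * (\<Sum>i\<in>UNIV. \<Sum>j\<in>UNIV. \<bar>A $ i $ j\<bar>)" for A :: "real^'n^'n" and x
  proof (cases "x = 0")
    case True
    then show ?thesis using C c N by (simp add: is_norm_def sum_nonneg)
  next
    case False
    have "N (A *v x) \<le> C * ((\<Sum>i\<in>UNIV. \<Sum>j\<in>UNIV. \<bar>A $ i $ j\<bar>) * norm x)"
    proof -
      have "C * norm (A *v x) \<le> C * ((\<Sum>i\<in>UNIV. \<Sum>j\<in>UNIV. \<bar>A $ i $ j\<bar>) * norm x)"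
        using norm_matrix_vector_mult_le[of A x] C(1) by (intro mult_left_mono) auto
      then show ?thesis using C(2)[of "A *v x"] by linarith
    qed
    moreover have "N x \<ge> c * norm x" "c * norm x > 0" using c False by auto
    ultimately have "N (A *v x) / N x \<le> C * ((\<Sum>i\<in>UNIV. \<Sum>j\<in>UNIV. \<bar>A $ i $ j\<bar>) * norm x) / (c * norm x)"
      using C(1) by (intro frac_le mult_nonneg_nonneg sum_nonneg) auto
    also have "\<dots> = C / c * (\<Sum>i\<in>UNIV. \<Sum>j\<in>UNIV. \<bar>A $ i $ j\<bar>)" using False by (simp add: field_simps)
    finally show ?thesis .
  qed
  then show ?thesis using C c by (intro exI[of _ "C / c"]) auto
qed

lemma induced_norm_upper_bound:
  fixes N :: "real^'n \<Rightarrow> real"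
  assumes N: "is_norm N"
  shows "\<exists>K>0. \<forall>A. induced_norm N A \<le> K * (\<Sum>i\<in>UNIV. \<Sum>j\<in>UNIV. \<bar>A $ i $ j\<bar>)"
proof -
  obtain K where K: "K > 0" "\<And>A x. N (A *v x) / N x \<le> K * (\<Sum>i\<in>UNIV. \<Sum>j\<in>UNIV. \<bar>A $ i $ j\<bar>)"
    using induced_norm_quotient_bound[OF N] by blast
  then have "induced_norm N A \<le> K * (\<Sum>i\<in>UNIV. \<Sum>j\<in>UNIV. \<bar>A $ i $ j\<bar>)" for A
    unfolding induced_norm_def by (intro cSUP_least) auto
  with K(1) show ?thesis by blast
qed

lemma induced_norm_lower_bound:
  fixes N :: "real^'n \<Rightarrow> real"
  assumes N: "is_norm N"
  shows "\<exists>K>0. \<forall>A i j. \<bar>A $ i $ j\<bar> \<le> K * induced_norm N A"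
proof -
  obtain c where c: "c > 0" "\<And>x. c * norm x \<le> N x" using is_norm_lower_bound[OF N] by blast
  obtain K where K: "\<And>A x. N (A *v x) / N x \<le> K * (\<Sum>i\<in>UNIV. \<Sum>j\<in>UNIV. \<bar>A $ i $ j\<bar>)"
    using induced_norm_quotient_bound[OF N] by blast
  define L where "L = (\<Sum>i\<in>UNIV. N (axis i 1)) + 1"
  have "L > 0" unfolding L_def by (intro add_nonneg_pos sum_nonneg is_norm_nonneg[OF N]) auto
  have "\<bar>A $ i $ j\<bar> \<le> L / c * induced_norm N A" for A i j
  proof -
    have q: "N (A *v x) / N x \<le> induced_norm N A" for x
      unfolding induced_norm_def by (rule cSUP_upper) (auto intro!: bdd_aboveI K)
    have nz: "N (axis j 1) > 0" using N is_norm_nonneg[OF N, of "axis j 1"]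
        by (auto simp: is_norm_def less_le)
    have "0 \<le> induced_norm N A" using q[of 0] N by (simp add: is_norm_def)
    have "A $ i $ j = (A *v axis j 1) $ i" by (simp add: matrix_vector_mult_basis column_def)
    then have "c * \<bar>A $ i $ j\<bar> \<le> c * norm (A *v axis j 1)"
        using c component_le_norm_cart[of "A *v axis j 1" i] by (intro mult_left_mono) auto
    also have "\<dots> \<le> N (A *v axis j 1)" by (rule c)
    also have "\<dots> \<le> N (axis j 1) * induced_norm N A" using q[of "axis j 1"] nz by (simp add: field_simps)
    also have "\<dots> \<le> L * induced_norm N A"
    proof (intro mult_right_mono \<open>0 \<le> induced_norm N A\<close>)
      have "N (axis j 1) \<le> (\<Sum>i\<in>UNIV. N (axis i 1))"
        using is_norm_nonneg[OF N] by (intro member_le_sum) auto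
      then show "N (axis j 1) \<le> L" by (simp add: L_def)
    qed
    finally show ?thesis using c by (simp add: field_simps)
  qed
  then show ?thesis using \<open>L > 0\<close> c by (intro exI[of _ "L / c"]) auto
qed

section \<open>Functions of bounded variation as differences of distribution functions\<close>

definition variation_below :: "(real \<Rightarrow> real) \<Rightarrow> real \<Rightarrow> real" where
  "variation_below f x = (SUP (n, t)\<in>{(n::nat, t). mono_on {..n} t \<and> t ` {..n} \<subseteq> {..x}}.
     \<Sum>k<n. \<bar>f (t (Suc k)) - f (t k)\<bar>)"

text \<open>Appending \<open>x\<close> and \<open>y\<close> to a partition below \<open>x\<close>
  gives a partition below \<open>y\<close> whose sum is larger by at least the last jump.
  Consequently the variation, and the variation minus \<open>f\<close>, are both monotone.\<close>

lemma variation_below_increment: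
  assumes C: "\<And>(n::nat) t. mono_on {..n} t \<Longrightarrow> (\<Sum>k<n. \<bar>f (t (Suc k)) - f (t k)\<bar>) \<le> C" and "x \<le> y"
  shows "variation_below f x + \<bar>f y - f x\<bar> \<le> variation_below f y"
proof -
  have "(\<Sum>k<n. \<bar>f (t (Suc k)) - f (t k)\<bar>) \<le> variation_below f y - \<bar>f y - f x\<bar>"
    if t: "mono_on {..n} t" "t ` {..n} \<subseteq> {..x}" for n t
  proof -
    define s where "s k = (if k \<le> n then t k else if k = Suc n then x else y)" for k
    have tx: "t k \<le> x" if "k \<le> n" for k using t that by auto
    have "mono_on {..Suc (Suc n)} s"
    proof (rule mono_onI)
      fix j k assume "j \<in> {..Suc (Suc n)}" "k \<in> {..Suc (Suc n)}" "j \<le> k"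
      then show "s j \<le> s k" using tx[of j] mono_onD[OF t(1), of j k] \<open>x \<le> y\<close>
        by (auto simp: s_def)
    qed
    moreover have "s ` {..Suc (Suc n)} \<subseteq> {..y}" using tx \<open>x \<le> y\<close> by (force simp: s_def)
    ultimately have "(\<lambda>(n, t). \<Sum>k<n. \<bar>f (t (Suc k)) - f (t k)\<bar>) (Suc (Suc n), s) \<le> variation_below f y"
      unfolding variation_below_def by (intro cSUP_upper) (auto intro!: bdd_aboveI C)
    moreover have "(\<Sum>k<n. \<bar>f (s (Suc k)) - f (s k)\<bar>) = (\<Sum>k<n. \<bar>f (t (Suc k)) - f (t k)\<bar>)"
      by (intro sum.cong) (auto simp: s_def)
    moreover have "\<bar>f (s (Suc (Suc n))) - f (s (Suc n))\<bar> = \<bar>f y - f x\<bar>" by (simp add: s_def)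
    ultimately show ?thesis by simp
  qed
  moreover have "(0, \<lambda>_. x) \<in> {(n::nat, t). mono_on {..n} t \<and> t ` {..n} \<subseteq> {..x}}"
      by (simp add: mono_on_def)
  then have "{(n::nat, t). mono_on {..n} t \<and> t ` {..n} \<subseteq> {..x}} \<noteq> {}" by blast
  ultimately have "variation_below f x \<le> variation_below f y - \<bar>f y - f x\<bar>"
    unfolding variation_below_def[of f x] by (intro cSUP_least) auto
  then show ?thesis by simp
qed

text \<open>\<open>interval_measure\<close> asks for right continuity. Passing to right limits
  provides it, and the difference of the two regularised monotone parts is the right limit of
  \<open>f\<close>, hence \<open>f\<close> itself wherever \<open>f\<close> is
  right-continuous.\<close>

lemma right_limit_exists:
  fixes g :: "real \<Rightarrow> real"
  assumes "mono g"
  shows "\<exists>G. mono G \<and> (\<forall>x. continuous (at_right x) G) \<and> (\<forall>x. (g \<longlongrightarrow> G x) (at_right x))"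
proof -
  define G where "G x = Inf (g ` {x<..})" for x
  have bdd: "bdd_below (g ` {x<..})" for x
    using assms by (auto intro!: bdd_belowI[of _ "g x"] monoD[OF assms])
  have Gle: "G x \<le> g y" if "x < y" for x y
    unfolding G_def using that by (intro cINF_lower bdd) auto
  have mono: "mono G" unfolding G_def
    by (intro monoI cINF_superset_mono bdd) auto
  have "(g \<longlongrightarrow> G x) (at_right x)" for x
    using Lim_right_bound[of UNIV x g "g x"] monoD[OF assms] by (simp add: G_def)
  moreover have "continuous (at_right x) G" for x
    unfolding continuous_within
  proof (rule order_tendstoI)
    fix a assume "a < G x"
    then have "a < G y" if "x < y" for y using monoD[OF mono, of x y] that by simp
    then show "eventually (\<lambda>y. a < G y) (at_right x)"
      by (rule eventually_mono[OF eventually_at_right_less])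
  next
    fix a assume "G x < a"
    then obtain z where z: "z > x" "g z < a" unfolding G_def
        by (subst (asm) cINF_less_iff[OF _ bdd]) auto
    have "eventually (\<lambda>y. y \<in> {x<..<z}) (at_right x)" using z by (intro eventually_at_right_real) auto
    then show "eventually (\<lambda>y. G y < a) (at_right x)"
      by eventually_elim (use Gle z in \<open>auto intro: le_less_trans\<close>)
  qed
  ultimately show ?thesis using mono by blast
qed

text \<open>The map \<open>max (-1)\<close> collects all the mass of \<open>{-2<..-1}\<close> in the
  point -1, so that a jump of \<open>G\<close> at -1 becomes an atom there. The base point -2 merely
  has to lie to the left of -1.\<close>

lemma delay_measure_of_distribution:
  assumes G: "mono G" "\<And>x. continuous (at_right x) G"
  shows "\<exists>P. finite_measure P \<and> sets P = sets delay_borel \<and>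
    (\<forall>t\<in>{-1<..0}. measure P {-1..t} = G t - G (-2))"
proof -
  define R where "R = restrict_space (interval_measure G) {-2<..0}"
  define P where "P = distr R delay_borel (max (-1))"
  have m: "max (-1) \<in> measurable R delay_borel" unfolding R_def
    by (intro measurable_restrict_space2 measurable_restrict_space1) (auto simp: space_restrict_space)
  have Ioc: "emeasure (interval_measure G) {-2<..t} = ennreal (G t - G (-2))" if "-2 \<le> t" for t
    using emeasure_interval_measure_Ioc[OF that] G monoD[OF G(1)] by auto
  have "finite_measure R"
    using Ioc[of 0] by (intro finite_measureI) (simp add: R_def space_restrict_space
        emeasure_restrict_space)
  then have "finite_measure P" unfolding P_def by (rule finite_measure.finite_measure_distr[OF _ m])
  moreover have "measure P {-1..t} = G t - G (-2)" if t: "t \<in> {-1<..0}" for t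
  proof -
    have "emeasure P {-1..t} = emeasure R (max (-1) -` {-1..t} \<inter> space R)"
      unfolding P_def using t by (intro emeasure_distr m) (auto simp: sets_restrict_space_iff)
    also have "max (-1) -` {-1..t} \<inter> space R = {-2<..t}" using t
        by (auto simp: R_def space_restrict_space)
    also have "emeasure R {-2<..t} = ennreal (G t - G (-2))"
      using t Ioc[of t] unfolding R_def by (subst emeasure_restrict_space) auto
    finally show ?thesis using monoD[OF G(1), of "-2" t] t by (simp add: measure_def)
  qed
  ultimately show ?thesis by (intro exI[of _ P]) (auto simp: P_def)
qed

lemma difference_measure_of_variation:
  assumes C: "\<And>(n::nat) t. mono_on {..n} t \<Longrightarrow> (\<Sum>k<n. \<bar>f (t (Suc k)) - f (t k)\<bar>) \<le> C"
    and right: "\<And>t. t \<in> {-1<..0} \<Longrightarrow> (f \<longlongrightarrow> f t) (at_right t)" "(f \<longlongrightarrow> 0) (at_right (-2))"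
  shows "\<exists>\<nu>. difference_measure \<nu> \<and> (\<forall>t\<in>{-1<..0}. \<nu> {-1..t} = f t)"
proof -
  define g where "g = variation_below f"
  define h where "h x = g x - f x" for x
  have inc: "g x + \<bar>f y - f x\<bar> \<le> g y" if "x \<le> y" for x y
    unfolding g_def using C that by (rule variation_below_increment)
  have "mono g" "mono h"
  proof (safe intro!: monoI)
    fix x y :: real assume "x \<le> y"
    then have "g x + \<bar>f y - f x\<bar> \<le> g y" by (rule inc)
    then show "g x \<le> g y" "h x \<le> h y" by (auto simp: h_def)
  qed
  then obtain G H where G: "mono G" "\<And>x. continuous (at_right x) G" "\<And>x. (g \<longlongrightarrow> G x) (at_right x)"
    and H: "mono H" "\<And>x. continuous (at_right x) H" "\<And>x. (h \<longlongrightarrow> H x) (at_right x)"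
    using right_limit_exists by metis
  have "((\<lambda>x. g x - h x) \<longlongrightarrow> G x - H x) (at_right x)" for x by (intro tendsto_diff G H)
  then have lim: "(f \<longlongrightarrow> G x - H x) (at_right x)" for x by (simp add: h_def)
  obtain P where P: "finite_measure P" "sets P = sets delay_borel" "\<forall>t\<in>{-1<..0}. measure P {-1..t}
      = G t - G (-2)"
    using delay_measure_of_distribution[of G] G by blast
  obtain Q where Q: "finite_measure Q" "sets Q = sets delay_borel" "\<forall>t\<in>{-1<..0}. measure Q {-1..t}
      = H t - H (-2)"
    using delay_measure_of_distribution[of H] H by blast
  \<comment> \<open>\<open>f\<close> tends to 0 at -2 from the right, so the base values cancel and
    no additive constant is left.\<close>
  have 2: "G (-2) - H (-2) = 0" using tendsto_unique[OF _ lim[of "-2"] right(2)] by simp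
  have "signed_difference P Q {-1..t} = f t" if "t \<in> {-1<..0}" for t
  proof -
    have "G t - H t = f t" using tendsto_unique[OF _ lim[of t] right(1)[OF that]] by simp
    moreover have "{-1..t} \<in> sets delay_borel" using that by (auto simp: sets_restrict_space_iff)
    ultimately show ?thesis using that P Q 2 by (simp add: signed_difference_def)
  qed
  moreover have "difference_measure (signed_difference P Q)"
    using P Q by (auto simp: difference_measure_def)
  ultimately show ?thesis by blast
qed

section \<open>Matrix measures and their images under delay maps\<close>

definition matrix_difference :: "(real set \<Rightarrow> real^'n^'n) \<Rightarrow> bool" where
  "matrix_difference \<mu> \<longleftrightarrow> (\<forall>i j. difference_measure (\<lambda>A. \<mu> A $ i $ j))"

lemma matrix_difference_imp_matrix_measure: "matrix_difference \<mu> \<Longrightarrow> matrix_measure \<mu>"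
  by (simp add: matrix_difference_def matrix_measure_def signed_measure_difference)

text \<open>The existence half of the correspondence behind \<open>measure_of_nbv\<close>, obtained
  entry by entry.\<close>

lemma matrix_difference_of_nbv:
  assumes N: "is_norm N" and M: "M \<in> NBV N"
  shows "matrix_difference (measure_of_nbv M)"
proof -
  have M0: "M (-1) = 0" and right: "\<And>t. t \<in> {-1<..<0} \<Longrightarrow> continuous (at_right t) M"
    using M by (auto simp: NBV_def)
  obtain C where C: "\<And>(n::nat) t. mono_on {..n} t \<Longrightarrow> t ` {..n} \<subseteq> {-1..0} \<Longrightarrow>
        (\<Sum>k<n. induced_norm N (M (t (Suc k)) - M (t k))) \<le> C"
    using M by (auto simp: NBV_def bounded_variation_def)
  obtain K where K: "K > 0" "\<And>A i j. \<bar>A $ i $ j\<bar> \<le> K * induced_norm N A"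
    using induced_norm_lower_bound[OF N] by blast
  \<comment> \<open>Clamping extends \<open>M\<close> to the whole line: the extension is 0 up to
    -1, because \<open>M (-1) = 0\<close>, and constant from 0 on. This gives the right limit 0 at
    -2 and right continuity at 0.\<close>
  define cl where "cl s = max (-1) (min 0 s)" for s :: real
  have "\<exists>\<nu>. difference_measure \<nu> \<and> (\<forall>t\<in>{-1<..0}. \<nu> {-1..t} = M (cl t) $ i $ j)" for i j
  proof (rule difference_measure_of_variation)
    fix n :: nat and t :: "nat \<Rightarrow> real" assume t: "mono_on {..n} t"
    have "(\<Sum>k<n. \<bar>M (cl (t (Suc k))) $ i $ j - M (cl (t k)) $ i $ j\<bar>)
        \<le> (\<Sum>k<n. K * induced_norm N (M (cl (t (Suc k))) - M (cl (t k))))"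
      by (intro sum_mono) (metis K(2) vector_minus_component)
    also have "\<dots> \<le> K * C" unfolding sum_distrib_left[symmetric]
    proof (rule mult_left_mono)
      have "mono_on {..n} (\<lambda>k. cl (t k))" using t by (fastforce simp: mono_on_def cl_def)
      then show "(\<Sum>k<n. induced_norm N (M (cl (t (Suc k))) - M (cl (t k)))) \<le> C"
        by (rule C) (auto simp: cl_def)
    qed (use K in simp)
    finally show "(\<Sum>k<n. \<bar>M (cl (t (Suc k))) $ i $ j - M (cl (t k)) $ i $ j\<bar>) \<le> K * C" .
  next
    fix t :: real assume t: "t \<in> {-1<..0}"
    show "((\<lambda>t. M (cl t) $ i $ j) \<longlongrightarrow> M (cl t) $ i $ j) (at_right t)"
    proof (cases "t = 0")
      case True
      have "eventually (\<lambda>s. M (cl s) $ i $ j = M (cl t) $ i $ j) (at_right t)"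
        using eventually_at_right_less[of t] by eventually_elim (simp add: cl_def True)
      then show ?thesis by (rule tendsto_eventually)
    next
      case False
      have "(M \<longlongrightarrow> M t) (at_right t)" using right[of t] t False by (simp add: continuous_within)
      then have "((\<lambda>s. M s $ i $ j) \<longlongrightarrow> M t $ i $ j) (at_right t)" by (intro tendsto_vec_nth)
      moreover have "eventually (\<lambda>s. s \<in> {t<..<0}) (at_right t)"
        using t False by (intro eventually_at_right_real) auto
      then have "eventually (\<lambda>s. M s $ i $ j = M (cl s) $ i $ j) (at_right t)"
        by eventually_elim (use t in \<open>auto simp: cl_def\<close>)
      ultimately have "((\<lambda>s. M (cl s) $ i $ j) \<longlongrightarrow> M t $ i $ j) (at_right t)"
        by (rule Lim_transform_eventually)
      moreover have "cl t = t" using t by (simp add: cl_def)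
      ultimately show ?thesis by simp
    qed
  next
    have "eventually (\<lambda>s. s \<in> {-2<..<-1}) (at_right (-2::real))"
        by (intro eventually_at_right_real) auto
    then have "eventually (\<lambda>s. M (cl s) $ i $ j = 0) (at_right (-2))"
      by eventually_elim (auto simp: cl_def M0)
    then show "((\<lambda>t. M (cl t) $ i $ j) \<longlongrightarrow> 0) (at_right (-2))" by (rule tendsto_eventually)
  qed
  then obtain \<nu> where \<nu>: "\<And>i j. difference_measure (\<nu> i j)"
    "\<And>i j t. t \<in> {-1<..0} \<Longrightarrow> \<nu> i j {-1..t} = M (cl t) $ i $ j" by metis
  define \<mu> where "\<mu> A = (\<chi> i j. \<nu> i j A)" for A
  have \<mu>: "matrix_difference \<mu>" using \<nu>(1) by (simp add: matrix_difference_def \<mu>_def)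
  have "measure_of_nbv M = \<mu>"
  proof (rule measure_of_nbv_eqI)
    fix t :: real assume "t \<in> {-1<..0}"
    then show "M t = \<mu> {-1..t}" using \<nu>(2)[of t] by (simp add: vec_eq_iff \<mu>_def cl_def)
  qed (use \<mu> in \<open>rule matrix_difference_imp_matrix_measure\<close>)
  with \<mu> show ?thesis by simp
qed

lemma matrix_difference_pushforward:
  assumes "matrix_difference \<mu>" "\<phi> \<in> delay_maps"
  shows "matrix_difference (pushforward \<phi> \<mu>)"
proof -
  have "(\<lambda>A. pushforward \<phi> \<mu> A $ i $ j) = pushforward \<phi> (\<lambda>A. \<mu> A $ i $ j)" for i j
    by (auto simp: pushforward_def)
  then show ?thesis using assms by (simp add: matrix_difference_def difference_measure_pushforward)
qed

text \<open>The pushforward is itself a matrix measure with the prescribed values on intervals, so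
  uniqueness identifies it.\<close>

lemma measure_of_nbv_perturbed:
  assumes "matrix_difference (measure_of_nbv M)" "\<phi> \<in> delay_maps"
  shows "measure_of_nbv (perturbed \<phi> M) = pushforward \<phi> (measure_of_nbv M)"
  unfolding perturbed_def
  by (rule measure_of_nbv_eqI)
    (simp_all add: nbv_of_measure_def matrix_difference_imp_matrix_measure
        matrix_difference_pushforward assms)

lemma matrix_integral_perturbed:
  assumes M: "matrix_difference (measure_of_nbv M)" and \<phi>: "\<phi> \<in> delay_maps"
    and "g \<in> borel_measurable delay_borel" "\<And>\<theta>. \<theta> \<in> {-1..0} \<Longrightarrow> cmod (g \<theta>) \<le> c"
  shows "matrix_integral (perturbed \<phi> M) g = matrix_integral M (\<lambda>\<theta>. g (\<phi> \<theta>))"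
proof -
  have "(\<lambda>A. pushforward \<phi> (measure_of_nbv M) A $ i $ j)
      = pushforward \<phi> (\<lambda>A. measure_of_nbv M A $ i $ j)" for i j
    by (auto simp: pushforward_def)
  moreover have "signed_integral (pushforward \<phi> (\<lambda>A. measure_of_nbv M A $ i $ j)) g =
      signed_integral (\<lambda>A. measure_of_nbv M A $ i $ j) (\<lambda>\<theta>. g (\<phi> \<theta>))" for i j
    using assms by (intro signed_integral_pushforward[where c = c]) (auto simp: matrix_difference_def)
  ultimately show ?thesis unfolding matrix_integral_def measure_of_nbv_perturbed[OF M \<phi>] by simp
qed

lemma vector_integral_perturbed:
  assumes M: "matrix_difference (measure_of_nbv M)" and \<phi>: "\<phi> \<in> delay_maps"
    and f: "continuous_on {-1..0} f"
  shows "vector_integral (perturbed \<phi> M) f = vector_integral M (\<lambda>\<theta>. f (\<phi> \<theta>))"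
proof -
  have *: "(\<lambda>A. pushforward \<phi> (measure_of_nbv M) A $ i $ j)
      = pushforward \<phi> (\<lambda>A. measure_of_nbv M A $ i $ j)" for i j
    by (auto simp: pushforward_def)
  have "signed_integral (pushforward \<phi> (\<lambda>A. measure_of_nbv M A $ i $ j)) (\<lambda>\<theta>. f \<theta> $ j) =
      signed_integral (\<lambda>A. measure_of_nbv M A $ i $ j) (\<lambda>\<theta>. f (\<phi> \<theta>) $ j)" for i j
  proof -
    have c: "continuous_on {-1..0} (\<lambda>\<theta>. f \<theta> $ j)" using f by (intro continuous_intros)
    then have "bounded ((\<lambda>\<theta>. f \<theta> $ j) ` {-1..0})"
      by (intro compact_imp_bounded compact_continuous_image) auto
    then obtain B where "\<And>\<theta>. \<theta> \<in> {-1..0} \<Longrightarrow> norm (f \<theta> $ j) \<le> B" unfolding bounded_iff by blast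
    then show ?thesis using M c
      by (intro signed_integral_pushforward[OF _ \<phi>, where c
          = B] borel_measurable_continuous_on_restrict)
        (auto simp: matrix_difference_def)
  qed
  then show ?thesis unfolding vector_integral_def measure_of_nbv_perturbed[OF M \<phi>] * by simp
qed

section \<open>Growth of linear recurrences\<close>

text \<open>The weighted \<open>\<ell>\<^sup>1\<close> norm is submultiplicative, so it passes through determinants and through
  division by linear factors with large roots.\<close>

definition weighted_l1_le :: "real \<Rightarrow> complex fps \<Rightarrow> real \<Rightarrow> bool" where
  "weighted_l1_le \<rho> f K \<longleftrightarrow> (\<forall>n. (\<Sum>k\<le>n. cmod (fps_nth f k) * \<rho> ^ k) \<le> K)"

lemma weighted_l1_le_mono: "weighted_l1_le \<rho> f K \<Longrightarrow> K \<le> L \<Longrightarrow> weighted_l1_le \<rho> f L"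
  unfolding weighted_l1_le_def by (meson order_trans)

lemma weighted_l1_le_nonneg: "weighted_l1_le \<rho> f K \<Longrightarrow> 0 \<le> K"
proof -
  assume "weighted_l1_le \<rho> f K"
  then have "(\<Sum>k\<le>0. cmod (fps_nth f k) * \<rho> ^ k) \<le> K" unfolding weighted_l1_le_def by blast
  then have "cmod (fps_nth f 0) \<le> K" by simp
  then show ?thesis by (meson norm_ge_zero order_trans)
qed

lemma weighted_l1_le_coeff:
  assumes "weighted_l1_le \<rho> f K" "0 < \<rho>"
  shows "cmod (fps_nth f n) * \<rho> ^ n \<le> K"
proof -
  have "cmod (fps_nth f n) * \<rho> ^ n \<le> (\<Sum>k\<le>n. cmod (fps_nth f k) * \<rho> ^ k)"
    using assms(2) by (intro member_le_sum) auto
  then show ?thesis using assms(1) unfolding weighted_l1_le_def by (meson order_trans)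
qed

lemma weighted_l1_le_add:
  assumes "weighted_l1_le \<rho> f K" "weighted_l1_le \<rho> g L" "0 < \<rho>"
  shows "weighted_l1_le \<rho> (f + g) (K + L)"
  unfolding weighted_l1_le_def
proof
  fix n
  have "(\<Sum>k\<le>n. cmod (fps_nth (f + g) k) * \<rho> ^ k)
      \<le> (\<Sum>k\<le>n. cmod (fps_nth f k) * \<rho> ^ k + cmod (fps_nth g k) * \<rho> ^ k)"
    using assms(3) by (intro sum_mono) (simp add: norm_triangle_ineq flip: distrib_right)
  then show "(\<Sum>k\<le>n. cmod (fps_nth (f + g) k) * \<rho> ^ k) \<le> K + L"
    using assms(1,2) unfolding weighted_l1_le_def sum.distrib by (meson add_mono order_trans)
qed

lemma weighted_l1_le_uminus: "weighted_l1_le \<rho> f K \<Longrightarrow> weighted_l1_le \<rho> (- f) K"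
  unfolding weighted_l1_le_def by simp

lemma weighted_l1_le_0: "weighted_l1_le \<rho> 0 0"
  unfolding weighted_l1_le_def by simp

lemma weighted_l1_le_sum:
  assumes "\<And>i. i \<in> I \<Longrightarrow> weighted_l1_le \<rho> (f i) (K i)" "0 < \<rho>"
  shows "weighted_l1_le \<rho> (\<Sum>i\<in>I. f i) (\<Sum>i\<in>I. K i)"
  using assms(1) by (induction I rule: infinite_finite_induct)
    (auto simp: weighted_l1_le_0 intro!: weighted_l1_le_add assms(2))

lemma weighted_l1_le_mult:
  assumes "weighted_l1_le \<rho> f K" "weighted_l1_le \<rho> g L" "0 < \<rho>"
  shows "weighted_l1_le \<rho> (f * g) (K * L)"
  unfolding weighted_l1_le_def
proof
  fix n
  define a where "a k = cmod (fps_nth f k) * \<rho> ^ k" for k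
  define b where "b k = cmod (fps_nth g k) * \<rho> ^ k" for k
  have nn: "0 \<le> a k" "0 \<le> b k" for k using assms(3) by (auto simp: a_def b_def)
  have "(\<Sum>k\<le>n. cmod (fps_nth (f * g) k) * \<rho> ^ k) \<le> (\<Sum>k\<le>n. \<Sum>i\<le>k. a i * b (k - i))"
  proof (rule sum_mono)
    fix k
    have "cmod (fps_nth (f * g) k) * \<rho> ^ k \<le> (\<Sum>i\<le>k. cmod (fps_nth f i * fps_nth g (k - i))) * \<rho> ^ k"
      unfolding fps_mult_nth atLeast0AtMost using assms(3) by (intro mult_right_mono norm_sum) auto
    also have "\<dots> = (\<Sum>i\<le>k. a i * b (k - i))"
      unfolding sum_distrib_right
      by (intro sum.cong refl) (auto simp: a_def b_def norm_mult power_add[symmetric] algebra_simps)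
    finally show "cmod (fps_nth (f * g) k) * \<rho> ^ k \<le> (\<Sum>i\<le>k. a i * b (k - i))" .
  qed
  also have "\<dots> = (\<Sum>(i, j)\<in>{(i, j). i + j \<le> n}. a i * b j)"
    by (simp add: sum.triangle_reindex_eq)
  also have "\<dots> \<le> (\<Sum>(i, j)\<in>{..n} \<times> {..n}. a i * b j)"
    using nn by (intro sum_mono2) auto
  also have "\<dots> = (\<Sum>i\<le>n. a i) * (\<Sum>j\<le>n. b j)" by (simp add: sum_product sum.cartesian_product)
  also have "\<dots> \<le> K * L"
  proof (rule mult_mono)
    show "sum a {..n} \<le> K" "sum b {..n} \<le> L"
      using assms(1,2) unfolding weighted_l1_le_def a_def b_def by auto
    show "0 \<le> K" by (rule weighted_l1_le_nonneg[OF assms(1)])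
    show "0 \<le> sum b {..n}" using nn by (intro sum_nonneg) auto
  qed
  finally show "(\<Sum>k\<le>n. cmod (fps_nth (f * g) k) * \<rho> ^ k) \<le> K * L" .
qed

lemma weighted_l1_le_1: "weighted_l1_le \<rho> 1 1"
proof -
  have "(\<Sum>k\<le>n. cmod (fps_nth 1 k) * \<rho> ^ k) = (\<Sum>k\<le>n. if k = 0 then 1 else 0)" for n
    by (intro sum.cong) auto
  then show ?thesis unfolding weighted_l1_le_def by simp
qed

lemma weighted_l1_le_prod:
  assumes "\<And>i. i \<in> I \<Longrightarrow> weighted_l1_le \<rho> (f i) (K i)" "0 < \<rho>"
  shows "weighted_l1_le \<rho> (\<Prod>i\<in>I. f i) (\<Prod>i\<in>I. K i)"
  using assms(1) by (induction I rule: infinite_finite_induct)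
    (auto simp: weighted_l1_le_1 intro!: weighted_l1_le_mult assms(2))

lemma weighted_l1_le_monom:
  assumes "0 < \<rho>"
  shows "weighted_l1_le \<rho> (fps_const a * fps_X ^ j) (cmod a * \<rho> ^ j)"
  unfolding weighted_l1_le_def
proof
  fix n
  have "(\<Sum>k\<le>n. cmod (fps_nth (fps_const a * fps_X ^ j) k) * \<rho> ^ k)
      = (\<Sum>k\<le>n. if k = j then cmod a * \<rho> ^ j else 0)"
    by (intro sum.cong) (auto simp: fps_X_power_nth)
  also have "\<dots> \<le> cmod a * \<rho> ^ j" using assms by simp
  finally show "(\<Sum>k\<le>n. cmod (fps_nth (fps_const a * fps_X ^ j) k) * \<rho> ^ k) \<le> cmod a * \<rho> ^ j" .
qed

text \<open>Division is multiplication by a geometric series, whose weighted norm is at most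
  \<open>1 / (1 - cmod a * \<rho>)\<close>.\<close>

lemma weighted_l1_le_divide_linear:
  assumes "weighted_l1_le \<rho> (f * (1 - fps_const a * fps_X)) K" "0 < \<rho>" "cmod a * \<rho> < 1"
  shows "weighted_l1_le \<rho> f (K * (1 / (1 - cmod a * \<rho>)))"
proof -
  define g where "g = Abs_fps (\<lambda>n. a ^ n)"
  have "(1 - fps_const a * fps_X) * g = 1"
  proof (rule fps_ext)
    fix n show "fps_nth ((1 - fps_const a * fps_X) * g) n = fps_nth 1 n"
      by (cases n) (simp_all add: g_def algebra_simps fps_X_mult_nth fps_mult_nth_0 mult.assoc)
  qed
  then have "f = f * (1 - fps_const a * fps_X) * g" by (simp add: mult.assoc)
  moreover have "weighted_l1_le \<rho> g (1 / (1 - cmod a * \<rho>))"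
    unfolding weighted_l1_le_def
  proof
    fix n
    have "(\<Sum>k\<le>n. cmod (fps_nth g k) * \<rho> ^ k) = (\<Sum>k\<le>n. (cmod a * \<rho>) ^ k)"
      by (simp add: g_def norm_power power_mult_distrib)
    also have "\<dots> \<le> (\<Sum>k. (cmod a * \<rho>) ^ k)"
      using assms by (intro sum_le_suminf summable_geometric) auto
    also have "\<dots> = 1 / (1 - cmod a * \<rho>)" using assms by (intro suminf_geometric) auto
    finally show "(\<Sum>k\<le>n. cmod (fps_nth g k) * \<rho> ^ k) \<le> 1 / (1 - cmod a * \<rho>)" .
  qed
  ultimately show ?thesis using weighted_l1_le_mult[OF assms(1) _ assms(2)] by metis
qed

text \<open>The linear factors are divided off one at a time. \<open>C\<close> is chosen before
  \<open>f\<close>, which later makes the growth bound uniform in the initial data.\<close>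

lemma weighted_l1_le_divide_poly:
  assumes p0: "poly p 0 = 1" and roots: "\<And>z. poly p z = 0 \<Longrightarrow> \<rho> < cmod z" and \<rho>: "0 < \<rho>"
  shows "\<exists>C\<ge>0. \<forall>f K. weighted_l1_le \<rho> (f * fps_of_poly p) K \<longrightarrow> weighted_l1_le \<rho> f (K * C)"
proof -
  obtain zs where zs: "p = (\<Prod>z\<leftarrow>zs. [:1, - (1/z):])" "\<forall>z\<in>set zs. z \<noteq> 0 \<and> poly p z = 0"
    using poly_factor_nonzero_root[OF p0] by auto
  have small: "cmod (1/z) * \<rho> < 1" if "z \<in> set zs" for z
    using zs(2) roots that by (auto simp: norm_divide divide_simps)
  have "\<exists>C\<ge>0. \<forall>f K. weighted_l1_le \<rho> (f * fps_of_poly (\<Prod>z\<leftarrow>zs. [:1, - (1/z):])) K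
      \<longrightarrow> weighted_l1_le \<rho> f (K * C)"
    using small
  proof (induction zs)
    case Nil
    show ?case by (intro exI[of _ 1]) simp
  next
    case (Cons z zs)
    then obtain C where C: "C \<ge> 0" "\<And>f K. weighted_l1_le \<rho> (f * fps_of_poly (\<Prod>z\<leftarrow>zs. [:1, - (1/z):])) K
      \<Longrightarrow> weighted_l1_le \<rho> f (K * C)" by auto
    have lin: "fps_of_poly [:1, - (1/z):] = 1 - fps_const (1/z) * fps_X"
      by (simp add: fps_of_poly_pCons fps_of_poly_const flip: fps_const_neg)
    have "weighted_l1_le \<rho> f (K * (1 / (1 - cmod (1/z) * \<rho>) * C))"
      if "weighted_l1_le \<rho> (f * fps_of_poly (\<Prod>z\<leftarrow>z # zs. [:1, - (1/z):])) K" for f K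
    proof -
      have "f * fps_of_poly (\<Prod>z\<leftarrow>z # zs. [:1, - (1/z):])
          = (f * fps_of_poly (\<Prod>z\<leftarrow>zs. [:1, - (1/z):])) * (1 - fps_const (1/z) * fps_X)"
        unfolding list.map prod_list.Cons fps_of_poly_mult lin by (simp add: mult_ac)
      with that have "weighted_l1_le \<rho> ((f * fps_of_poly (\<Prod>z\<leftarrow>zs. [:1, - (1/z):])) *
          (1 - fps_const (1/z) * fps_X)) K"
        by (simp only:)
      then have "weighted_l1_le \<rho> (f * fps_of_poly (\<Prod>z\<leftarrow>zs. [:1, - (1/z):]))
          (K * (1 / (1 - cmod (1/z) * \<rho>)))"
        by (intro weighted_l1_le_divide_linear \<rho> Cons.prems) simp_all
      from C(2)[OF this] show ?thesis by (simp add: mult.assoc)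
    qed
    moreover have "1 / (1 - cmod (1/z) * \<rho>) * C \<ge> 0"
      using Cons.prems[of z] C(1) by (intro mult_nonneg_nonneg) auto
    ultimately show ?case by blast
  qed
  then show ?thesis unfolding zs(1)[symmetric] .
qed

section \<open>Cramer's rule and matrix recurrences\<close>

text \<open>Division-free, so that it applies to matrices of power series. The replaced column is a
  combination of the columns of \<open>A\<close>; by multilinearity only the \<open>k\<close>-th one
  survives, as every other summand has a repeated column. The computation is done with rows of the
  transpose.\<close>

lemma cramer_comm_ring:
  fixes A :: "'a::comm_ring_1^'n^'n"
  shows "det (\<chi> i j. if j = k then (A *v x) $ i else A $ i $ j) = x $ k * det A"
proof -
  have row: "det (\<chi> i. if i = k then row j B else row i B) = (if j = k then det B else 0)" for j
      and B :: "'a^'n^'n"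
  proof (cases "j = k")
    case True
    then have "(\<chi> i. if i = k then row j B else row i B) = B" by (simp add: vec_eq_iff row_def)
    then show ?thesis using True by simp
  next
    case False
    then show ?thesis by (simp, intro det_identical_rows[of j k]) (auto simp: row_def)
  qed
  have "det (\<chi> i j. if j = k then (A *v x) $ i else A $ i $ j)
      = det (transpose (\<chi> i j. if j = k then (A *v x) $ i else A $ i $ j))" by simp
  also have "transpose (\<chi> i j. if j = k then (A *v x) $ i else A $ i $ j)
      = (\<chi> i. if i = k then (\<Sum>j\<in>UNIV. x $ j *s row j (transpose A)) else row i (transpose A))"
    by (auto simp: vec_eq_iff transpose_def row_def matrix_vector_mult_def mult.commute)
  also have "det \<dots> = (\<Sum>j\<in>UNIV. det (\<chi> i. if i = k then x $ j *s row j (transpose A) else row i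
      (transpose A)))"
    by (rule det_linear_row_sum) simp
  also have "\<dots> = (\<Sum>j\<in>UNIV. x $ j * (if j = k then det A else 0))"
    by (intro sum.cong refl) (simp add: det_row_mul row)
  also have "\<dots> = x $ k * det A" by (simp add: if_distrib cong: if_cong)
  finally show ?thesis .
qed

lemma fps_of_poly_det: "fps_of_poly (det A)
    = det (\<chi> i j. fps_of_poly ((A::'a::comm_ring_1 poly^'n^'n) $ i $ j))"
proof -
  have "fps_of_poly (of_int k * q) = of_int k * fps_of_poly q" for k and q :: "'a poly"
    by (simp only: fps_of_poly_mult of_int_poly fps_of_poly_const fps_of_int)
  then show ?thesis by (simp add: det_def fps_of_poly_sum fps_of_poly_prod)
qed

text \<open>With \<open>z = exp (-s/m)\<close> its determinant is the characteristic function of the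
  system with delays \<open>j/m\<close>; a disc around 0 in \<open>z\<close> corresponds to a right
  half-plane in \<open>s\<close>.\<close>

definition recurrence_pencil :: "nat \<Rightarrow> (nat \<Rightarrow> real^'n^'n) \<Rightarrow> complex \<Rightarrow> complex^'n^'n" where
  "recurrence_pencil m A z = mat 1 - (\<chi> a b. \<Sum>j\<in>{1..m}. of_real (A j $ a $ b) * z ^ j)"

text \<open>The generating series \<open>F\<close> of \<open>Y\<close> satisfies
  \<open>P *v F = U\<close>, where \<open>U\<close> is a polynomial vector determined by the first
  \<open>m\<close> values. Cramer's rule gives \<open>F $ k * det P = D\<close> with
  \<open>D\<close> bounded by a multiple of \<open>b\<close>, and \<open>det P\<close>, whose roots
  all lie beyond \<open>\<rho>\<close>, can be divided out.\<close>

lemma recurrence_bound: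
  fixes A :: "nat \<Rightarrow> real^'n^'n"
  assumes \<rho>: "0 < \<rho>" and nz: "\<And>z. cmod z \<le> \<rho> \<Longrightarrow> det (recurrence_pencil m A z) \<noteq> 0"
  shows "\<exists>K\<ge>0. \<forall>Y b. (\<forall>n<m. \<forall>i. \<bar>Y n $ i\<bar> \<le> b) \<longrightarrow> (\<forall>n\<ge>m. Y n = (\<Sum>j\<in>{1..m}. A j *v Y (n - j))) \<longrightarrow> 0 \<le> b \<longrightarrow>
      (\<forall>n i. \<bar>Y n $ i\<bar> * \<rho> ^ n \<le> K * b)"
proof -
  define Q :: "complex poly^'n^'n" where
    "Q = mat 1 - (\<chi> a b. \<Sum>j\<in>{1..m}. monom (of_real (A j $ a $ b)) j)"
  define P :: "complex fps^'n^'n" where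
    "P = mat 1 - (\<chi> a b. \<Sum>j\<in>{1..m}. fps_const (of_real (A j $ a $ b)) * fps_X ^ j)"
  have PQ: "P = (\<chi> a b. fps_of_poly (Q $ a $ b))"
    by (auto simp: vec_eq_iff P_def Q_def mat_def fps_of_poly_diff fps_of_poly_sum fps_of_poly_monom)
  have Qz: "poly (det Q) z = det (recurrence_pencil m A z)" for z
    unfolding poly_det recurrence_pencil_def
    by (rule arg_cong[where f = det]) (auto simp: vec_eq_iff Q_def mat_def poly_sum poly_monom)
  have "recurrence_pencil m A 0 = mat 1"
    by (simp add: recurrence_pencil_def vec_eq_iff power_0_left)
  then have Q0: "poly (det Q) 0 = 1" by (simp add: Qz)
  have "\<rho> < cmod z" if "poly (det Q) z = 0" for z using that nz[of z] by (force simp: Qz)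
  from weighted_l1_le_divide_poly[OF Q0 this \<rho>] obtain C where
    C: "C \<ge> 0" "\<And>f K. weighted_l1_le \<rho> (f * det P) K \<Longrightarrow> weighted_l1_le \<rho> f (K * C)"
    unfolding fps_of_poly_det PQ[symmetric] by blast
  define c where "c a b = 1 + (\<Sum>j\<in>{1..m}. cmod (of_real (A j $ a $ b)) * \<rho> ^ j)" for a b
  have c0: "0 \<le> c a b" for a b unfolding c_def using \<rho> by (intro add_nonneg_nonneg sum_nonneg) auto
  have Pc: "weighted_l1_le \<rho> (P $ a $ b) (c a b)" for a b
  proof -
    have "weighted_l1_le \<rho> (mat 1 $ a $ b) 1"
      by (auto simp: mat_def weighted_l1_le_1 intro: weighted_l1_le_mono[OF weighted_l1_le_0])
    moreover have "weighted_l1_le \<rho> (- (\<Sum>j\<in>{1..m}. fps_const (of_real (A j $ a $ b)) * fps_X ^ j))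
        (\<Sum>j\<in>{1..m}. cmod (of_real (A j $ a $ b)) * \<rho> ^ j)"
      by (intro weighted_l1_le_uminus weighted_l1_le_sum weighted_l1_le_monom \<rho>)
    ultimately show ?thesis unfolding c_def using weighted_l1_le_add[OF _ _ \<rho>]
      by (fastforce simp: P_def)
  qed
  define e where "e = (\<Sum>n<m. \<Sum>a\<in>UNIV. \<Sum>b\<in>UNIV. \<Sum>k\<le>n. cmod (fps_nth (P $ a $ b) k) * \<rho> ^ n)"
  have e0: "0 \<le> e" unfolding e_def using \<rho> by (intro sum_nonneg) auto
  \<comment> \<open>The Leibniz expansion with every entry replaced by its norm bound and column
    \<open>k\<close> by \<open>e\<close>; summing over \<open>k\<close> as well gives one constant
    for all components.\<close>
  define T where "T = (\<Sum>k\<in>UNIV. \<Sum>p\<in>{p. p permutes (UNIV::'n set)}. \<Prod>i\<in>UNIV. if p i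
      = k then e else c i (p i))"
  have T_term: "0 \<le> (\<Prod>i\<in>UNIV. if p i = k then e else c i (p i))" for p k
    using e0 c0 by (intro prod_nonneg) auto
  have T0: "0 \<le> T" unfolding T_def using T_term by (intro sum_nonneg) auto
  have "\<bar>Y n $ k\<bar> * \<rho> ^ n \<le> (T * C) * b"
    if init: "\<forall>n<m. \<forall>i. \<bar>Y n $ i\<bar> \<le> b" and rec: "\<forall>n\<ge>m. Y n = (\<Sum>j\<in>{1..m}. A j *v Y (n - j))"
      and b: "0 \<le> b" for Y :: "nat \<Rightarrow> real^'n" and b n k
  proof -
    define F :: "complex fps^'n" where "F = (\<chi> i. Abs_fps (\<lambda>n. of_real (Y n $ i)))"
    define U where "U = P *v F"
    \<comment> \<open>From index \<open>m\<close> on, the coefficients of \<open>P *v F\<close> are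
      the defects of the recurrence.\<close>
    have U_large: "fps_nth (U $ a) n = 0" if "n \<ge> m" for a n
    proof -
      have "fps_nth (U $ a) n = fps_nth (F $ a) n
          - (\<Sum>d\<in>UNIV. \<Sum>j\<in>{1..m}. of_real (A j $ a $ d) * fps_nth (F $ d) (n - j))"
      proof -
        have "U $ a = F $ a - (\<Sum>d\<in>UNIV. \<Sum>j\<in>{1..m}. fps_const (of_real (A j $ a $ d)) *
            (fps_X ^ j * F $ d))"
          unfolding U_def P_def matrix_vector_mult_diff_rdistrib matrix_vector_mul_lid
          by (simp add: matrix_vector_mult_def sum_distrib_right mult.assoc)
        then show ?thesis using that
          by (simp add: fps_sum_nth fps_X_power_mult_nth)
      qed
      also have "\<dots> = of_real (Y n $ a - (\<Sum>j\<in>{1..m}. A j *v Y (n - j)) $ a)"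
        unfolding F_def by (subst sum.swap) (simp add: matrix_vector_mult_def)
      also have "\<dots> = 0" using rec that by simp
      finally show ?thesis .
    qed
    have U_small: "cmod (fps_nth (U $ a) n) \<le> (\<Sum>d\<in>UNIV. \<Sum>k\<le>n. cmod (fps_nth (P $ a $ d) k)) * b"
        if "n < m" for a n
    proof -
      have "fps_nth (U $ a) n = (\<Sum>d\<in>UNIV. \<Sum>k\<le>n. fps_nth (P $ a $ d) k * fps_nth (F $ d) (n - k))"
        by (simp add: U_def matrix_vector_mult_def fps_sum_nth fps_mult_nth atLeast0AtMost)
      also have "cmod \<dots> \<le> (\<Sum>d\<in>UNIV. \<Sum>k\<le>n. cmod (fps_nth (P $ a $ d) k) * b)"
        using init that by (intro sum_norm_le) (auto simp: norm_mult F_def intro!: mult_left_mono)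
      finally show ?thesis by (simp add: sum_distrib_right)
    qed
    have Ue: "weighted_l1_le \<rho> (U $ a) (e * b)" for a
      unfolding weighted_l1_le_def
    proof
      fix n
      have "(\<Sum>k\<le>n. cmod (fps_nth (U $ a) k) * \<rho> ^ k)
          \<le> (\<Sum>k\<in>{..n} \<union> {..<m}. cmod (fps_nth (U $ a) k) * \<rho> ^ k)"
        using \<rho> by (intro sum_mono2) auto
      also have "\<dots> = (\<Sum>k<m. cmod (fps_nth (U $ a) k) * \<rho> ^ k)"
        using U_large by (intro sum.mono_neutral_right) auto
      also have "\<dots> \<le> (\<Sum>n<m. (\<Sum>d\<in>UNIV. \<Sum>k\<le>n. cmod (fps_nth (P $ a $ d) k)) * b * \<rho> ^ n)"
        using \<rho> by (intro sum_mono mult_right_mono U_small) auto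
      also have "\<dots> = (\<Sum>n<m. \<Sum>d\<in>UNIV. \<Sum>k\<le>n. cmod (fps_nth (P $ a $ d) k) * \<rho> ^ n) * b"
        unfolding sum_distrib_right by (simp only: mult_ac)
      also have "\<dots> \<le> e * b"
      proof (intro mult_right_mono b)
        have "(\<Sum>d\<in>UNIV. \<Sum>k\<le>n. cmod (fps_nth (P $ a $ d) k) * \<rho> ^ n)
            \<le> (\<Sum>a\<in>UNIV. \<Sum>d\<in>UNIV. \<Sum>k\<le>n. cmod (fps_nth (P $ a $ d) k) * \<rho> ^ n)" for n
          using \<rho> by (intro member_le_sum[where f =
              "\<lambda>a. \<Sum>d\<in>UNIV. \<Sum>k\<le>n. cmod (fps_nth (P $ a $ d) k) * \<rho> ^ n"] sum_nonneg) auto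
        then show "(\<Sum>n<m. \<Sum>d\<in>UNIV. \<Sum>k\<le>n. cmod (fps_nth (P $ a $ d) k) * \<rho> ^ n) \<le> e"
          unfolding e_def by (rule sum_mono)
      qed
      finally show "(\<Sum>k\<le>n. cmod (fps_nth (U $ a) k) * \<rho> ^ k) \<le> e * b" .
    qed
    define D where "D = det (\<chi> i j. if j = k then U $ i else P $ i $ j)"
    have D: "F $ k * det P = D" unfolding D_def U_def by (rule cramer_comm_ring[symmetric])
    \<comment> \<open>A permutation meets column \<open>k\<close> exactly once, so \<open>b\<close>
      enters every product to the first power: the bound is linear in the initial data.\<close>
    have term_eq: "(\<Prod>i\<in>UNIV. if p i = k then e * b else c i (p i))
        = (\<Prod>i\<in>UNIV. if p i = k then e else c i (p i)) * b"
      if p: "p permutes (UNIV::'n set)" for p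
    proof -
      obtain i0 where i0: "p i0 = k" using permutes_surj[OF p] by (metis surjD)
      have eq: "p i = k \<longleftrightarrow> i = i0" for i using i0 permutes_inj[OF p] by (metis injD)
      show ?thesis unfolding eq by (simp add: prod.remove[of UNIV i0] mult_ac)
    qed
    have "weighted_l1_le \<rho> D (\<Sum>p\<in>{p. p permutes (UNIV::'n set)}. \<Prod>i\<in>UNIV. if p i
        = k then e * b else c i (p i))"
      unfolding D_def det_def
    proof (intro weighted_l1_le_sum \<rho>)
      fix p
      have "weighted_l1_le \<rho> (\<Prod>i\<in>UNIV. (\<chi> i j. if j = k then U $ i else P $ i $ j) $ i $ p i)
          (\<Prod>i\<in>UNIV. if p i = k then e * b else c i (p i))"
        using Ue Pc by (intro weighted_l1_le_prod \<rho>) auto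
      then show "weighted_l1_le \<rho> (of_int (sign p) * (\<Prod>i\<in>UNIV. (\<chi> i j. if j
          = k then U $ i else P $ i $ j) $ i $ p i))
          (\<Prod>i\<in>UNIV. if p i = k then e * b else c i (p i))"
        by (cases "sign p = 1") (auto simp: sign_def weighted_l1_le_uminus split: if_splits)
    qed
    moreover have "(\<Sum>p\<in>{p. p permutes (UNIV::'n set)}. \<Prod>i\<in>UNIV. if p i = k then e * b else c i (p i))
        = (\<Sum>p\<in>{p. p permutes (UNIV::'n set)}. \<Prod>i\<in>UNIV. if p i = k then e else c i (p i)) * b"
      unfolding sum_distrib_right by (intro sum.cong refl term_eq) simp
    ultimately have "weighted_l1_le \<rho> (F $ k * det P)
        ((\<Sum>p\<in>{p. p permutes (UNIV::'n set)}. \<Prod>i\<in>UNIV. if p i = k then e else c i (p i)) * b)"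
      unfolding D by simp
    then have "weighted_l1_le \<rho> (F $ k * det P) (T * b)"
    proof (rule weighted_l1_le_mono)
      show "(\<Sum>p\<in>{p. p permutes (UNIV::'n set)}. \<Prod>i\<in>UNIV. if p i = k then e else c i (p i)) * b \<le> T * b"
        unfolding T_def using T_term
        by (intro mult_right_mono b member_le_sum[where f =
            "\<lambda>k. \<Sum>p\<in>{p. p permutes (UNIV::'n set)}. \<Prod>i\<in>UNIV. if p i
            = k then e else c i (p i)"] sum_nonneg) auto
    qed
    then have "weighted_l1_le \<rho> (F $ k) (T * b * C)" by (rule C(2))
    from weighted_l1_le_coeff[OF this \<rho>, of n] show ?thesis by (simp add: F_def mult_ac)
  qed
  then show ?thesis using T0 C(1) by (intro exI[of _ "T * C"]) auto
qed

section \<open>Systems with commensurable delays\<close>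

lemma sup_norm_upper:
  fixes N :: "real^'n \<Rightarrow> real"
  assumes N: "is_norm N" and f: "continuous_on {-1..0} f" and \<theta>: "\<theta> \<in> {-1..0}"
  shows "N (f \<theta>) \<le> sup_norm N f"
proof -
  have "continuous_on {-1..0} (\<lambda>\<theta>. N (f \<theta>))"
    using continuous_on_compose[OF f is_norm_continuous[OF N]] by (simp add: o_def)
  then have "bdd_above ((\<lambda>\<theta>. N (f \<theta>)) ` {-1..0})"
    by (intro bounded_imp_bdd_above compact_imp_bounded compact_continuous_image) auto
  then show ?thesis unfolding sup_norm_def using \<theta> by (intro cSUP_upper)
qed

lemma sup_norm_least:
  assumes "\<And>\<theta>. \<theta> \<in> {-1..0} \<Longrightarrow> N (f \<theta>) \<le> B"
  shows "sup_norm N f \<le> B"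
  unfolding sup_norm_def using assms by (intro cSUP_least) auto

text \<open>All that is used of a system with delays \<open>j/m\<close>. As \<open>j\<close> starts
  at 1, the value \<open>x t\<close> is determined by strictly earlier ones.\<close>

context
  fixes N :: "real^'n \<Rightarrow> real" and M :: "real \<Rightarrow> real^'n^'n" and A :: "nat \<Rightarrow> real^'n^'n" and m :: nat
  assumes N: "is_norm N" and m: "0 < m"
    and vector_integral_eq: "\<And>f. continuous_on {-1..0} f \<Longrightarrow>
      vector_integral M f = (\<Sum>j\<in>{1..m}. A j *v f (- (real j / real m)))"
    and char_fun_eq: "\<And>s. char_fun M s = det (recurrence_pencil m A (exp (- s / of_nat m)))"
begin

lemma solution_recurrence:
  assumes x: "is_solution M x" and t: "0 \<le> t"
  shows "x t = (\<Sum>j\<in>{1..m}. A j *v x (t - real j / real m))"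
proof -
  have "continuous_on {-1..0} (\<lambda>\<theta>. x (t + \<theta>))"
    using x t unfolding is_solution_def
    by (intro continuous_on_compose2[of "{-1..}" x _ "\<lambda>\<theta>. t + \<theta>"] continuous_intros) auto
  from vector_integral_eq[OF this] show ?thesis using x t by (simp add: is_solution_def)
qed

text \<open>Sampled with step \<open>1/m\<close>, a solution is a sequence obeying the matrix
  recurrence, whatever the offset of the samples; \<open>recurrence_bound\<close> treats all offsets
  with one constant.\<close>

lemma exp_rate_le:
  assumes "\<And>s. char_fun M s = 0 \<Longrightarrow> Re s < \<beta>"
  shows "exp_rate N M \<le> ereal \<beta>"
proof -
  \<comment> \<open>The image of the line \<open>Re s = \<beta>\<close> under
    \<open>z = exp (-s/m)\<close> is the circle of this radius, so the closed disc corresponds to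
    \<open>\<beta> \<le> Re s\<close>, together with the point \<open>z = 0\<close>.\<close>
  define \<rho> where "\<rho> = exp (- \<beta> / real m)"
  have \<rho>: "0 < \<rho>" by (simp add: \<rho>_def)
  have nz: "det (recurrence_pencil m A z) \<noteq> 0" if "cmod z \<le> \<rho>" for z
  proof (cases "z = 0")
    case True
    then have "recurrence_pencil m A z = mat 1"
      by (simp add: recurrence_pencil_def vec_eq_iff power_0_left)
    then show ?thesis by simp
  next
    case False
    have "ln (cmod z) \<le> - \<beta> / real m"
      using that False ln_le_cancel_iff[of "cmod z" \<rho>] by (simp add: \<rho>_def)
    then have "\<beta> \<le> Re (- of_nat m * Ln z)" using False m by (simp add: field_simps)
    then have "char_fun M (- of_nat m * Ln z) \<noteq> 0" using assms by force
    moreover have e: "exp (- (- of_nat m * Ln z) / of_nat m) = z" using False m by simp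
    ultimately show ?thesis unfolding char_fun_eq e by simp
  qed
  obtain C where C: "C > 0" "\<And>x. N x \<le> C * norm x" using is_norm_upper_bound[OF N] by blast
  obtain c where c: "c > 0" "\<And>x. c * norm x \<le> N x" using is_norm_lower_bound[OF N] by blast
  obtain K where K: "K \<ge> 0" and KY: "\<forall>Y b. (\<forall>n<m. \<forall>i. \<bar>Y n $ i\<bar> \<le> b) \<longrightarrow>
      (\<forall>n\<ge>m. Y n = (\<Sum>j\<in>{1..m}. A j *v Y (n - j))) \<longrightarrow> 0 \<le> b \<longrightarrow>
      (\<forall>n i. \<bar>Y n $ i\<bar> * \<rho> ^ n \<le> K * b)"
    using recurrence_bound[of \<rho> m A, OF \<rho> nz] by blast
  \<comment> \<open>\<open>C\<close>, \<open>c\<close> and the dimension convert between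
    \<open>N\<close> and components. The exponential absorbs the difference \<open>1 - t0\<close>
    between the time \<open>t\<close> and the length \<open>(q + m)/m\<close> covered by the
    samples, for either sign of \<open>\<beta>\<close>.\<close>
  define L where "L = C * real CARD('n) * K / c * exp (2 * \<bar>\<beta>\<bar>)"
  have L0: "0 \<le> L" using C c K by (simp add: L_def)
  have point: "N (x t) \<le> L * exp (\<beta> * t) * sup_norm N \<phi>"
    if \<phi>: "\<phi> \<in> initial_space M" and x: "is_solution M x" "\<forall>\<theta>\<in>{-1..0}. x \<theta> = \<phi> \<theta>" and t: "0 \<le> t"
        for \<phi> x t
  proof -
    have \<phi>c: "continuous_on {-1..0} \<phi>" using \<phi> by (simp add: initial_space_def)
    define B where "B = sup_norm N \<phi>"
    have B: "N (\<phi> \<theta>) \<le> B" if "\<theta> \<in> {-1..0}" for \<theta> unfolding B_def by (rule sup_norm_upper[OF N \<phi>c that])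
    have B0: "0 \<le> B" using B[of 0] is_norm_nonneg[OF N, of "\<phi> 0"] by simp
    define q where "q = nat \<lfloor>t * real m\<rfloor>"
    define t0 where "t0 = t - real q / real m"
    have "real q \<le> t * real m" "t * real m < real q + 1" using t m by (auto simp: q_def)
    then have "real q / real m \<le> t" "t < (real q + 1) / real m"
      using m by (simp_all add: divide_le_eq less_divide_eq)
    then have t0: "0 \<le> t0" "t0 < 1 / real m" by (auto simp: t0_def add_divide_distrib)
    \<comment> \<open>Starting one unit before \<open>t0\<close> puts the first \<open>m\<close>
      samples into the initial interval, and \<open>x t\<close> becomes the sample number
      \<open>q + m\<close>.\<close>
    define Y where "Y n = x (t0 - 1 + real n / real m)" for n
    have init: "\<bar>Y n $ i\<bar> \<le> B / c" if "n < m" for n i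
    proof -
      have "real n + 1 \<le> real m" using that by linarith
      then have "1 / real m + real n / real m \<le> 1" using m by (simp add: field_simps)
      then have "t0 - 1 + real n / real m \<in> {-1..0}" using t0 by auto
      then have "Y n = \<phi> (t0 - 1 + real n / real m)" "N (\<phi> (t0 - 1 + real n / real m)) \<le> B"
        using x(2) B by (auto simp: Y_def)
      then have "norm (Y n) \<le> B / c" using c(2)[of "Y n"] c(1) by (simp add: field_simps)
      then show ?thesis using component_le_norm_cart[of "Y n" i] by linarith
    qed
    have rec: "Y n = (\<Sum>j\<in>{1..m}. A j *v Y (n - j))" if "m \<le> n" for n
    proof -
      have "1 \<le> real n / real m" using that m by simp
      then have "0 \<le> t0 - 1 + real n / real m" using t0(1) by linarith
      from solution_recurrence[OF x(1) this]
      have "Y n = (\<Sum>j\<in>{1..m}. A j *v x (t0 - 1 + real n / real m - real j / real m))"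
          by (simp add: Y_def)
      also have "\<dots> = (\<Sum>j\<in>{1..m}. A j *v Y (n - j))"
        using that by (intro sum.cong refl) (simp add: Y_def of_nat_diff diff_divide_distrib
            add_diff_eq)
      finally show ?thesis .
    qed
    have Yt: "Y (q + m) = x t" using m by (simp add: Y_def t0_def add_divide_distrib)
    have \<rho>pow: "\<rho> ^ (q + m) = exp (- \<beta> * (t - t0 + 1))"
    proof -
      have "real (q + m) * (- \<beta> / real m) = - \<beta> * (t - t0 + 1)" using m
          by (simp add: t0_def field_simps)
      then show ?thesis unfolding \<rho>_def exp_of_nat_mult[symmetric] by simp
    qed
    have comp: "\<bar>x t $ i\<bar> \<le> K * (B / c) * (exp (\<beta> * t) * exp (2 * \<bar>\<beta>\<bar>))" for i
    proof -
      have "\<bar>x t $ i\<bar> * exp (- \<beta> * (t - t0 + 1)) \<le> K * (B / c)"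
        using KY[rule_format, where Y = Y and b = "B / c" and n = "q + m" and i = i] init rec B0 c(1)
        by (simp add: Yt \<rho>pow)
      then have "\<bar>x t $ i\<bar> * exp (- \<beta> * (t - t0 + 1)) * exp (\<beta> * (t - t0 + 1))
          \<le> K * (B / c) * exp (\<beta> * (t - t0 + 1))"
        by (intro mult_right_mono) auto
      moreover have "exp (- \<beta> * (t - t0 + 1)) * exp (\<beta> * (t - t0 + 1)) = 1" by (simp flip: exp_add)
      ultimately have "\<bar>x t $ i\<bar> \<le> K * (B / c) * exp (\<beta> * (t - t0 + 1))"
          by (simp only: mult.assoc mult_1_right)
      also have "\<dots> \<le> K * (B / c) * (exp (\<beta> * t) * exp (2 * \<bar>\<beta>\<bar>))"
      proof (rule mult_left_mono)
        have "1 / real m \<le> 1" using m by simp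
        then have "\<bar>1 - t0\<bar> \<le> 2" using t0 by linarith
        then have "\<bar>\<beta>\<bar> * \<bar>1 - t0\<bar> \<le> \<bar>\<beta>\<bar> * 2" by (intro mult_left_mono) auto
        then have "\<beta> * (1 - t0) \<le> 2 * \<bar>\<beta>\<bar>" by (simp flip: abs_mult)
        then show "exp (\<beta> * (t - t0 + 1)) \<le> exp (\<beta> * t) * exp (2 * \<bar>\<beta>\<bar>)"
          by (simp add: algebra_simps flip: exp_add)
      qed (use K B0 c in auto)
      finally show ?thesis .
    qed
    have "N (x t) \<le> C * (\<Sum>i\<in>UNIV. \<bar>x t $ i\<bar>)"
      using C(2)[of "x t"] mult_left_mono[OF norm_le_l1_cart[of "x t"], of C] C(1) by linarith
    also have "\<dots> \<le> C * (\<Sum>i\<in>(UNIV::'n set). K * (B / c) * (exp (\<beta> * t) * exp (2 * \<bar>\<beta>\<bar>)))"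
      using C(1) comp by (intro mult_left_mono sum_mono) auto
    also have "\<dots> = L * exp (\<beta> * t) * B" using c(1) by (simp add: L_def)
    finally show ?thesis by (simp add: B_def)
  qed
  \<comment> \<open>The window reaches back by at most 1, which costs
    \<open>exp \<bar>\<beta>\<bar>\<close>. The summand 1 covers the part of the window where the
    solution is still the initial function.\<close>
  define K' where "K' = (L + 1) * exp \<bar>\<beta>\<bar>"
  have "sup_norm N (\<lambda>\<theta>. x (t + \<theta>)) \<le> K' * exp (\<beta> * t) * sup_norm N \<phi>"
    if \<phi>: "\<phi> \<in> initial_space M" and x: "is_solution M x" "\<forall>\<theta>\<in>{-1..0}. x \<theta> = \<phi> \<theta>" and t: "0 \<le> t"
        for \<phi> x t
  proof (rule sup_norm_least)
    fix \<theta> :: real assume \<theta>: "\<theta> \<in> {-1..0}"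
    have \<phi>c: "continuous_on {-1..0} \<phi>" using \<phi> by (simp add: initial_space_def)
    have B0: "0 \<le> sup_norm N \<phi>"
      using sup_norm_upper[OF N \<phi>c, of 0] is_norm_nonneg[OF N, of "\<phi> 0"] by simp
    have shift: "exp (\<beta> * (t + \<theta>)) \<le> exp \<bar>\<beta>\<bar> * exp (\<beta> * t)"
    proof -
      have "\<bar>\<beta>\<bar> * \<bar>\<theta>\<bar> \<le> \<bar>\<beta>\<bar> * 1" using \<theta> by (intro mult_left_mono) auto
      then have "\<beta> * \<theta> \<le> \<bar>\<beta>\<bar>" by (simp flip: abs_mult)
      then show ?thesis by (simp add: algebra_simps flip: exp_add)
    qed
    show "N (x (t + \<theta>)) \<le> K' * exp (\<beta> * t) * sup_norm N \<phi>"
    proof (cases "0 \<le> t + \<theta>")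
      case True
      have "N (x (t + \<theta>)) \<le> L * exp (\<beta> * (t + \<theta>)) * sup_norm N \<phi>" by (rule point[OF \<phi> x True])
      also have "\<dots> \<le> (L + 1) * (exp \<bar>\<beta>\<bar> * exp (\<beta> * t)) * sup_norm N \<phi>"
        using L0 B0 shift by (intro mult_right_mono mult_mono) auto
      finally show ?thesis by (simp add: K'_def mult.assoc)
    next
      case False
      then have "N (x (t + \<theta>)) \<le> sup_norm N \<phi>" using x(2) \<theta> t sup_norm_upper[OF N \<phi>c, of "t + \<theta>"]
          by auto
      also have "\<dots> = 1 * 1 * sup_norm N \<phi>" by simp
      also have "\<dots> \<le> (L + 1) * (exp \<bar>\<beta>\<bar> * exp (\<beta> * t)) * sup_norm N \<phi>"
      proof (intro mult_right_mono mult_mono B0)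
        have "t \<le> 1" using False \<theta> by auto
        then have "\<bar>\<beta>\<bar> * \<bar>t\<bar> \<le> \<bar>\<beta>\<bar> * 1" using t by (intro mult_left_mono) auto
        then have "- (\<beta> * t) \<le> \<bar>\<beta>\<bar>" by (simp flip: abs_mult)
        then show "1 \<le> exp \<bar>\<beta>\<bar> * exp (\<beta> * t)" by (simp flip: exp_add)
      qed (use L0 in auto)
      finally show ?thesis by (simp add: K'_def mult.assoc)
    qed
  qed
  moreover have "K' > 0" using L0 by (simp add: K'_def)
  ultimately show ?thesis unfolding exp_rate_def by (intro Inf_lower imageI CollectI exI[of _ K']) auto
qed

text \<open>A kernel vector \<open>v\<close> at a zero \<open>s\<close> gives the complex solution
  \<open>exp (s t) v\<close>. The weights \<open>w = 1\<close> and \<open>w = - \<i>\<close> select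
  its real and imaginary parts; both are needed because either may vanish at a given time, while
  together they control the modulus.\<close>

lemma exp_rate_ge:
  assumes s: "char_fun M s = 0"
  shows "ereal (Re s) \<le> exp_rate N M"
  unfolding exp_rate_def
proof (rule Inf_greatest, safe)
  fix \<alpha> K :: real
  assume K: "0 < K" and bound: "\<forall>\<phi>\<in>initial_space M. \<forall>x. is_solution M x \<longrightarrow> (\<forall>\<theta>\<in>{-1..0}. x \<theta> = \<phi> \<theta>) \<longrightarrow>
     (\<forall>t\<ge>0. sup_norm N (\<lambda>\<theta>. x (t + \<theta>)) \<le> K * exp (\<alpha> * t) * sup_norm N \<phi>)"
  obtain c where c: "c > 0" "\<And>x. c * norm x \<le> N x" using is_norm_lower_bound[OF N] by blast
  define z where "z = exp (- s / of_nat m)"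
  obtain v where v: "v \<noteq> 0" "recurrence_pencil m A z *v v = 0"
    using s unfolding char_fun_eq det_eq_0_iff_kernel z_def by blast
  have fixv: "v $ a = (\<Sum>j\<in>{1..m}. \<Sum>b\<in>UNIV. of_real (A j $ a $ b) * z ^ j * v $ b)" for a
  proof -
    have "v - (\<chi> a b. \<Sum>j\<in>{1..m}. of_real (A j $ a $ b) * z ^ j) *v v = 0"
      using v(2) unfolding recurrence_pencil_def matrix_vector_mult_diff_rdistrib
          matrix_vector_mul_lid .
    then have "v $ a = ((\<chi> a b. \<Sum>j\<in>{1..m}. of_real (A j $ a $ b) * z ^ j) *v v) $ a" by simp
    also have "\<dots> = (\<Sum>j\<in>{1..m}. \<Sum>b\<in>UNIV. of_real (A j $ a $ b) * z ^ j * v $ b)"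
      by (simp add: matrix_vector_mult_def sum_distrib_right) (rule sum.swap)
    finally show ?thesis .
  qed
  define x where "x w t = (\<chi> a. Re (w * exp (s * of_real t) * v $ a))" for w t
  have xc: "continuous_on S (x w)" for S w unfolding x_def by (intro continuous_intros)
  have xrec: "x w t = (\<Sum>j\<in>{1..m}. A j *v x w (t - real j / real m))" for w t
  proof -
    have "x w t $ a = (\<Sum>j\<in>{1..m}. A j *v x w (t - real j / real m)) $ a" for a
    proof -
      have ex: "exp (s * of_real t) * z ^ j = exp (s * of_real (t - real j / real m))" for j
        unfolding z_def exp_of_nat_mult[symmetric] exp_add[symmetric] using m by (simp add: field_simps)
      have "x w t $ a = Re (w * exp (s * of_real t) * (\<Sum>j\<in>{1..m}. \<Sum>b\<in>UNIV. of_real (A j $ a $ b) * z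
          ^ j * v $ b))"
        unfolding x_def fixv[of a, symmetric] by simp
      also have "\<dots> = (\<Sum>j\<in>{1..m}. \<Sum>b\<in>UNIV. Re (of_real (A j $ a $ b) *
          (w * (exp (s * of_real t) * z ^ j) * v $ b)))"
        by (simp only: sum_distrib_left Re_sum mult_ac)
      also have "\<dots> = (\<Sum>j\<in>{1..m}. A j *v x w (t - real j / real m)) $ a"
        unfolding ex by (simp add: matrix_vector_mult_def x_def)
      finally show ?thesis .
    qed
    then show ?thesis by (simp add: vec_eq_iff)
  qed
  have vi: "vector_integral M (\<lambda>\<theta>. x w (t + \<theta>)) = x w t" for w t
  proof -
    have "continuous_on {-1..0} (\<lambda>\<theta>. x w (t + \<theta>))"
      by (rule continuous_on_compose2[OF xc[of UNIV]]) (auto intro!: continuous_intros)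
    from vector_integral_eq[OF this] show ?thesis unfolding xrec[of w t] by simp
  qed
  have sol: "is_solution M (x w)" "x w \<in> initial_space M" for w
    using vi[of w] vi[of w 0] by (simp_all add: is_solution_def initial_space_def xc)
  define B where "B = K * (sup_norm N (x 1) + sup_norm N (x (- \<i>))) / c"
  obtain a where a: "v $ a \<noteq> 0" using v(1) by (auto simp: vec_eq_iff)
  have main: "exp (Re s * t) * cmod (v $ a) \<le> B * exp (\<alpha> * t)" if "0 \<le> t" for t
  proof -
    have xb: "\<bar>x w t $ a\<bar> \<le> K * exp (\<alpha> * t) * sup_norm N (x w) / c" for w
    proof -
      have "c * \<bar>x w t $ a\<bar> \<le> c * norm (x w t)" using c(1)
          by (intro mult_left_mono component_le_norm_cart) auto
      also have "\<dots> \<le> N (x w (t + 0))" using c(2) by simp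
      also have "\<dots> \<le> sup_norm N (\<lambda>\<theta>. x w (t + \<theta>))"
        by (rule sup_norm_upper[OF N continuous_on_compose2[OF xc[of UNIV]]])
            (auto intro!: continuous_intros)
      also have "\<dots> \<le> K * exp (\<alpha> * t) * sup_norm N (x w)" using bound sol[of w] that by blast
      finally show ?thesis using c(1) by (simp add: field_simps)
    qed
    have "exp (Re s * t) * cmod (v $ a) = cmod (exp (s * of_real t) * v $ a)" by (simp add: norm_mult)
    also have "\<dots> \<le> \<bar>x 1 t $ a\<bar> + \<bar>x (- \<i>) t $ a\<bar>"
      using cmod_le[of "exp (s * of_real t) * v $ a"] by (simp add: x_def mult.assoc)
    also have "\<dots> \<le> B * exp (\<alpha> * t)" using xb[of 1] xb[of "- \<i>"]
        by (simp add: B_def distrib_left distrib_right add_divide_distrib mult_ac)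
    finally show ?thesis .
  qed
  show "ereal (Re s) \<le> ereal \<alpha>"
  proof (rule ccontr)
    assume "\<not> ereal (Re s) \<le> ereal \<alpha>"
    then have gt: "\<alpha> < Re s" by simp
    \<comment> \<open>Chosen so that already the linear lower bound of the exponential, multiplied
      by \<open>cmod (v $ a)\<close>, exceeds \<open>\<bar>B\<bar>\<close>.\<close>
    define t where "t = (\<bar>B\<bar> / cmod (v $ a)) / (Re s - \<alpha>)"
    have t0: "0 \<le> t" using gt by (simp add: t_def)
    have "exp ((Re s - \<alpha>) * t) * cmod (v $ a) \<le> B"
      using main[OF t0] by (simp add: left_diff_distrib exp_diff field_simps)
    moreover have "1 + (Re s - \<alpha>) * t \<le> exp ((Re s - \<alpha>) * t)" by (rule exp_ge_add_one_self)
    then have "(1 + (Re s - \<alpha>) * t) * cmod (v $ a) \<le> exp ((Re s - \<alpha>) * t) * cmod (v $ a)"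
      by (intro mult_right_mono) auto
    moreover have "(1 + (Re s - \<alpha>) * t) * cmod (v $ a) = cmod (v $ a) + \<bar>B\<bar>" using gt a
        by (simp add: t_def field_simps)
    moreover have "cmod (v $ a) > 0" using a by simp
    ultimately show False by linarith
  qed
qed

text \<open>A gap between abscissa and rate would contain a real \<open>\<beta>\<close>, which
  \<open>exp_rate_le\<close> rules out; this includes the abscissa
  \<open>-\<infinity>\<close>.\<close>

lemma spectral_growth_commensurable:
  assumes "M \<in> well_posed N"
  shows "M \<in> spectral_growth N"
proof -
  have "spectral_abscissa M \<le> exp_rate N M"
    unfolding spectral_abscissa_def by (intro Sup_least) (auto intro: exp_rate_ge)
  moreover have "exp_rate N M \<le> spectral_abscissa M"
  proof (rule ccontr)
    assume "\<not> exp_rate N M \<le> spectral_abscissa M"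
    then have "spectral_abscissa M < exp_rate N M" by simp
    then obtain \<beta> where \<beta>: "spectral_abscissa M < ereal \<beta>" "ereal \<beta> < exp_rate N M"
      using ereal_dense2 by blast
    have "Re s < \<beta>" if "char_fun M s = 0" for s
    proof -
      have "ereal (Re s) \<le> spectral_abscissa M"
        unfolding spectral_abscissa_def using that by (intro Sup_upper) auto
      then have "ereal (Re s) < ereal \<beta>" using \<beta>(1) by (rule le_less_trans)
      then show ?thesis by simp
    qed
    then have "exp_rate N M \<le> ereal \<beta>" by (rule exp_rate_le)
    then show False using \<beta>(2) by simp
  qed
  ultimately show ?thesis using assms by (simp add: spectral_growth_def)
qed

end

section \<open>Polydiscs and the spectral radius\<close>

lemma signed_integral_norm_le:
  fixes f :: "real \<Rightarrow> 'b::{banach, second_countable_topology}"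
  assumes \<nu>: "difference_measure \<nu>" and f: "f \<in> borel_measurable delay_borel"
    and bound: "\<And>\<theta>. \<theta> \<in> {-1..0} \<Longrightarrow> norm (f \<theta>) \<le> c"
  shows "norm (signed_integral \<nu> f) \<le>
    (measure (positive_part \<nu>) {-1..0} + measure (positive_part (\<lambda>A. - \<nu> A)) {-1..0}) * c"
proof -
  have *: "norm (integral\<^sup>L P f) \<le> measure P {-1..0} * c"
    if P: "finite_measure P" "sets P = sets delay_borel" for P
  proof -
    interpret finite_measure P by fact
    have sp: "space P = {-1..0}" using sets_eq_imp_space_eq[OF P(2)] by simp
    have "f \<in> borel_measurable P" using f measurable_cong_sets[OF P(2) refl, of borel] by auto
    then have "integrable P f" using bound by (intro integrable_const_bound[of _ c]) (auto simp: sp)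
    then have "integral\<^sup>L P (\<lambda>x. norm (f x)) \<le> integral\<^sup>L P (\<lambda>_. c)"
      using bound by (intro integral_mono integrable_norm) (auto simp: sp)
    then have "norm (integral\<^sup>L P f) \<le> integral\<^sup>L P (\<lambda>_. c)"
      by (rule order_trans[OF integral_norm_bound])
    then show ?thesis by (simp add: sp)
  qed
  have "norm (signed_integral \<nu> f)
      \<le> norm (integral\<^sup>L (positive_part \<nu>) f) + norm (integral\<^sup>L (positive_part (\<lambda>A. - \<nu> A)) f)"
    unfolding signed_integral_def by (rule norm_triangle_ineq4)
  also have "\<dots> \<le> measure (positive_part \<nu>) {-1..0} * c + measure (positive_part (\<lambda>A. - \<nu> A)) {-1..0}
      * c"
    by (intro add_mono * jordan_decomposition[OF \<nu>]) simp_all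
  finally show ?thesis by (simp add: algebra_simps)
qed

lemma matrix_integral_scale: "matrix_integral M (\<lambda>\<theta>. c * g \<theta>)
    = (\<chi> a b. c * matrix_integral M g $ a $ b)"
  by (simp add: matrix_integral_def signed_integral_def right_diff_distrib)

lemma matrix_integral_simple:
  assumes M: "matrix_difference (measure_of_nbv M)" and u: "simple_function delay_borel u"
    and I: "finite I" "u ` {-1..0} \<subseteq> I"
  shows "matrix_integral M (\<lambda>\<theta>. f (u \<theta>)) =
    (\<chi> a b. \<Sum>i\<in>I. f i * of_real (measure_of_nbv M (u -` {i} \<inter> {-1..0}) $ a $ b))"
  using M unfolding matrix_integral_def matrix_difference_def
  by (simp add: signed_integral_simple[OF _ u I] vec_eq_iff scaleR_conv_of_real mult.commute)

text \<open>No eigenvalue is followed through the limit: the bound of \<open>det_lower_bound\<close>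
  for the approximating matrices, taken at \<open>1/z\<close>, passes to the limit and contradicts
  the vanishing of \<open>det (Id - A'/z)\<close>.\<close>

lemma eigenvalues_limit:
  assumes M: "matrix_difference (measure_of_nbv M)" and r: "0 \<le> r"
    and simple: "\<And>g z. simple_function delay_borel g \<Longrightarrow> (\<And>\<theta>. \<theta> \<in> {-1..0} \<Longrightarrow> cmod (g \<theta>) < 1) \<Longrightarrow>
      z \<in> eigenvalues (matrix_integral M g) \<Longrightarrow> cmod z \<le> r"
    and g: "g \<in> borel_measurable delay_borel" "\<And>\<theta>. \<theta> \<in> {-1..0} \<Longrightarrow> cmod (g \<theta>) \<le> 1"
    and z: "z \<in> eigenvalues (matrix_integral (M :: real \<Rightarrow> real^'n^'n) g)"
  shows "cmod z \<le> r"
proof (rule ccontr)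
  assume "\<not> cmod z \<le> r"
  then have zr: "r < cmod z" by simp
  then have "z \<noteq> 0" using r by auto
  obtain s where s: "\<And>n. simple_function delay_borel (s n)"
    "\<And>\<theta>. \<theta> \<in> {-1..0} \<Longrightarrow> (\<lambda>n. s n \<theta>) \<longlonglongrightarrow> g \<theta>"
    using borel_measurable_implies_sequence_metric[OF g(1), of 0] unfolding space_delay_borel by metis
  \<comment> \<open>Simple approximants of \<open>g\<close> may leave the unit disc.
    \<open>q n\<close> projects them radially onto the closed disc and then shrinks slightly to
    obtain modulus strictly below 1.\<close>
  define q where "q n w = of_real (real (Suc n) / real (Suc (Suc n))) *
      (w / of_real (max 1 (cmod w)))" for n w
  have q1: "cmod (q n w) < 1" for n w
  proof -
    have "cmod w / max 1 (cmod w) \<le> 1" by (simp add: divide_simps)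
    then have "real (Suc n) / real (Suc (Suc n)) * (cmod w / max 1 (cmod w))
        \<le> real (Suc n) / real (Suc (Suc n)) * 1"
      by (intro mult_left_mono) auto
    also have "\<dots> < 1" by simp
    finally show ?thesis unfolding q_def norm_mult norm_divide norm_of_real by simp
  qed
  have qs: "simple_function delay_borel (\<lambda>\<theta>. q n (s n \<theta>))" for n
    using simple_function_compose[OF s(1)[of n], of "q n"] by (simp add: o_def)
  have qlim: "(\<lambda>n. q n (s n \<theta>)) \<longlonglongrightarrow> g \<theta>" if "\<theta> \<in> {-1..0}" for \<theta>
  proof -
    have "(\<lambda>n. real (Suc n) / real (Suc (Suc n))) \<longlonglongrightarrow> 1"
      using LIMSEQ_Suc[OF LIMSEQ_n_over_Suc_n] by simp
    then have "(\<lambda>n. q n (s n \<theta>)) \<longlonglongrightarrow> of_real 1 * (g \<theta> / of_real (max 1 (cmod (g \<theta>))))"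
      unfolding q_def by (intro tendsto_intros s(2)[OF that]) auto
    then show ?thesis using g(2)[OF that] by (simp add: max_def split: if_splits)
  qed
  define A where "A n = matrix_integral M (\<lambda>\<theta>. q n (s n \<theta>))" for n
  define A' where "A' = matrix_integral M g"
  have A: "(\<lambda>n. A n $ a $ b) \<longlonglongrightarrow> A' $ a $ b" for a b
    unfolding A_def A'_def matrix_integral_def vec_lambda_beta using M qlim q1
    by (intro signed_integral_dominated_convergence[where c
        = 1] g(1) borel_measurable_simple_function[OF qs])
      (auto simp: matrix_difference_def intro: less_imp_le)
  have cr: "cmod (1/z) * r < 1" using zr \<open>z \<noteq> 0\<close> by (simp add: norm_divide field_simps)
  have "(1 - cmod (1/z) * r) ^ CARD('n) \<le> cmod (det (mat 1 - (\<chi> i j. (1/z) * A n $ i $ j)))" for n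
    using simple[OF qs q1, of _ n] r cr by (intro det_lower_bound) (auto simp: A_def)
  moreover have "(\<lambda>n. cmod (det (mat 1 - (\<chi> i j. (1/z) * A n $ i $ j)))) \<longlonglongrightarrow>
      cmod (det (mat 1 - (\<chi> i j. (1/z) * A' $ i $ j)))"
    unfolding det_def vector_minus_component vec_lambda_beta
    by (intro tendsto_intros A)
  ultimately have "(1 - cmod (1/z) * r) ^ CARD('n) \<le> cmod (det (mat 1 - (\<chi> i j. (1/z) * A' $ i $ j)))"
    by (intro LIMSEQ_le_const) auto
  moreover have "det (mat 1 - (\<chi> i j. (1/z) * A' $ i $ j)) = 0"
    using z eigenvalue_iff_pencil[OF \<open>z \<noteq> 0\<close>, of A'] by (simp add: A'_def poly_pencil)
  moreover have "0 < (1 - cmod (1/z) * r) ^ CARD('n)" using cr by simp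
  ultimately show False by simp
qed

text \<open>Without this the real-valued supremum in \<open>rho_HS\<close> would not bound the
  individual spectral radii.\<close>

lemma bdd_above_rho_HS:
  assumes M: "matrix_difference (measure_of_nbv (M :: real \<Rightarrow> real^'n^'n))"
  shows "bdd_above ((\<lambda>\<xi>. spectral_radius_cmat (matrix_integral M (\<lambda>\<theta>. exp (\<i> * of_real (\<xi> \<theta>)))))
    ` borel_measurable delay_borel)"
proof -
  define T where "T a b = measure (positive_part (\<lambda>A. measure_of_nbv M A $ a $ b)) {-1..0}
      + measure (positive_part (\<lambda>A. - measure_of_nbv M A $ a $ b)) {-1..0}" for a b
  have "spectral_radius_cmat (matrix_integral M (\<lambda>\<theta>. exp (\<i> * of_real (\<xi> \<theta>))))
      \<le> (\<Sum>a\<in>UNIV. \<Sum>b\<in>UNIV. T a b)"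
    if \<xi>: "\<xi> \<in> borel_measurable delay_borel" for \<xi>
  proof -
    let ?A = "matrix_integral M (\<lambda>\<theta>. exp (\<i> * of_real (\<xi> \<theta>)))"
    have m: "(\<lambda>\<theta>. exp (\<i> * of_real (\<xi> \<theta>))) \<in> borel_measurable delay_borel" using \<xi> by measurable
    have "spectral_radius_cmat ?A \<in> cmod ` eigenvalues ?A"
      unfolding spectral_radius_cmat_def eigenvalues_def[symmetric]
      using finite_eigenvalues eigenvalues_nonempty by (intro Max_in) auto
    then have "spectral_radius_cmat ?A \<le> (\<Sum>a\<in>UNIV. \<Sum>b\<in>UNIV. cmod (?A $ a $ b))"
      using eigenvalue_norm_le by auto
    also have "\<dots> \<le> (\<Sum>a\<in>UNIV. \<Sum>b\<in>UNIV. T a b)"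
      using M signed_integral_norm_le[OF _ m, of _ 1]
      by (intro sum_mono) (simp add: matrix_integral_def matrix_difference_def T_def)
    finally show ?thesis .
  qed
  then show ?thesis by (intro bdd_aboveI) auto
qed

lemma eigenvalue_le_rho_HS:
  assumes M: "matrix_difference (measure_of_nbv M)" and \<xi>: "\<xi> \<in> borel_measurable delay_borel"
    and z: "z \<in> eigenvalues (matrix_integral M (\<lambda>\<theta>. exp (\<i> * of_real (\<xi> \<theta>))))"
  shows "cmod z \<le> rho_HS M"
proof -
  have "cmod z \<le> spectral_radius_cmat (matrix_integral M (\<lambda>\<theta>. exp (\<i> * of_real (\<xi> \<theta>))))"
    unfolding spectral_radius_cmat_def eigenvalues_def[symmetric] using z finite_eigenvalues
        by (intro Max_ge) auto
  also have "\<dots> \<le> rho_HS M"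
    unfolding rho_HS_def by (intro cSUP_upper \<xi> bdd_above_rho_HS M)
  finally show ?thesis .
qed

lemma rho_HS_least:
  assumes "\<And>\<xi> z. \<xi> \<in> borel_measurable delay_borel \<Longrightarrow>
      z \<in> eigenvalues (matrix_integral M (\<lambda>\<theta>. exp (\<i> * of_real (\<xi> \<theta>)))) \<Longrightarrow> cmod z \<le> r"
  shows "rho_HS M \<le> r"
  unfolding rho_HS_def
proof (rule cSUP_least)
  have "(\<lambda>_. 0) \<in> borel_measurable delay_borel" by simp
  then show "(borel_measurable delay_borel :: (real \<Rightarrow> real) set) \<noteq> {}" by blast
  fix \<xi> :: "real \<Rightarrow> real" assume "\<xi> \<in> borel_measurable delay_borel"
  then show "spectral_radius_cmat (matrix_integral M (\<lambda>\<theta>. exp (\<i> * of_real (\<xi> \<theta>)))) \<le> r"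
    unfolding spectral_radius_cmat_def eigenvalues_def[symmetric]
    using finite_eigenvalues eigenvalues_nonempty assms by (intro Max.boundedI) auto
qed

text \<open>The Moebius maps \<open>w \<mapsto> (w + z) / (1 + cnj z * w)\<close> turn the polydisc into a family of discs
  whose boundary circles lie on the torus.\<close>

lemma polydisc_no_zeros:
  fixes B :: "'i \<Rightarrow> complex^'n^'n" and R :: "real \<Rightarrow> 'i \<Rightarrow> real"
  assumes cont: "\<And>i. i \<in> I \<Longrightarrow> continuous_on {0..1} (\<lambda>t. R t i)" and start: "\<And>i. i \<in> I \<Longrightarrow> R 0 i = 0"
    and torus: "\<And>t \<zeta>. t \<in> {0..1} \<Longrightarrow> (\<And>i. i \<in> I \<Longrightarrow> cmod (\<zeta> i) = 1) \<Longrightarrow>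
      det (mat 1 - (\<chi> a b. \<Sum>i\<in>I. of_real (R t i) * \<zeta> i * B i $ a $ b)) \<noteq> 0"
    and z: "\<And>i. i \<in> I \<Longrightarrow> cmod (z i) < 1"
  shows "det (mat 1 - (\<chi> a b. \<Sum>i\<in>I. of_real (R 1 i) * z i * B i $ a $ b)) \<noteq> 0"
proof -
  \<comment> \<open>One complex variable \<open>w\<close> replaces the whole tuple:
    \<open>w = 0\<close> gives back the point \<open>z\<close>, and at \<open>t = 0\<close> every
    radius vanishes and the determinant is 1.\<close>
  define h where "h t w = det (mat 1 - (\<chi> a b. \<Sum>i\<in>I. of_real (R t i) *
      ((w + z i) / (1 + cnj (z i) * w)) * B i $ a $ b))" for t w
  have nz: "1 + cnj (z i) * w \<noteq> 0" if "i \<in> I" "cmod w \<le> 1" for i w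
  proof
    assume "1 + cnj (z i) * w = 0"
    then have "cnj (z i) * w = -1" by (simp add: add_eq_0_iff)
    then have "cmod (z i) * cmod w = 1" by (metis complex_mod_cnj norm_minus_cancel norm_mult norm_one)
    moreover have "cmod (z i) * cmod w \<le> cmod (z i) * 1" using that by (intro mult_left_mono) auto
    ultimately show False using z[OF that(1)] by simp
  qed
  have "h 1 0 \<noteq> 0"
  proof (rule no_zeros_homotopy[of h])
    show "continuous_on ({0..1} \<times> cball 0 1) (\<lambda>(t, w). h t w)"
      unfolding h_def det_def vector_minus_component vec_lambda_beta case_prod_unfold
      using nz by (intro continuous_intros continuous_on_compose2[OF cont, where f = fst]) auto
    show "h t holomorphic_on ball 0 1" for t
      unfolding h_def det_def vector_minus_component vec_lambda_beta
      using nz by (intro holomorphic_intros) auto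
    show "h 0 w \<noteq> 0" for w
    proof -
      have "mat 1 - (\<chi> a b. \<Sum>i\<in>I. of_real (R 0 i) * ((w + z i) / (1 + cnj (z i) * w)) * B i $ a $ b)
          = mat 1"
        using start by (simp add: vec_eq_iff)
      then show ?thesis by (simp add: h_def)
    qed
    show "h t w \<noteq> 0" if "t \<in> {0..1}" "cmod w = 1" for t w
      unfolding h_def
    proof (rule torus[OF that(1)])
      fix i assume "i \<in> I"
      have "w * cnj w = 1" using that(2) by (simp add: complex_norm_square[symmetric])
      then have "w + z i = w * cnj (1 + cnj (z i) * w)" by (simp add: algebra_simps)
      then have "cmod (w + z i) = cmod w * cmod (cnj (1 + cnj (z i) * w))" by (simp only: norm_mult)
      then have "cmod (w + z i) = cmod (1 + cnj (z i) * w)" using that(2)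
          by (simp only: complex_mod_cnj)
      then show "cmod ((w + z i) / (1 + cnj (z i) * w)) = 1"
        using nz[OF \<open>i \<in> I\<close>, of w] that(2) by (simp add: norm_divide)
    qed
  qed auto
  then show ?thesis by (simp add: h_def)
qed

text \<open>A choice of unimodular numbers on the pieces of \<open>g\<close> has the form
  \<open>exp (\<i> \<xi>)\<close> with \<open>\<xi>\<close> simple, so the torus hypothesis of
  \<open>polydisc_no_zeros\<close> is controlled by \<open>rho_HS\<close>; a radius
  \<open>t \<le> 1\<close> only enlarges the eigenvalue to \<open>z/t\<close>. The maximum with 0
  supplies the nonnegative bound that the passage to limits asks for.\<close>

lemma eigenvalues_simple_le_rho_HS:
  assumes M: "matrix_difference (measure_of_nbv (M :: real \<Rightarrow> real^'n^'n))"
    and g: "simple_function delay_borel g" "\<And>\<theta>. \<theta> \<in> {-1..0} \<Longrightarrow> cmod (g \<theta>) < 1"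
    and z: "z \<in> eigenvalues (matrix_integral M g)"
  shows "cmod z \<le> max 0 (rho_HS M)"
proof (rule ccontr)
  assume "\<not> cmod z \<le> max 0 (rho_HS M)"
  then have zr: "z \<noteq> 0" "rho_HS M < cmod z" by auto
  define I where "I = g ` {-1..0}"
  have I: "finite I" "g ` {-1..0} \<subseteq> I" using simple_functionD(1)[OF g(1)] by (auto simp: I_def)
  define C where "C v a b = complex_of_real (measure_of_nbv M (g -` {v} \<inter> {-1..0}) $ a $ b)" for v a b
  have mi: "matrix_integral M (\<lambda>\<theta>. f (g \<theta>)) = (\<chi> a b. \<Sum>v\<in>I. f v * C v a b)" for f
    using matrix_integral_simple[OF M g(1) I, of f] by (simp add: C_def)
  have "det (mat 1 - (\<chi> a b. \<Sum>v\<in>I. of_real 1 * v * (\<chi> a b. 1/z * C v a b) $ a $ b)) \<noteq> 0"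
  proof (rule polydisc_no_zeros[where R = "\<lambda>t _. t"])
    fix t :: real and \<zeta> :: "complex \<Rightarrow> complex"
    assume t: "t \<in> {0..1}" and \<zeta>: "\<And>v. v \<in> I \<Longrightarrow> cmod (\<zeta> v) = 1"
    show "det (mat 1 - (\<chi> a b. \<Sum>v\<in>I. of_real t * \<zeta> v * (\<chi> a b. 1/z * C v a b) $ a $ b)) \<noteq> 0"
    proof
      assume d: "det (mat 1 - (\<chi> a b. \<Sum>v\<in>I. of_real t * \<zeta> v * (\<chi> a b. 1/z * C v a b) $ a $ b)) = 0"
      define \<xi> where "\<xi> \<theta> = Arg (\<zeta> (g \<theta>))" for \<theta>
      have "simple_function delay_borel \<xi>"
        using simple_function_compose[OF g(1), of "\<lambda>v. Arg (\<zeta> v)"] by (simp add: \<xi>_def[abs_def] o_def)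
      then have \<xi>: "\<xi> \<in> borel_measurable delay_borel" by (rule borel_measurable_simple_function)
      define A where "A = matrix_integral M (\<lambda>\<theta>. exp (\<i> * of_real (\<xi> \<theta>)))"
      have A: "A = (\<chi> a b. \<Sum>v\<in>I. \<zeta> v * C v a b)"
      proof -
        have "A = (\<chi> a b. \<Sum>v\<in>I. exp (\<i> * of_real (Arg (\<zeta> v))) * C v a b)"
          unfolding A_def \<xi>_def by (rule mi)
        moreover have "exp (\<i> * of_real (Arg (\<zeta> v))) = \<zeta> v" if "v \<in> I" for v
          using Arg_eq[of "\<zeta> v"] \<zeta>[OF that] by (cases "\<zeta> v = 0") auto
        ultimately show ?thesis by (simp add: vec_eq_iff)
      qed
      have "(\<chi> a b. \<Sum>v\<in>I. of_real t * \<zeta> v * (\<chi> a b. 1/z * C v a b) $ a $ b)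
          = (\<chi> i j. (of_real t / z) * A $ i $ j)"
        by (simp add: A vec_eq_iff sum_distrib_left mult_ac)
      then have p: "poly (pencil A) (of_real t / z) = 0" using d by (simp add: poly_pencil)
      then have "t \<noteq> 0" by auto
      then have "z / of_real t \<in> eigenvalues A"
          using p zr eigenvalue_iff_pencil[of "z / of_real t" A] by simp
      then have "cmod (z / of_real t) \<le> rho_HS M" unfolding A_def by (rule eigenvalue_le_rho_HS[OF M \<xi>])
      moreover have "cmod z \<le> cmod (z / of_real t)"
        using t \<open>t \<noteq> 0\<close> by (simp add: norm_divide le_divide_eq mult_right_le_one_le)
      ultimately show False using zr by simp
    qed
  qed (use g(2) in \<open>auto simp: I_def intro!: continuous_intros\<close>)
  moreover have "(\<chi> a b. \<Sum>v\<in>I. of_real 1 * v * (\<chi> a b. 1/z * C v a b) $ a $ b)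
      = (\<chi> i j. (1 / z) * matrix_integral M g $ i $ j)"
    using mi[of id] by (simp add: vec_eq_iff sum_distrib_left mult_ac)
  ultimately have "poly (pencil (matrix_integral M g)) (1/z) \<noteq> 0" by (simp add: poly_pencil)
  then show False using z zr eigenvalue_iff_pencil by blast
qed

section \<open>From the bound on the spectral radius to uniform strong stability\<close>

lemma char_fun_perturbed:
  assumes M: "matrix_difference (measure_of_nbv M)" and \<phi>: "\<phi> \<in> delay_maps"
  shows "char_fun (perturbed \<phi> M) s = det (mat 1 - matrix_integral M (\<lambda>\<theta>. exp (s * of_real (\<phi> \<theta>))))"
proof -
  have "continuous_on {-1..0} (\<lambda>\<theta>. exp (s * complex_of_real \<theta>))" by (intro continuous_intros)
  moreover from this have "bounded ((\<lambda>\<theta>. exp (s * complex_of_real \<theta>)) ` {-1..0})"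
    by (intro compact_imp_bounded compact_continuous_image) auto
  then obtain c where "\<And>\<theta>. \<theta> \<in> {-1..0} \<Longrightarrow> cmod (exp (s * complex_of_real \<theta>)) \<le> c"
    unfolding bounded_iff by blast
  ultimately show ?thesis unfolding char_fun_def
    by (subst matrix_integral_perturbed[OF M \<phi>, where c
        = c]) (auto intro: borel_measurable_continuous_on_restrict)
qed

lemma strongly_stable_if_rho_HS_less_1:
  assumes M: "matrix_difference (measure_of_nbv (M :: real \<Rightarrow> real^'n^'n))" and "rho_HS M < 1"
  shows "strongly_stable_uniform N M"
proof -
  define r where "r = max 0 (rho_HS M)"
  \<comment> \<open>Any number strictly between \<open>r\<close> and 1 would do. With
    \<open>\<alpha> = - ln r1\<close> the function \<open>r1 * exp (s \<phi>)\<close> has modulus at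
    most 1 for \<open>Re s > -\<alpha>\<close>, and a zero at \<open>s\<close> would make
    \<open>r1 > r\<close> an eigenvalue of its integral.\<close>
  define r1 where "r1 = (1 + r) / 2"
  have r: "0 \<le> r" "r < r1" "r1 < 1" "0 < r1" using assms(2) by (auto simp: r_def r1_def)
  define \<alpha> where "\<alpha> = - ln r1"
  have \<alpha>: "\<alpha> > 0" "exp \<alpha> = 1 / r1" using r by (auto simp: \<alpha>_def exp_minus divide_inverse)
  have "exp_rate N (perturbed \<phi> M) \<le> ereal (- \<alpha>)"
    if \<phi>: "\<phi> \<in> delay_maps" and G: "perturbed \<phi> M \<in> spectral_growth N" for \<phi>
  proof -
    have "Re s \<le> - \<alpha>" if zero: "char_fun (perturbed \<phi> M) s = 0" for s
    proof (rule ccontr)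
      assume "\<not> Re s \<le> - \<alpha>"
      define g where "g \<theta> = of_real r1 * exp (s * of_real (\<phi> \<theta>))" for \<theta>
      have \<phi>m: "\<phi> \<in> borel_measurable delay_borel"
        using \<phi> unfolding delay_maps_def by (simp add: measurable_restrict_space2_iff)
      then have gm: "g \<in> borel_measurable delay_borel" unfolding g_def by measurable
      have "cmod (g \<theta>) \<le> 1" if "\<theta> \<in> {-1..0}" for \<theta>
      proof -
        have \<phi>\<theta>: "\<phi> \<theta> \<in> {-1..0}" by (rule delay_mapsD[OF \<phi> that])
        have "- Re s * (- \<phi> \<theta>) \<le> \<alpha> * (- \<phi> \<theta>)" using \<open>\<not> Re s \<le> - \<alpha>\<close> \<phi>\<theta> by (intro mult_right_mono) auto
        also have "\<dots> \<le> \<alpha> * 1" using \<alpha> \<phi>\<theta> by (intro mult_left_mono) auto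
        finally have "exp (Re s * \<phi> \<theta>) \<le> exp \<alpha>" by simp
        then show ?thesis using r \<alpha>(2) by (simp add: g_def norm_mult field_simps)
      qed
      note g1 = this
      have "det (mat 1 - (\<chi> a b. (1 / of_real r1) * matrix_integral M g $ a $ b)) = 0"
        using zero r unfolding char_fun_perturbed[OF M \<phi>] g_def matrix_integral_scale by simp
      then have "of_real r1 \<in> eigenvalues (matrix_integral M g)"
        using r by (subst eigenvalue_iff_pencil) (auto simp: poly_pencil)
      then have "cmod (of_real r1) \<le> r"
        using eigenvalues_limit[OF M r(1) _ gm g1] eigenvalues_simple_le_rho_HS[OF M]
            unfolding r_def by blast
      then show False using r by simp
    qed
    \<comment> \<open>Only here membership in \<open>spectral_growth\<close> enters: it turns the
      bound on zeros into a bound on the rate.\<close>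
    then have "spectral_abscissa (perturbed \<phi> M) \<le> ereal (- \<alpha>)"
      unfolding spectral_abscissa_def by (intro Sup_least) auto
    then show ?thesis using G by (simp add: spectral_growth_def)
  qed
  then show ?thesis unfolding strongly_stable_uniform_def using \<alpha>(1) by blast
qed

section \<open>Perturbations onto a grid\<close>

lemma signed_measure_finite_UN:
  assumes \<nu>: "signed_measure \<nu>" and "finite I" "\<And>i. i \<in> I \<Longrightarrow> E i \<in> sets delay_borel"
      "disjoint_family_on E I"
  shows "\<nu> (\<Union>i\<in>I. E i) = (\<Sum>i\<in>I. \<nu> (E i))"
  using assms(2-)
proof (induction I rule: finite_induct)
  case empty
  then show ?case by (simp add: signed_measure_empty[OF \<nu>])
next
  case (insert i I)
  have "E i \<inter> (\<Union>i\<in>I. E i) = {}"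
    using insert.prems(2) insert.hyps(2) unfolding disjoint_family_on_def by fastforce
  then have "\<nu> (E i \<union> (\<Union>i\<in>I. E i)) = \<nu> (E i) + \<nu> (\<Union>i\<in>I. E i)"
    using insert by (intro signed_measure_Un \<nu>) auto
  moreover have "disjoint_family_on E I" using insert.prems(2) by (auto simp: disjoint_family_on_def)
  ultimately show ?case using insert by simp
qed

text \<open>\<open>\<phi>\<close> sends the piece \<open>J = j\<close> to the grid point
  \<open>-j/m\<close>. Excluding \<open>j = 0\<close> keeps all mass away from delay 0.\<close>

context
  fixes N :: "real^'n \<Rightarrow> real" and M :: "real \<Rightarrow> real^'n^'n" and J :: "real \<Rightarrow> nat" and m :: nat
      and \<phi> :: "real \<Rightarrow> real"
  assumes N: "is_norm N" and M: "matrix_difference (measure_of_nbv M)" and m: "0 < m"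
    and J: "simple_function delay_borel J" and range_J: "J ` {-1..0} \<subseteq> {1..m}"
    and \<phi>_eq: "\<And>\<theta>. \<phi> \<theta> = - (real (J \<theta>) / real m)"
begin

lemma grid_delay_map: "\<phi> \<in> delay_maps"
proof -
  have "simple_function delay_borel \<phi>"
    using simple_function_compose[OF J, of "\<lambda>j. - (real j / real m)"] by (simp add: o_def \<phi>_eq[abs_def])
  moreover have "\<phi> \<theta> \<in> {-1..0}" if "\<theta> \<in> {-1..0}" for \<theta>
  proof -
    have "J \<theta> \<in> {1..m}" using range_J that by blast
    then show ?thesis using m by (simp add: \<phi>_eq)
  qed
  ultimately show ?thesis unfolding delay_maps_def
    by (intro measurable_restrict_space2 borel_measurable_simple_function) auto
qed

definition grid_matrix :: "nat \<Rightarrow> real^'n^'n" where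
  "grid_matrix j = measure_of_nbv M (J -` {j} \<inter> {-1..0})"

lemma vector_integral_grid:
  assumes "continuous_on {-1..0} f"
  shows "vector_integral (perturbed \<phi> M) f = (\<Sum>j\<in>{1..m}. grid_matrix j *v f (- (real j / real m)))"
proof -
  have "signed_integral (\<lambda>A. measure_of_nbv M A $ a $ b) (\<lambda>\<theta>. f (- (real (J \<theta>) / real m)) $ b)
      = (\<Sum>j\<in>{1..m}. grid_matrix j $ a $ b * f (- (real j / real m)) $ b)" for a b
    using signed_integral_simple[OF _ J _ range_J, of "\<lambda>A. measure_of_nbv M A $ a $ b"
        "\<lambda>j. f (- (real j / real m)) $ b"] M
    by (simp add: matrix_difference_def grid_matrix_def)
  then show ?thesis unfolding vector_integral_perturbed[OF M grid_delay_map assms]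
    unfolding vector_integral_def \<phi>_eq
    by (simp add: vec_eq_iff matrix_vector_mult_def) (intro allI sum.swap)
qed

lemma char_fun_grid: "char_fun (perturbed \<phi> M) s
    = det (recurrence_pencil m grid_matrix (exp (- s / of_nat m)))"
proof -
  have "matrix_integral M (\<lambda>\<theta>. exp (s * of_real (\<phi> \<theta>)))
      = (\<chi> a b. \<Sum>j\<in>{1..m}. exp (s * of_real (- (real j / real m))) * of_real (grid_matrix j $ a $ b))"
    using matrix_integral_simple[OF M J _ range_J, of "\<lambda>j. exp (s * of_real (- (real j / real m)))"]
    by (simp add: \<phi>_eq grid_matrix_def)
  moreover have "exp (s * of_real (- (real j / real m))) = exp (- s / of_nat m) ^ j" for j
    unfolding exp_of_nat_mult[symmetric] by (simp add: mult.commute)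
  ultimately show ?thesis unfolding char_fun_perturbed[OF M grid_delay_map] recurrence_pencil_def
    by (simp only: mult.commute[of "exp _ ^ _"])
qed

lemma perturbed_grid:
  assumes t: "t \<in> {-1<..0}"
  shows "perturbed \<phi> M t = (\<Sum>j\<in>{1..m}. if - (real j / real m) \<le> t then grid_matrix j else 0)"
proof -
  define I where "I = {j \<in> {1..m}. - (real j / real m) \<le> t}"
  have I: "finite I" by (simp add: I_def)
  have pre: "\<phi> -` {-1..t} \<inter> {-1..0} = (\<Union>j\<in>I. J -` {j} \<inter> {-1..0})"
  proof -
    have "\<theta> \<in> \<phi> -` {-1..t} \<longleftrightarrow> J \<theta> \<in> I" if "\<theta> \<in> {-1..0}" for \<theta>
    proof -
      have "J \<theta> \<in> {1..m}" using range_J that by blast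
      moreover have "-1 \<le> \<phi> \<theta>" using delay_mapsD[OF grid_delay_map that] by simp
      ultimately show ?thesis by (simp add: I_def \<phi>_eq)
    qed
    then show ?thesis by blast
  qed
  have "perturbed \<phi> M t $ a $ b = (\<Sum>j\<in>I. grid_matrix j $ a $ b)" for a b
  proof -
    have "perturbed \<phi> M t $ a $ b = measure_of_nbv M (\<Union>j\<in>I. J -` {j} \<inter> {-1..0}) $ a $ b"
      using t pre by (auto simp: perturbed_def nbv_of_measure_def pushforward_def
          sets_restrict_space_iff)
    also have "\<dots> = (\<Sum>j\<in>I. measure_of_nbv M (J -` {j} \<inter> {-1..0}) $ a $ b)"
    proof (rule signed_measure_finite_UN[OF _ I])
      show "signed_measure (\<lambda>A. measure_of_nbv M A $ a $ b)"
        using matrix_difference_imp_matrix_measure[OF M] by (simp add: matrix_measure_def)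
    qed (auto simp: disjoint_family_on_def simple_function_vimage_sets[OF J])
    finally show ?thesis by (simp add: grid_matrix_def)
  qed
  then have "perturbed \<phi> M t = (\<Sum>j\<in>I. grid_matrix j)" by (simp add: vec_eq_iff)
  also have "\<dots> = (\<Sum>j\<in>{1..m}. if - (real j / real m) \<le> t then grid_matrix j else 0)"
    unfolding I_def by (rule sum.inter_filter) simp
  finally show ?thesis .
qed

text \<open>The perturbed function is a step function. Every step profile rises once from 0 to 1, so
  telescoping bounds the variation by the total size of the jumps.\<close>

lemma perturbed_grid_NBV: "perturbed \<phi> M \<in> NBV N"
proof -
  \<comment> \<open>The condition \<open>-1 < t\<close> encodes the normalisation at -1: the mass at
    delay 1 appears only to the right of that point.\<close>
  define \<sigma> where "\<sigma> j t = (if -1 < t \<and> - (real j / real m) \<le> t then 1 else 0 :: real)" for j t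
  have eq: "perturbed \<phi> M t = (\<Sum>j\<in>{1..m}. \<sigma> j t *\<^sub>R grid_matrix j)" if "t \<in> {-1..0}" for t
  proof (cases "t = -1")
    case True
    then show ?thesis by (simp add: perturbed_def nbv_of_measure_def \<sigma>_def)
  next
    case False
    then have "t \<in> {-1<..0}" using that by auto
    then show ?thesis unfolding perturbed_grid[OF \<open>t \<in> {-1<..0}\<close>]
      by (intro sum.cong) (auto simp: \<sigma>_def)
  qed
  obtain K where K: "K > 0" "\<And>A. induced_norm N A \<le> K * (\<Sum>a\<in>UNIV. \<Sum>b\<in>UNIV. \<bar>A $ a $ b\<bar>)"
    using induced_norm_upper_bound[OF N] by blast
  define G where "G j = (\<Sum>a\<in>UNIV. \<Sum>b\<in>UNIV. \<bar>grid_matrix j $ a $ b\<bar>)" for j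
  have G0: "0 \<le> G j" for j unfolding G_def by (intro sum_nonneg) auto
  have "(\<Sum>k<n. induced_norm N (perturbed \<phi> M (t (Suc k)) - perturbed \<phi> M (t k))) \<le> K * (\<Sum>j\<in>{1..m}. G j)"
    if t: "mono_on {..n} t" "t ` {..n} \<subseteq> {-1..0}" for n :: nat and t
  proof -
    have step: "induced_norm N (perturbed \<phi> M (t (Suc k)) - perturbed \<phi> M (t k))
        \<le> K * (\<Sum>j\<in>{1..m}. (\<sigma> j (t (Suc k)) - \<sigma> j (t k)) * G j)" if "k < n" for k
    proof -
      have tk: "t k \<in> {-1..0}" "t (Suc k) \<in> {-1..0}" using that t(2) by (auto simp: image_subset_iff)
      have "t k \<le> t (Suc k)" using that by (intro mono_onD[OF t(1)]) auto
      then have \<sigma>: "\<sigma> j (t k) \<le> \<sigma> j (t (Suc k))" for j by (auto simp: \<sigma>_def)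
      have "(\<Sum>a\<in>UNIV. \<Sum>b\<in>UNIV. \<bar>(perturbed \<phi> M (t (Suc k)) - perturbed \<phi> M (t k)) $ a $ b\<bar>)
          \<le> (\<Sum>a\<in>UNIV. \<Sum>b\<in>UNIV. \<Sum>j\<in>{1..m}. (\<sigma> j (t (Suc k)) - \<sigma> j (t k)) * \<bar>grid_matrix j $ a $ b\<bar>)"
      proof (intro sum_mono)
        fix a b
        have "(perturbed \<phi> M (t (Suc k)) - perturbed \<phi> M (t k)) $ a $ b
            = (\<Sum>j\<in>{1..m}. (\<sigma> j (t (Suc k)) - \<sigma> j (t k)) * grid_matrix j $ a $ b)"
          unfolding vector_minus_component eq[OF tk(1)] eq[OF tk(2)]
          by (simp add: sum_subtractf left_diff_distrib)
        also have "\<bar>\<dots>\<bar> \<le> (\<Sum>j\<in>{1..m}. \<bar>(\<sigma> j (t (Suc k)) - \<sigma> j (t k)) * grid_matrix j $ a $ b\<bar>)"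
            by (rule sum_abs)
        also have "\<dots> = (\<Sum>j\<in>{1..m}. (\<sigma> j (t (Suc k)) - \<sigma> j (t k)) * \<bar>grid_matrix j $ a $ b\<bar>)"
          using \<sigma> by (simp add: abs_mult)
        finally show "\<bar>(perturbed \<phi> M (t (Suc k)) - perturbed \<phi> M (t k)) $ a $ b\<bar>
            \<le> (\<Sum>j\<in>{1..m}. (\<sigma> j (t (Suc k)) - \<sigma> j (t k)) * \<bar>grid_matrix j $ a $ b\<bar>)" .
      qed
      also have "\<dots> = (\<Sum>a\<in>UNIV. \<Sum>j\<in>{1..m}. \<Sum>b\<in>UNIV. (\<sigma> j (t (Suc k)) - \<sigma> j (t k)) * \<bar>grid_matrix j $
          a $ b\<bar>)"
        by (intro sum.cong refl sum.swap)
      also have "\<dots> = (\<Sum>j\<in>{1..m}. (\<sigma> j (t (Suc k)) - \<sigma> j (t k)) * G j)"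
        by (subst sum.swap) (simp add: G_def sum_distrib_left)
      finally show ?thesis using K(2)[of "perturbed \<phi> M (t (Suc k)) - perturbed \<phi> M (t k)"] K(1)
        by (meson less_imp_le mult_left_mono order_trans)
    qed
    have "(\<Sum>k<n. induced_norm N (perturbed \<phi> M (t (Suc k)) - perturbed \<phi> M (t k)))
        \<le> (\<Sum>k<n. K * (\<Sum>j\<in>{1..m}. (\<sigma> j (t (Suc k)) - \<sigma> j (t k)) * G j))"
      using step by (intro sum_mono) auto
    also have "\<dots> = K * (\<Sum>j\<in>{1..m}. (\<Sum>k<n. \<sigma> j (t (Suc k)) - \<sigma> j (t k)) * G j)"
      unfolding sum_distrib_left[symmetric] by (subst sum.swap) (simp add: sum_distrib_right)
    also have "\<dots> \<le> K * (\<Sum>j\<in>{1..m}. 1 * G j)"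
    proof (intro mult_left_mono sum_mono mult_right_mono G0)
      show "(\<Sum>k<n. \<sigma> j (t (Suc k)) - \<sigma> j (t k)) \<le> 1" for j
      proof -
        have "(\<Sum>k<n. \<sigma> j (t (Suc k)) - \<sigma> j (t k)) = \<sigma> j (t n) - \<sigma> j (t 0)"
          by (rule sum_lessThan_telescope)
        then show ?thesis by (simp add: \<sigma>_def split: if_splits)
      qed
    qed (use K in auto)
    finally show ?thesis by simp
  qed
  then have "bounded_variation N (perturbed \<phi> M)" unfolding bounded_variation_def by blast
  moreover have "perturbed \<phi> M (-1) = 0" by (simp add: perturbed_def nbv_of_measure_def)
  moreover have "continuous (at_right t) (perturbed \<phi> M)" if t: "t \<in> {-1<..<0}" for t
  proof -
    have "((\<lambda>s. \<sigma> j s) \<longlongrightarrow> \<sigma> j t) (at_right t)" for j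
    proof (rule tendsto_eventually, cases "- (real j / real m) \<le> t")
      case True
      show "eventually (\<lambda>s. \<sigma> j s = \<sigma> j t) (at_right t)"
        by (rule eventually_mono[OF eventually_at_right_less]) (use True t in \<open>auto simp: \<sigma>_def\<close>)
    next
      case False
      then have "eventually (\<lambda>s. s \<in> {t<..<- (real j / real m)}) (at_right t)"
        by (intro eventually_at_right_real) auto
      then show "eventually (\<lambda>s. \<sigma> j s = \<sigma> j t) (at_right t)"
        by (rule eventually_mono) (use False in \<open>auto simp: \<sigma>_def\<close>)
    qed
    then have "((\<lambda>s. \<Sum>j\<in>{1..m}. \<sigma> j s *\<^sub>R grid_matrix j) \<longlongrightarrow> (\<Sum>j\<in>{1..m}. \<sigma> j t *\<^sub>R grid_matrix j))
        (at_right t)"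
      by (intro tendsto_intros)
    moreover have "eventually (\<lambda>s. s \<in> {t<..<0}) (at_right t)" using t
        by (intro eventually_at_right_real) auto
    then have "eventually (\<lambda>s. (\<Sum>j\<in>{1..m}. \<sigma> j s *\<^sub>R grid_matrix j) = perturbed \<phi> M s) (at_right t)"
      by (rule eventually_mono) (use t eq in auto)
    ultimately show ?thesis unfolding continuous_within using eq[of t] t
        by (auto intro: Lim_transform_eventually)
  qed
  ultimately show ?thesis by (simp add: NBV_def)
qed

text \<open>No delay is shorter than \<open>1/m\<close>, so there is no jump at 0 and the
  determinant in \<open>well_posed\<close> is that of the identity.\<close>

lemma perturbed_grid_spectral_growth: "perturbed \<phi> M \<in> spectral_growth N"
proof (rule spectral_growth_commensurable[OF N m vector_integral_grid char_fun_grid])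
  have "eventually (\<lambda>t. t \<in> {-(1/real m)<..<0}) (at_left (0::real))"
    using m by (intro eventually_at_left_real) auto
  then have "eventually (\<lambda>t. perturbed \<phi> M t = perturbed \<phi> M 0) (at_left 0)"
  proof (rule eventually_mono)
    fix t :: real assume t: "t \<in> {-(1/real m)<..<0}"
    have "1 / real m \<le> 1" using m by simp
    then have t1: "t \<in> {-1<..0}" using t by auto
    have "- (real j / real m) \<le> t" if "j \<in> {1..m}" for j
    proof -
      have "1 / real m \<le> real j / real m" using that by (intro divide_right_mono) auto
      then show ?thesis using t by auto
    qed
    then show "perturbed \<phi> M t = perturbed \<phi> M 0"
      unfolding perturbed_grid[OF t1] perturbed_grid[of 0, simplified] by (intro sum.cong) auto
  qed
  then have "(perturbed \<phi> M \<longlongrightarrow> perturbed \<phi> M 0) (at_left 0)" by (rule tendsto_eventually)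
  then have "Lim (at_left 0) (perturbed \<phi> M) = perturbed \<phi> M 0" by (intro tendsto_Lim) auto
  then show "perturbed \<phi> M \<in> well_posed N" using perturbed_grid_NBV by (simp add: well_posed_def)
qed

end

section \<open>Tori without zeros from local stability\<close>

text \<open>\<open>u\<close> labels a partition, \<open>\<tau> i\<close> is a delay close to all
  points of piece \<open>i\<close>, and \<open>\<zeta> i\<close> is a freely chosen phase.
  \<open>F L\<close> is the characteristic function of an admissible grid perturbation seen from a
  vertically shifted origin; its zero-free half-plane is inherited by the limit
  \<open>H\<close>.\<close>

lemma locally_strongly_stable_torus_no_zeros:
  fixes M :: "real \<Rightarrow> real^'n^'n" and u :: "real \<Rightarrow> 'i" and \<tau> :: "'i \<Rightarrow> real" and \<zeta> :: "'i \<Rightarrow> complex"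
  assumes N: "is_norm N" and M: "matrix_difference (measure_of_nbv M)" and \<epsilon>: "0 < \<epsilon>"
    and stable: "\<And>\<phi>. \<phi> \<in> delay_maps \<Longrightarrow> sup_norm abs (\<lambda>\<theta>. \<phi> \<theta> - \<theta>) < \<epsilon> \<Longrightarrow>
        perturbed \<phi> M \<in> spectral_growth N \<Longrightarrow> exp_rate N (perturbed \<phi> M) \<le> ereal (- \<alpha>)"
    and u: "simple_function delay_borel u"
    and \<tau>: "\<And>\<theta>. \<theta> \<in> {-1..0} \<Longrightarrow> 0 < \<tau> (u \<theta>) \<and> \<tau> (u \<theta>) \<le> 1 \<and> \<bar>\<theta> + \<tau> (u \<theta>)\<bar> \<le> \<epsilon> / 4"
    and \<zeta>: "\<And>i. i \<in> u ` {-1..0} \<Longrightarrow> cmod (\<zeta> i) = 1" and s: "- \<alpha> < Re s"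
  shows "det (mat 1 - (\<chi> a b. \<Sum>i\<in>u ` {-1..0}. exp (- s * of_real (\<tau> i)) * \<zeta> i *
     of_real (measure_of_nbv M (u -` {i} \<inter> {-1..0}) $ a $ b))) \<noteq> 0"
proof -
  define I where "I = u ` {-1..0}"
  have I: "finite I" "u ` {-1..0} \<subseteq> I" using simple_functionD(1)[OF u] by (auto simp: I_def)
  define C where "C i a b = complex_of_real (measure_of_nbv M (u -` {i} \<inter> {-1..0}) $ a $ b)" for i a b
  have \<tau>I: "0 < \<tau> i" "\<tau> i \<le> 1" if "i \<in> I" for i using \<tau> that by (auto simp: I_def)
  \<comment> \<open>The phase in full turns, negated because delays enter with a minus sign, and
    reduced to \<open>[0,1)\<close> so that \<open>\<lfloor>y i * L\<rfloor>\<close> is a digit in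
    base \<open>L\<close>.\<close>
  define y where "y i = frac (- Arg (\<zeta> i) / (2 * pi))" for i
  have y: "0 \<le> y i" "y i < 1" for i by (simp_all add: y_def frac_lt_1)
  have \<zeta>y: "exp (\<i> * of_real (- (2 * pi * y i))) = \<zeta> i" if "i \<in> I" for i
  proof -
    have "- (2 * pi * y i) = Arg (\<zeta> i) + 2 * pi * of_int \<lfloor>- Arg (\<zeta> i) / (2 * pi)\<rfloor>"
      by (simp add: y_def frac_def field_simps)
    then have "cis (- (2 * pi * y i))
        = cis (Arg (\<zeta> i)) * cis (2 * pi * of_int \<lfloor>- Arg (\<zeta> i) / (2 * pi)\<rfloor>)"
      by (simp only: cis_mult)
    also have "cis (2 * pi * of_int \<lfloor>- Arg (\<zeta> i) / (2 * pi)\<rfloor>) = 1" by (rule cis_multiple_2pi) simp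
    also have "cis (Arg (\<zeta> i)) * 1 = \<zeta> i"
    proof -
      have "cmod (\<zeta> i) = 1" using \<zeta> that by (simp add: I_def)
      then have "\<zeta> i \<noteq> 0" by auto
      then show ?thesis using \<open>cmod (\<zeta> i) = 1\<close> by (simp add: cis_Arg sgn_div_norm)
    qed
    finally show ?thesis by (simp add: cis_conv_exp)
  qed
  text \<open>On the grid of mesh \<open>1/L\<^sup>2\<close> the frequency \<open>2 \<pi> L\<close> rotates by \<open>2 \<pi> / L\<close> per grid step, so that
    within distance \<open>O(1/L)\<close> of \<open>-\<tau> i\<close> every phase is attained up to \<open>O(1/L)\<close>.\<close>
  define p where "p L i = real L * (of_int \<lfloor>\<tau> i * real L\<rfloor> - 1) + of_int \<lfloor>y i * real L\<rfloor> + 1" for L i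
  define a where "a L i = - (p L i / (real L)\<^sup>2)" for L i
  have floor_lim: "(\<lambda>L. of_int \<lfloor>c * real L\<rfloor> / real L) \<longlonglongrightarrow> c" for c :: real
  proof (rule real_tendsto_sandwich)
    show "eventually (\<lambda>L. c - 1 / real L \<le> of_int \<lfloor>c * real L\<rfloor> / real L) sequentially"
      using eventually_gt_at_top[of 0]
    proof eventually_elim
      case (elim L)
      have "(c * real L - 1) / real L \<le> of_int \<lfloor>c * real L\<rfloor> / real L"
          by (intro divide_right_mono) linarith+
      then show ?case using elim by (simp add: diff_divide_distrib)
    qed
    show "eventually (\<lambda>L. of_int \<lfloor>c * real L\<rfloor> / real L \<le> c) sequentially"
      using eventually_gt_at_top[of 0]
    proof eventually_elim
      case (elim L)
      have "of_int \<lfloor>c * real L\<rfloor> / real L \<le> (c * real L) / real L" by (intro divide_right_mono) linarith+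
      then show ?case using elim by simp
    qed
    have "(\<lambda>L. c - 1 / real L) \<longlonglongrightarrow> c - 0" by (intro tendsto_intros lim_1_over_n)
    then show "(\<lambda>L. c - 1 / real L) \<longlonglongrightarrow> c" by simp
  qed simp
  have a_lim: "(\<lambda>L. a L i) \<longlonglongrightarrow> - \<tau> i" for i
  proof -
    have "(\<lambda>L. - (of_int \<lfloor>\<tau> i * real L\<rfloor> / real L - 1 / real L + of_int \<lfloor>y i * real L\<rfloor> / real L *
        (1 / real L) + 1 / real L * (1 / real L)))
        \<longlonglongrightarrow> - (\<tau> i - 0 + y i * 0 + 0 * 0)"
      by (intro tendsto_intros floor_lim lim_1_over_n)
    moreover have "eventually (\<lambda>L. - (of_int \<lfloor>\<tau> i * real L\<rfloor> / real L - 1 / real L + of_int \<lfloor>y i *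
        real L\<rfloor> / real L * (1 / real L) + 1 / real L * (1 / real L)) = a L i) sequentially"
      using eventually_gt_at_top[of 0]
      by eventually_elim (simp add: a_def p_def power2_eq_square field_simps)
    ultimately have "(\<lambda>L. a L i) \<longlonglongrightarrow> - (\<tau> i - 0 + y i * 0 + 0 * 0)" by (rule Lim_transform_eventually)
    then show ?thesis by simp
  qed
  have phase_lim: "(\<lambda>L. exp (\<i> * of_real (2 * pi * real L * a L i))) \<longlonglongrightarrow> \<zeta> i" if "i \<in> I" for i
  proof -
    have "(\<lambda>L. exp (\<i> * of_real (- (2 * pi * (of_int \<lfloor>y i * real L\<rfloor> / real L + 1 / real L)))))
        \<longlonglongrightarrow> exp (\<i> * of_real (- (2 * pi * (y i + 0))))"
      by (intro tendsto_intros floor_lim lim_1_over_n)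
    moreover have "eventually (\<lambda>L. exp
        (\<i> * of_real (- (2 * pi * (of_int \<lfloor>y i * real L\<rfloor> / real L + 1 / real L))))
        = exp (\<i> * of_real (2 * pi * real L * a L i))) sequentially"
      using eventually_gt_at_top[of 0]
    proof eventually_elim
      case (elim L)
      \<comment> \<open>The coarse part of the delay contributes whole turns; only the fine digit is
        visible in the phase.\<close>
      have "2 * pi * real L * a L i = - (2 * pi * (of_int \<lfloor>y i * real L\<rfloor> / real L + 1 / real L))
          + 2 * pi * of_int (1 - \<lfloor>\<tau> i * real L\<rfloor>)"
        using elim by (simp add: a_def p_def power2_eq_square field_simps)
      then have "cis (2 * pi * real L * a L i)
          = cis (- (2 * pi * (of_int \<lfloor>y i * real L\<rfloor> / real L + 1 / real L)))
          * cis (2 * pi * of_int (1 - \<lfloor>\<tau> i * real L\<rfloor>))" by (simp only: cis_mult)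
      also have "cis (2 * pi * of_int (1 - \<lfloor>\<tau> i * real L\<rfloor>)) = 1" by (rule cis_multiple_2pi) simp
      finally show ?case by (simp add: cis_conv_exp)
    qed
    ultimately have "(\<lambda>L. exp (\<i> * of_real (2 * pi * real L * a L i)))
        \<longlonglongrightarrow> exp (\<i> * of_real (- (2 * pi * (y i + 0))))"
      by (rule Lim_transform_eventually)
    then show ?thesis using \<zeta>y[OF that] by simp
  qed
  define F where "F L z = det (mat 1 - (\<chi> b c. \<Sum>i\<in>I. exp ((z + \<i> * of_real (2 * pi * real L)) *
      of_real (a L i)) * C i b c))" for L z
  define H where "H z = det (mat 1 - (\<chi> b c. \<Sum>i\<in>I. exp (- z * of_real (\<tau> i)) * \<zeta> i * C i b c))" for z
  define S where "S = {z. - \<alpha> < Re z}"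
  have "eventually (\<lambda>L. \<forall>i\<in>I. 1 < \<tau> i * real L) sequentially"
  proof (rule eventually_ball_finite[OF I(1)], rule ballI)
    fix i assume "i \<in> I"
    then have \<tau>0: "0 < \<tau> i" by (rule \<tau>I)
    show "eventually (\<lambda>L. 1 < \<tau> i * real L) sequentially"
      using eventually_gt_at_top[of "nat \<lceil>1 / \<tau> i\<rceil>"]
    proof eventually_elim
      case (elim L)
      then have "1 / \<tau> i < real L" by linarith
      then show ?case using \<tau>0 by (simp add: divide_less_eq mult.commute)
    qed
  qed
  moreover have "eventually (\<lambda>L. \<forall>i\<in>I. \<bar>a L i + \<tau> i\<bar> < \<epsilon> / 4) sequentially"
  proof (rule eventually_ball_finite[OF I(1)], rule ballI)
    fix i
    have "(\<lambda>L. \<bar>a L i + \<tau> i\<bar>) \<longlonglongrightarrow> \<bar>- \<tau> i + \<tau> i\<bar>" by (intro tendsto_intros a_lim)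
    then show "eventually (\<lambda>L. \<bar>a L i + \<tau> i\<bar> < \<epsilon> / 4) sequentially"
      using \<epsilon> by (intro order_tendstoD(2)) auto
  qed
  ultimately have "eventually (\<lambda>L. 0 < L \<and> (\<forall>i\<in>I. 1 < \<tau> i * real L) \<and> (\<forall>i\<in>I. \<bar>a L i + \<tau> i\<bar> < \<epsilon> / 4))
      sequentially"
    using eventually_gt_at_top[of 0] by eventually_elim auto
  then obtain L0 where L0: "\<And>L. L \<ge> L0 \<Longrightarrow> 0 < L \<and> (\<forall>i\<in>I. 1 < \<tau> i * real L) \<and> (\<forall>i\<in>I. \<bar>a L i + \<tau> i\<bar>
      < \<epsilon> / 4)"
    by (auto simp: eventually_sequentially)
  have Fnz: "F L z \<noteq> 0" if "L \<ge> L0" "z \<in> S" for L z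
  proof
    assume F0: "F L z = 0"
    \<comment> \<open>The vertical shift leaves the real part unchanged, so a zero at
      \<open>w\<close> contradicts the bound on the abscissa.\<close>
    define w where "w = z + \<i> * of_real (2 * pi * real L)"
    have L: "0 < L" "\<And>i. i \<in> I \<Longrightarrow> 1 < \<tau> i * real L" "\<And>i. i \<in> I \<Longrightarrow> \<bar>a L i + \<tau> i\<bar> < \<epsilon> / 4"
      using L0[OF that(1)] by auto
    \<comment> \<open>A two-digit number in base \<open>L\<close>: the coarse digit
      \<open>\<lfloor>\<tau> L\<rfloor> - 1\<close> and the fine digit both lie in
      \<open>0..L-1\<close>, and the final 1 moves the range to \<open>1..L^2\<close>, away from
      delay 0.\<close>
    define J where "J \<theta> = nat (int L * (\<lfloor>\<tau> (u \<theta>) * real L\<rfloor> - 1) + \<lfloor>y (u \<theta>) * real L\<rfloor> + 1)" for \<theta>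
    define \<phi> where "\<phi> \<theta> = - (real (J \<theta>) / real (L\<^sup>2))" for \<theta>
    have Jsimple: "simple_function delay_borel J"
      using simple_function_compose[OF u, of
          "\<lambda>i. nat (int L * (\<lfloor>\<tau> i * real L\<rfloor> - 1) + \<lfloor>y i * real L\<rfloor> + 1)"]
      by (simp add: o_def J_def[abs_def])
    have J: "J \<theta> \<in> {1..L\<^sup>2}" "\<phi> \<theta> = a L (u \<theta>)" if \<theta>: "\<theta> \<in> {-1..0}" for \<theta>
    proof -
      have i: "u \<theta> \<in> I" using \<theta> by (simp add: I_def)
      define k where "k = \<lfloor>\<tau> (u \<theta>) * real L\<rfloor>"
      define l where "l = \<lfloor>y (u \<theta>) * real L\<rfloor>"
      have "1 \<le> k" using L(2)[OF i] unfolding k_def by (simp add: le_floor_iff)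
      have "\<tau> (u \<theta>) * real L \<le> 1 * real L" using \<tau>I[OF i] by (intro mult_right_mono) auto
      then have "k \<le> int L" unfolding k_def by (simp add: floor_le_iff)
      have "0 \<le> l" using y(1)[of "u \<theta>"] by (simp add: l_def)
      have "y (u \<theta>) * real L < 1 * real L" using y(2)[of "u \<theta>"] L(1)
          by (intro mult_strict_right_mono) auto
      then have "l < int L" unfolding l_def by (simp add: floor_less_iff)
      have lower: "0 \<le> int L * (k - 1)" using \<open>1 \<le> k\<close> by simp
      have upper: "int L * (k - 1) \<le> int L * (int L - 1)" using \<open>k \<le> int L\<close>
          by (intro mult_left_mono) auto
      have Jint: "int (J \<theta>) = int L * (k - 1) + l + 1"
        using lower \<open>0 \<le> l\<close> by (simp add: J_def k_def l_def)
      have "int (J \<theta>) \<le> int (L\<^sup>2)"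
        using upper \<open>l < int L\<close> unfolding Jint by (simp add: power2_eq_square algebra_simps)
      moreover have "1 \<le> int (J \<theta>)" using lower \<open>0 \<le> l\<close> unfolding Jint by linarith
      ultimately show "J \<theta> \<in> {1..L\<^sup>2}" by (simp del: of_nat_power)
      have "real (J \<theta>) = of_int (int (J \<theta>))" by simp
      also have "\<dots> = p L (u \<theta>)" unfolding Jint by (simp add: p_def k_def l_def)
      finally show "\<phi> \<theta> = a L (u \<theta>)" by (simp add: \<phi>_def a_def)
    qed
    have range_J: "J ` {-1..0} \<subseteq> {1..L\<^sup>2}" using J by blast
    have m: "0 < L\<^sup>2" using L(1) by simp
    have \<phi>: "\<phi> \<in> delay_maps" by (rule grid_delay_map[OF N M m Jsimple range_J \<phi>_def])
    have G: "perturbed \<phi> M \<in> spectral_growth N"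
      by (rule perturbed_grid_spectral_growth[OF N M m Jsimple range_J \<phi>_def])
    \<comment> \<open>One quarter of \<open>\<epsilon>\<close> comes from replacing
      \<open>\<theta>\<close> by \<open>-\<tau>\<close>, one from rounding; the supremum then stays
      strictly below \<open>\<epsilon>\<close>.\<close>
    have "sup_norm abs (\<lambda>\<theta>. \<phi> \<theta> - \<theta>) \<le> \<epsilon> / 2"
    proof (rule sup_norm_least)
      fix \<theta> :: real assume \<theta>: "\<theta> \<in> {-1..0}"
      have "\<bar>\<phi> \<theta> - \<theta>\<bar> \<le> \<bar>a L (u \<theta>) + \<tau> (u \<theta>)\<bar> + \<bar>\<theta> + \<tau> (u \<theta>)\<bar>"
        unfolding J(2)[OF \<theta>] by linarith
      moreover have "\<bar>a L (u \<theta>) + \<tau> (u \<theta>)\<bar> < \<epsilon> / 4" using \<theta> by (intro L(3)) (simp add: I_def)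
      moreover have "\<bar>\<theta> + \<tau> (u \<theta>)\<bar> \<le> \<epsilon> / 4" using \<tau>[OF \<theta>] by simp
      ultimately show "\<bar>\<phi> \<theta> - \<theta>\<bar> \<le> \<epsilon> / 2" by linarith
    qed
    then have "sup_norm abs (\<lambda>\<theta>. \<phi> \<theta> - \<theta>) < \<epsilon>" using \<epsilon> by linarith
    from stable[OF \<phi> this G] have "spectral_abscissa (perturbed \<phi> M) \<le> ereal (- \<alpha>)"
      using G by (simp add: spectral_growth_def)
    moreover have "char_fun (perturbed \<phi> M) w = 0"
    proof -
      have "matrix_integral M (\<lambda>\<theta>. exp (w * of_real (\<phi> \<theta>)))
          = matrix_integral M (\<lambda>\<theta>. exp (w * of_real (a L (u \<theta>))))"
        unfolding matrix_integral_def signed_integral_def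
        by (intro arg_cong[where f = vec_lambda] ext arg_cong2[where f =
            "(-)"] Bochner_Integration.integral_cong) (auto simp: J(2))
      also have "\<dots> = (\<chi> b c. \<Sum>i\<in>I. exp (w * of_real (a L i)) * C i b c)"
        using matrix_integral_simple[OF M u I, of "\<lambda>i. exp (w * of_real (a L i))"] by (simp add: C_def)
      finally show ?thesis using F0 by (simp add: char_fun_perturbed[OF M \<phi>] F_def w_def)
    qed
    then have "ereal (Re w) \<le> spectral_abscissa (perturbed \<phi> M)"
      unfolding spectral_abscissa_def by (intro Sup_upper) auto
    ultimately have "ereal (Re w) \<le> ereal (- \<alpha>)" by (rule order_trans[rotated])
    then show False using that(2) by (simp add: w_def S_def)
  qed
  have "H s \<noteq> 0"
  proof -
    \<comment> \<open>Since every \<open>\<tau> i\<close> is positive, \<open>H\<close> tends to 1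
      far to the right. This supplies the point where \<open>H\<close> does not vanish.\<close>
    have "((\<lambda>x. H (of_real x)) \<longlongrightarrow> det (mat 1 - (\<chi> b c. \<Sum>i\<in>I. 0 * \<zeta> i * C i b c))) at_top"
      unfolding H_def det_def vector_minus_component vec_lambda_beta
    proof (intro tendsto_intros)
      fix i assume "i \<in> I"
      then have "0 < \<tau> i" by (rule \<tau>I)
      then have "filterlim (\<lambda>x. \<tau> i * x) at_top at_top"
        by (intro filterlim_tendsto_pos_mult_at_top[OF tendsto_const] filterlim_ident)
      then have "filterlim (\<lambda>x. - x * \<tau> i) at_bot at_top"
          by (simp add: filterlim_uminus_at_bot mult.commute)
      then have "((\<lambda>x. exp (- x * \<tau> i)) \<longlongrightarrow> 0) at_top" by (rule filterlim_compose[OF exp_at_bot])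
      then have "((\<lambda>x. of_real (exp (- x * \<tau> i)) :: complex) \<longlongrightarrow> of_real 0) at_top"
          by (rule tendsto_of_real)
      then show "((\<lambda>x. exp (- complex_of_real x * of_real (\<tau> i))) \<longlongrightarrow> 0) at_top"
        by (simp add: exp_of_real[symmetric])
    qed
    moreover have "mat 1 - (\<chi> b c. \<Sum>i\<in>I. 0 * \<zeta> i * C i b c) = mat 1" by (simp add: vec_eq_iff)
    ultimately have "((\<lambda>x. H (of_real x)) \<longlongrightarrow> 1) at_top" by simp
    then have "eventually (\<lambda>x. H (of_real x) \<noteq> 0) at_top" by (rule tendsto_imp_eventually_ne) simp
    then have "eventually (\<lambda>x. H (of_real x) \<noteq> 0 \<and> - \<alpha> < x) at_top"
      using eventually_gt_at_top[of "- \<alpha>"] by eventually_elim auto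
    then obtain x where x: "H (of_real x) \<noteq> 0" "- \<alpha> < x" by (auto dest: eventually_happens)
    show ?thesis
    proof (rule no_zeros_limit[of S F H L0 "of_real x" s])
      show "open S" "connected S"
        unfolding S_def by (auto intro: open_halfspace_Re_gt convex_connected convex_halfspace_Re_gt)
      show "F L holomorphic_on S" for L
        unfolding F_def det_def vector_minus_component vec_lambda_beta by (intro holomorphic_intros)
      show "H holomorphic_on S"
        unfolding H_def det_def vector_minus_component vec_lambda_beta by (intro holomorphic_intros)
      fix v :: "nat \<Rightarrow> complex" and z and r :: "nat \<Rightarrow> nat" assume r: "strict_mono r" and v: "v \<longlonglongrightarrow> z"
      have "(\<lambda>n. exp (v n * of_real (a (r n) i)) * exp (\<i> * of_real (2 * pi * real (r n) * a (r n) i)))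
          \<longlonglongrightarrow> exp (z * of_real (- \<tau> i)) * \<zeta> i" if "i \<in> I" for i
        by (intro tendsto_intros v LIMSEQ_subseq_LIMSEQ[OF a_lim r, unfolded o_def]
            LIMSEQ_subseq_LIMSEQ[OF phase_lim[OF that] r, unfolded o_def])
      then have "(\<lambda>n. exp ((v n + \<i> * of_real (2 * pi * real (r n))) * of_real (a (r n) i)))
          \<longlonglongrightarrow> exp (- z * of_real (\<tau> i)) * \<zeta> i" if "i \<in> I" for i
        using that by (simp add: exp_add[symmetric] algebra_simps)
      then show "(\<lambda>n. F (r n) (v n)) \<longlonglongrightarrow> H z"
        unfolding F_def H_def det_def vector_minus_component vec_lambda_beta
        by (intro tendsto_intros)
    qed (use x s Fnz in \<open>auto simp: S_def\<close>)
  qed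
  then show ?thesis by (simp add: H_def I_def C_def)
qed

text \<open>The level sets of a simple \<open>g\<close> are refined by cells of length about
  \<open>1/n\<close>, the delay of a cell being \<open>k/n\<close>. Real \<open>s\<close> then gives
  tori of radii \<open>(t R)^k\<close>, growing from 0 to \<open>R^k \<ge> R\<close>; the final
  polydisc contains \<open>g/z\<close> whenever \<open>cmod z > 1/R\<close>.\<close>

lemma rho_HS_less_1_if_locally_strongly_stable:
  assumes N: "is_norm N" and M: "matrix_difference (measure_of_nbv (M :: real \<Rightarrow> real^'n^'n))"
    and "locally_strongly_stable_uniform N M"
  shows "rho_HS M < 1"
proof -
  obtain \<alpha> \<epsilon> where \<alpha>: "\<alpha> > 0" and \<epsilon>: "\<epsilon> > 0" and stable: "\<And>\<phi>. \<phi> \<in> delay_maps \<Longrightarrow>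
      sup_norm abs (\<lambda>\<theta>. \<phi> \<theta> - \<theta>) < \<epsilon> \<Longrightarrow> perturbed \<phi> M \<in> spectral_growth N \<Longrightarrow>
      exp_rate N (perturbed \<phi> M) \<le> ereal (- \<alpha>)"
    using assms(3) unfolding locally_strongly_stable_uniform_def by blast
  obtain n :: nat where n: "0 < n" "1 / real n \<le> \<epsilon> / 4"
    using real_arch_inverse[of "\<epsilon> / 4"] \<epsilon> by (auto simp: inverse_eq_divide)
  \<comment> \<open>Corresponds to \<open>s = -\<alpha>/2\<close>, safely inside the zero-free
    half-plane: \<open>exp (-s k/n) = R^k\<close>.\<close>
  define R where "R = exp (\<alpha> / (2 * real n))"
  have R: "1 < R" using \<alpha> n by (simp add: R_def)
  \<comment> \<open>Adding 1 keeps the delay positive; the minimum corrects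
    \<open>\<theta> = -1\<close>, where the count would reach \<open>n + 1\<close>.\<close>
  define k where "k \<theta> = min n (nat \<lfloor>- \<theta> * real n\<rfloor> + 1)" for \<theta> :: real
  have k: "1 \<le> k \<theta>" "k \<theta> \<le> n" for \<theta> using n by (auto simp: k_def)
  have k\<theta>: "\<bar>\<theta> + real (k \<theta>) / real n\<bar> \<le> \<epsilon> / 4" if \<theta>: "\<theta> \<in> {-1..0}" for \<theta>
  proof -
    have x: "0 \<le> - \<theta> * real n" "- \<theta> * real n \<le> 1 * real n"
      using \<theta> mult_right_mono[of "- \<theta>" 1 "real n"] by (auto intro!: mult_nonpos_nonneg)
    then have "\<bar>- \<theta> * real n - real (k \<theta>)\<bar> \<le> 1" unfolding k_def by linarith
    then have "\<bar>- \<theta> * real n - real (k \<theta>)\<bar> / real n \<le> 1 / real n" by (intro divide_right_mono) auto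
    moreover have "\<bar>- \<theta> * real n - real (k \<theta>)\<bar> / real n = \<bar>\<theta> + real (k \<theta>) / real n\<bar>"
    proof -
      have "\<bar>- \<theta> * real n - real (k \<theta>)\<bar> / real n = \<bar>(- \<theta> * real n - real (k \<theta>)) / real n\<bar>" by simp
      also have "(- \<theta> * real n - real (k \<theta>)) / real n = - (\<theta> + real (k \<theta>) / real n)" using n
          by (simp add: field_simps)
      finally show ?thesis by simp
    qed
    ultimately show ?thesis using n(2) by linarith
  qed
  have ksimple: "simple_function delay_borel k"
    unfolding simple_function_def
  proof (intro conjI ballI)
    have "k ` space delay_borel \<subseteq> {..n}" using k by auto
    then show "finite (k ` space delay_borel)" by (rule finite_subset) simp
    have "(\<lambda>\<theta>. k \<theta>) \<in> measurable delay_borel (count_space UNIV)" unfolding k_def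
      by (intro measurable_restrict_space1) measurable
    then show "k -` {x} \<inter> space delay_borel \<in> sets delay_borel" for x by (rule measurable_sets) simp
  qed
  have simple: "cmod z \<le> 1 / R"
    if g: "simple_function delay_borel g" "\<And>\<theta>. \<theta> \<in> {-1..0} \<Longrightarrow> cmod (g \<theta>) < 1"
      and z: "z \<in> eigenvalues (matrix_integral M g)" for g z
  proof (rule ccontr)
    assume "\<not> cmod z \<le> 1 / R"
    then have zR: "1 / R < cmod z" by simp
    then have "z \<noteq> 0" using R by auto
    have zR: "cmod (1 / z) < R" using zR \<open>z \<noteq> 0\<close> R by (simp add: norm_divide field_simps)
    define u where "u \<theta> = (g \<theta>, k \<theta>)" for \<theta>
    have u: "simple_function delay_borel u" unfolding u_def
        by (rule simple_function_Pair[OF g(1) ksimple])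
    define I where "I = u ` {-1..0}"
    have I: "finite I" "u ` {-1..0} \<subseteq> I" using simple_functionD(1)[OF u] by (auto simp: I_def)
    have Ik: "1 \<le> snd i" "cmod (fst i) < 1" if "i \<in> I" for i using that k g(2)
        by (auto simp: I_def u_def)
    define C where "C i = (\<chi> a b. complex_of_real (measure_of_nbv M (u -` {i} \<inter> {-1..0}) $ a $ b))"
        for i
    \<comment> \<open>The point \<open>g/z\<close> is written as radius times a number of modulus
      below 1, which uses \<open>cmod (1/z) < R \<le> R^k\<close>.\<close>
    have "det (mat 1 - (\<chi> a b. \<Sum>i\<in>I. of_real ((1 * R) ^ snd i) * ((1 / z) * fst i / of_real R ^ snd
        i) * C i $ a $ b)) \<noteq> 0"
    proof (rule polydisc_no_zeros[where R = "\<lambda>t i. (t * R) ^ snd i"])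
      fix t :: real and \<zeta> :: "complex \<times> nat \<Rightarrow> complex"
      assume t: "t \<in> {0..1}" and \<zeta>: "\<And>i. i \<in> I \<Longrightarrow> cmod (\<zeta> i) = 1"
      show "det (mat 1 - (\<chi> a b. \<Sum>i\<in>I. of_real ((t * R) ^ snd i) * \<zeta> i * C i $ a $ b)) \<noteq> 0"
      proof (cases "t = 0")
        \<comment> \<open>The case \<open>s = \<infinity>\<close>: all radii vanish because
          \<open>k\<close> is at least 1.\<close>
        case True
        have "mat 1 - (\<chi> a b. \<Sum>i\<in>I. of_real ((t * R) ^ snd i) * \<zeta> i * C i $ a $ b) = mat 1"
        proof -
          have pow0: "(t * R) ^ snd i = 0" if "i \<in> I" for i using True Ik(1)[OF that] by simp
          have "(\<Sum>i\<in>I. of_real ((t * R) ^ snd i) * \<zeta> i * C i $ a $ b) = 0" for a b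
            by (intro sum.neutral ballI) (simp only: pow0 of_real_0 mult_zero_left)
          then show ?thesis by (simp only: vec_eq_iff vector_minus_component vec_lambda_beta
              diff_zero) simp
        qed
        then show ?thesis by simp
      next
        case False
        then have tR: "0 < t * R" using t R by auto
        \<comment> \<open>Solves \<open>exp (-s/n) = t R\<close>; since \<open>t \<le> 1\<close>, it
          satisfies \<open>s \<ge> -\<alpha>/2\<close>.\<close>
        define s where "s = - real n * ln (t * R)"
        have "ln (t * R) \<le> ln R" using tR t R
            by (subst ln_le_cancel_iff) (auto intro: mult_left_le_one_le)
        then have "real n * ln (t * R) \<le> real n * (\<alpha> / (2 * real n))"
            by (intro mult_left_mono) (auto simp: R_def)
        then have "- \<alpha> < s" using n \<alpha> by (simp add: s_def)
        have pow: "exp (- of_real s * of_real (real (snd i) / real n))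
            = complex_of_real ((t * R) ^ snd i)" for i :: "complex \<times> nat"
        proof -
          have "- s * (real (snd i) / real n) = real (snd i) * ln (t * R)" using n by (simp add: s_def)
          then have "exp (- s * (real (snd i) / real n)) = (t * R) ^ snd i" using tR
              by (simp add: exp_of_nat_mult)
          then show ?thesis by (metis exp_of_real of_real_minus of_real_mult)
        qed
        have "det (mat 1 - (\<chi> a b. \<Sum>i\<in>u ` {-1..0}. exp (- of_real s * of_real (real (snd i) / real
            n)) * \<zeta> i *
            of_real (measure_of_nbv M (u -` {i} \<inter> {-1..0}) $ a $ b))) \<noteq> 0"
        proof (rule locally_strongly_stable_torus_no_zeros[OF N M \<epsilon> stable u])
          fix \<theta> :: real assume \<theta>: "\<theta> \<in> {-1..0}"
          show "0 < real (snd (u \<theta>)) / real n \<and> real (snd (u \<theta>)) / real n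
              \<le> 1 \<and> \<bar>\<theta> + real (snd (u \<theta>)) / real n\<bar> \<le> \<epsilon> / 4"
            using k[of \<theta>] k\<theta>[OF \<theta>] n by (simp add: u_def)
        qed (use \<zeta> \<open>- \<alpha> < s\<close> in \<open>auto simp: I_def\<close>)
        then show ?thesis unfolding pow by (simp add: C_def I_def)
      qed
    next
      fix i assume i: "i \<in> I"
      show "(0 * R) ^ snd i = 0" using Ik(1)[OF i] by simp
      have "cmod (1 / z * fst i / of_real R ^ snd i) = cmod (1 / z) * cmod (fst i) / R ^ snd i"
        using R by (simp add: norm_mult norm_divide norm_power)
      also have "\<dots> \<le> cmod (1 / z) * 1 / R ^ snd i"
        using Ik(2)[OF i] R by (intro divide_right_mono mult_left_mono) auto
      also have "\<dots> < R / R ^ snd i" using zR R by (intro divide_strict_right_mono) auto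
      also have "\<dots> \<le> 1" using R Ik(1)[OF i] self_le_power[of R "snd i"] by simp
      finally show "cmod (1 / z * fst i / of_real R ^ snd i) < 1" .
    qed (intro continuous_intros)
    moreover have "(\<chi> a b. \<Sum>i\<in>I. of_real ((1 * R) ^ snd i) * ((1 / z) * fst i / of_real R ^ snd i) *
        C i $ a $ b)
        = (\<chi> a b. (1 / z) * matrix_integral M g $ a $ b)"
    proof -
      have "matrix_integral M g = (\<chi> a b. \<Sum>i\<in>I. fst i * C i $ a $ b)"
        using matrix_integral_simple[OF M u I, of fst] by (simp add: u_def C_def)
      then show ?thesis using R by (simp add: vec_eq_iff sum_distrib_left mult_ac)
    qed
    ultimately show False using z eigenvalue_iff_pencil[OF \<open>z \<noteq> 0\<close>, of "matrix_integral M g"]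
        by (simp add: poly_pencil)
  qed
  have "rho_HS M \<le> 1 / R"
  proof (rule rho_HS_least)
    fix \<xi> :: "real \<Rightarrow> real" and z
    assume \<xi>: "\<xi> \<in> borel_measurable delay_borel"
        and z: "z \<in> eigenvalues (matrix_integral M (\<lambda>\<theta>. exp (\<i> * of_real (\<xi> \<theta>))))"
    show "cmod z \<le> 1 / R"
    proof (rule eigenvalues_limit[OF M _ simple _ _ z])
      show "(\<lambda>\<theta>. exp (\<i> * of_real (\<xi> \<theta>))) \<in> borel_measurable delay_borel" using \<xi> by measurable
    qed (use R in auto)
  qed
  also have "\<dots> < 1" using R by simp
  finally show ?thesis .
qed

theorem theorem4p9:
  fixes N :: "real^'n \<Rightarrow> real" and M :: "real \<Rightarrow> real^'n^'n"
  assumes "is_norm N"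
    and "M \<in> spectral_growth N"
  shows "(rho_HS M < 1 \<longleftrightarrow> strongly_stable_uniform N M) \<and>
    (strongly_stable_uniform N M \<longleftrightarrow> locally_strongly_stable_uniform N M)"
proof -
  have M: "matrix_difference (measure_of_nbv M)"
    using assms by (intro matrix_difference_of_nbv) (auto simp: spectral_growth_def well_posed_def)
  have "locally_strongly_stable_uniform N M" if "strongly_stable_uniform N M"
    using that unfolding strongly_stable_uniform_def locally_strongly_stable_uniform_def
    by (meson zero_less_one)
  then show ?thesis
    using strongly_stable_if_rho_HS_less_1[OF M] rho_HS_less_1_if_locally_strongly_stable[OF
        assms(1) M] by blast
qed

end
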